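(* Let $c=m/n$ where $m,n\in\mathbb Z_{>0}$, $\gcd(m,n)=1$, and let $H_c=H_{1,c}(\mathcal S_n,\mathbb C^n)$. Then the following holds. (a) $\Delta_c(\mathrm{triv})$ has a basis $v_{\mathbf a}$ labeled by sequences $\mathbf a=(a_1,\dots,a_n)$ of nonnegative integers. The action of $u_i,\tau,\lambda$ in this basis is given by $$u_iv_{\mathbf a}=\mathtt w_iv_{\mathbf a},\qquad \tau v_{\mathbf a}=v_{\pi\cdot\mathbf a},\qquad \lambda v_{\mathbf a}=\mathtt w_1v_{\pi^{-1}\cdot\mathbf a},$$ where $\mathtt w_i=a_i-(g_{\mathbf a}(i)-1)c$ and $\pi\cdot(a_1,\dots,a_n)=(a_n+1,a_1,\dots,a_{n-1})$ (if $a_1=0$ then $\mathtt w_1=0$ and $\lambda v_{\mathbf a}=0$). The action of $\mathcal S_n$ in this basis is given by $$s_iv_{\mathbf a}=\begin{cases}v_{s_i\cdot\mathbf a}+\frac{c}{\mathtt w_i-\mathtt w_{i+1}}v_{\mathbf a}& a_i>a_{i+1},\\[2pt] \frac{(\mathtt w_{i+1}-\mathtt w_i-c)(\mathtt w_{i+1}-\mathtt w_i+c)}{(\mathtt w_i-\mathtt w_{i+1})^2}v_{s_i\cdot\mathbf a}+\frac{c}{\mathtt w_i-\mathtt w_{i+1}}v_{\mathbf a}& a_i<a_{i+1},\\[2pt] v_{\mathbf a}&a_i=a_{i+1}.\end{cases}$$ (b) $L_c(\mathrm{triv})$ has a basis given by (the images of) those $v_{\mathbf a}$ for which $|a_i-a_j|\le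 m$ for all $i,j$, and $a_i-a_j=m$ implies $i<j$.
   Context: $H_{1,c}(\mathcal S_n,\mathbb C^n)$ is the quotient of $\mathbb C\langle x_1,\dots,x_n,y_1,\dots,y_n\rangle\rtimes\mathcal S_n$ by $[x_i,x_j]=[y_i,y_j]=0$, $[y_i,x_j]=c\,(ij)$ for $i\ne j$, $[y_i,x_i]=1-c\sum_{j\ne i}(ij)$. $s_i=(i,i+1)$, $u_i=x_iy_i-c\sum_{j<i}(ij)$, $\tau=x_1(12\cdots n)$, $\lambda=(12\cdots n)^{-1}y_1$. $\Delta_c(\mathrm{triv})=\mathrm{Ind}_{\mathbb C[y_1,\dots,y_n]\rtimes\mathcal S_n}^{H_c}\mathrm{triv}\cong\mathbb C[x_1,\dots,x_n]$ (with $y_i$ acting by $0$ on $\mathrm{triv}$), and $L_c(\mathrm{triv})$ is its unique irreducible quotient. For $\mathbf a\in\mathbb Z_{\ge0}^n$, $g_{\mathbf a}\in\mathcal S_n$ is the minimal length permutation sorting $\mathbf a$ to be non-decreasing: $g_{\mathbf a}(i)=\#\{j:a_j<a_i\}+\#\{j\le i:a_j=a_i\}$. $s_i\cdot\mathbf a$ swaps $a_i$ and $a_{i+1}$. *)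

theory Defs
  imports
    Complex_Main
    "HOL-Library.Poly_Mapping"
    "HOL-Library.FuncSet"
    "HOL-Combinatorics.Perm"
    "HOL-Algebra.QuotRing"
    "HOL-Algebra.Module"
    "HOL-Algebra.Generated_Groups"
    "HOL-Algebra.Free_Abelian_Groups"
begin

section \<open>The smash product of a free algebra with a symmetric group\<close>

datatype letter = Xl nat | Yl nat

fun perm_letter :: "nat perm \<Rightarrow> letter \<Rightarrow> letter" where
  "perm_letter p (Xl i) = Xl (Perm.apply p i)"
| "perm_letter p (Yl i) = Yl (Perm.apply p i)"

text \<open>
  \<open>Smash u p\<close> stands for the word \<open>u\<close> followed by the permutation \<open>p\<close>.  These
  form the semidirect product monoid with \<open>p u p\<^sup>-\<^sup>1 = p(u)\<close>.  It is written
  additively because keys of type \<^typ>\<open>'a \<Rightarrow>\<^sub>0 'b\<close> are, so that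
  \<^typ>\<open>complex\<close>-valued finitely supported functions on it carry the product
  of its monoid algebra.
\<close>

datatype smash_word = Smash (word: "letter list") (perm: "nat perm")

instantiation smash_word :: monoid_add
begin

definition zero_smash_word :: smash_word where
  "0 = Smash [] 1"

definition plus_smash_word :: "smash_word \<Rightarrow> smash_word \<Rightarrow> smash_word" where
  "k + l = Smash (word k @ map (perm_letter (perm k)) (word l)) (perm k * perm l)"

instance
proof
  have one: "perm_letter 1 x = x" for x
    by (cases x) simp_all
  have mult: "perm_letter (p * q) x = perm_letter p (perm_letter q x)" for p q x
    by (cases x) (simp_all add: apply_times)
  fix k l r :: smash_word
  show "k + l + r = k + (l + r)"
    by (simp add: plus_smash_word_def mult mult.assoc)
  show "0 + k = k"
    by (simp add: plus_smash_word_def zero_smash_word_def one cong: map_cong)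
  show "k + 0 = k"
    by (simp add: plus_smash_word_def zero_smash_word_def)
qed

end

type_synonym smash = "smash_word \<Rightarrow>\<^sub>0 complex"

definition const :: "complex \<Rightarrow> smash" where
  "const z = Poly_Mapping.single 0 z"

definition xg :: "nat \<Rightarrow> smash" where
  "xg i = Poly_Mapping.single (Smash [Xl i] 1) 1"

definition yg :: "nat \<Rightarrow> smash" where
  "yg i = Poly_Mapping.single (Smash [Yl i] 1) 1"

definition pg :: "nat perm \<Rightarrow> smash" where
  "pg p = Poly_Mapping.single (Smash [] p) 1"

text \<open>
  \<open>smash_algebra V n\<close> is \<open>\<complex>\<langle>V\<rangle> \<rtimes> S\<^sub>n\<close>, for a set \<open>V\<close> of letters that is stable
  under \<open>S\<^sub>n\<close>, the latter realised as the permutations moving only \<open>1, \<dots>, n\<close>.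
\<close>

definition smash_algebra :: "letter set \<Rightarrow> nat \<Rightarrow> smash ring" where
  "smash_algebra V n =
    \<lparr>carrier = {f. \<forall>k \<in> Poly_Mapping.keys f. set (word k) \<subseteq> V \<and> affected (perm k) \<subseteq> {1..n}},
     monoid.mult = (*), one = 1, ring.zero = 0, add = (+)\<rparr>"

section \<open>The rational Cherednik algebra\<close>

definition xy_smash :: "nat \<Rightarrow> smash ring" where
  "xy_smash n = smash_algebra (Xl ` {1..n} \<union> Yl ` {1..n}) n"

definition cherednik_relators :: "nat \<Rightarrow> complex \<Rightarrow> smash set" where
  "cherednik_relators n c =
     {xg i * xg j - xg j * xg i | i j. i \<in> {1..n} \<and> j \<in> {1..n}}
   \<union> {yg i * yg j - yg j * yg i | i j. i \<in> {1..n} \<and> j \<in> {1..n}}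
   \<union> {(yg i * xg j - xg j * yg i) - const c * pg (Perm.swap i j)
        | i j. i \<in> {1..n} \<and> j \<in> {1..n} \<and> i \<noteq> j}
   \<union> {(yg i * xg i - xg i * yg i) - (1 - const c * (\<Sum>j \<in> {1..n} - {i}. pg (Perm.swap i j)))
        | i. i \<in> {1..n}}"

definition cherednik_ideal :: "nat \<Rightarrow> complex \<Rightarrow> smash set" where
  "cherednik_ideal n c = genideal (xy_smash n) (cherednik_relators n c)"

definition cherednik :: "nat \<Rightarrow> complex \<Rightarrow> smash set ring" where
  "cherednik n c = xy_smash n Quot cherednik_ideal n c"

definition H_class :: "nat \<Rightarrow> complex \<Rightarrow> smash \<Rightarrow> smash set" where
  "H_class n c f = cherednik_ideal n c +>\<^bsub>xy_smash n\<^esub> f"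

definition H_scalar :: "nat \<Rightarrow> complex \<Rightarrow> complex \<Rightarrow> smash set" where
  "H_scalar n c z = H_class n c (const z)"

definition H_s :: "nat \<Rightarrow> complex \<Rightarrow> nat \<Rightarrow> smash set" where
  "H_s n c i = H_class n c (pg (Perm.swap i (i + 1)))"

definition H_u :: "nat \<Rightarrow> complex \<Rightarrow> nat \<Rightarrow> smash set" where
  "H_u n c i = H_class n c (xg i * yg i - const c * (\<Sum>j \<in> {1..<i}. pg (Perm.swap i j)))"

definition long_cycle :: "nat \<Rightarrow> nat perm" where
  "long_cycle n = Perm.cycle [1..<n + 1]"

definition H_tau :: "nat \<Rightarrow> complex \<Rightarrow> smash set" where
  "H_tau n c = H_class n c (xg 1 * pg (long_cycle n))"

definition H_lambda :: "nat \<Rightarrow> complex \<Rightarrow> smash set" where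
  "H_lambda n c = H_class n c (pg (inverse (long_cycle n)) * yg 1)"

section \<open>Left modules\<close>

text \<open>
  Left modules over noncommutative rings are given by records of type
  \<^typ>\<open>('r, 'v) module\<close>, whose components \<open>mult\<close> and \<open>one\<close> play no role.
\<close>

definition quotient_module :: "('r, 'v) module \<Rightarrow> 'v set \<Rightarrow> ('r, 'v set) module" where
  "quotient_module M N =
    \<lparr>carrier = a_rcosets\<^bsub>M\<^esub> N, monoid.mult = undefined, one = undefined,
     ring.zero = N, add = set_add M,
     smult = (\<lambda>r A. \<Union>x \<in> A. N +>\<^bsub>M\<^esub> (r \<odot>\<^bsub>M\<^esub> x))\<rparr>"

definition irreducible_module :: "'r ring \<Rightarrow> ('r, 'v) module \<Rightarrow> bool" where
  "irreducible_module R M \<longleftrightarrow>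
     carrier M \<noteq> {\<zero>\<^bsub>M\<^esub>} \<and>
     (\<forall>N. submodule N R M \<longrightarrow> N = {\<zero>\<^bsub>M\<^esub>} \<or> N = carrier M)"

text \<open>
  \<open>H \<otimes>\<^sub>B V\<close> for a ring homomorphism \<open>\<phi>\<close> from \<open>B\<close> to \<open>H\<close> and a left \<open>B\<close>-module \<open>V\<close>:
  the free abelian group on the pairs \<open>(h, v)\<close> modulo the biadditivity and
  \<open>B\<close>-balancedness relations.
\<close>

definition tensor_relators ::
  "'b ring \<Rightarrow> 'h ring \<Rightarrow> ('b \<Rightarrow> 'h) \<Rightarrow> ('b, 'v) module \<Rightarrow> ('h \<times> 'v \<Rightarrow>\<^sub>0 int) set" where
  "tensor_relators B H \<phi> V =
     {frag_of (h \<oplus>\<^bsub>H\<^esub> h', v) - (frag_of (h, v) + frag_of (h', v))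
        | h h' v. h \<in> carrier H \<and> h' \<in> carrier H \<and> v \<in> carrier V}
   \<union> {frag_of (h, v \<oplus>\<^bsub>V\<^esub> v') - (frag_of (h, v) + frag_of (h, v'))
        | h v v'. h \<in> carrier H \<and> v \<in> carrier V \<and> v' \<in> carrier V}
   \<union> {frag_of (h \<otimes>\<^bsub>H\<^esub> \<phi> b, v) - frag_of (h, b \<odot>\<^bsub>V\<^esub> v)
        | h b v. h \<in> carrier H \<and> b \<in> carrier B \<and> v \<in> carrier V}"

definition free_pairs_module ::
  "'h ring \<Rightarrow> ('b, 'v) module \<Rightarrow> ('h, 'h \<times> 'v \<Rightarrow>\<^sub>0 int) module" where
  "free_pairs_module H V =
    \<lparr>carrier = carrier (free_Abelian_group (carrier H \<times> carrier V)),
     monoid.mult = undefined, one = undefined, ring.zero = 0, add = (+),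
     smult = (\<lambda>r. frag_extend (\<lambda>(h, v). frag_of (r \<otimes>\<^bsub>H\<^esub> h, v)))\<rparr>"

definition induced_module ::
  "'b ring \<Rightarrow> 'h ring \<Rightarrow> ('b \<Rightarrow> 'h) \<Rightarrow> ('b, 'v) module \<Rightarrow> ('h, ('h \<times> 'v \<Rightarrow>\<^sub>0 int) set) module" where
  "induced_module B H \<phi> V =
     quotient_module (free_pairs_module H V)
       (generate (free_Abelian_group (carrier H \<times> carrier V)) (tensor_relators B H \<phi> V))"

text \<open>
  The family \<open>v\<close>, indexed by \<open>A\<close>, is a basis of \<open>M\<close> over \<open>\<complex>\<close>, where complex numbers
  act on \<open>M\<close> through \<open>\<iota>\<close>.
\<close>

definition complex_basis ::
  "(complex \<Rightarrow> 'r) \<Rightarrow> ('r, 'v) module \<Rightarrow> 'i set \<Rightarrow> ('i \<Rightarrow> 'v) \<Rightarrow> bool" where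
  "complex_basis \<iota> M A v \<longleftrightarrow>
     v \<in> A \<rightarrow> carrier M \<and>
     (\<forall>F k. finite F \<and> F \<subseteq> A \<and> (\<Oplus>\<^bsub>M\<^esub>a \<in> F. \<iota> (k a) \<odot>\<^bsub>M\<^esub> v a) = \<zero>\<^bsub>M\<^esub> \<longrightarrow> (\<forall>a \<in> F. k a = 0)) \<and>
     (\<forall>x \<in> carrier M. \<exists>F k. finite F \<and> F \<subseteq> A \<and> x = (\<Oplus>\<^bsub>M\<^esub>a \<in> F. \<iota> (k a) \<odot>\<^bsub>M\<^esub> v a))"

section \<open>The standard module of the trivial representation and its irreducible quotient\<close>

definition y_smash :: "nat \<Rightarrow> smash ring" where
  "y_smash n = smash_algebra (Yl ` {1..n}) n"

text \<open>\<open>\<complex>[y\<^sub>1, \<dots>, y\<^sub>n] \<rtimes> S\<^sub>n\<close>\<close>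

definition y_poly_smash :: "nat \<Rightarrow> smash set ring" where
  "y_poly_smash n = y_smash n Quot
     genideal (y_smash n) {yg i * yg j - yg j * yg i | i j. i \<in> {1..n} \<and> j \<in> {1..n}}"

text \<open>
  The canonical homomorphism to the Cherednik algebra; for a coset \<open>b\<close>, the set
  sum below is the coset of the Cherednik ideal that contains \<open>b\<close>.
\<close>

definition y_poly_smash_to_H :: "nat \<Rightarrow> complex \<Rightarrow> smash set \<Rightarrow> smash set" where
  "y_poly_smash_to_H n c b = cherednik_ideal n c <+>\<^bsub>xy_smash n\<^esub> b"

text \<open>The character with \<open>y\<^sub>i \<mapsto> 0\<close> and \<open>p \<mapsto> 1\<close> for permutations \<open>p\<close>.\<close>

definition triv_char :: "smash \<Rightarrow> complex" where
  "triv_char f = (\<Sum>k \<in> {k \<in> Poly_Mapping.keys f. word k = []}. Poly_Mapping.lookup f k)"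

definition triv_module :: "(smash set, complex) module" where
  "triv_module =
    \<lparr>carrier = UNIV, monoid.mult = undefined, one = undefined, ring.zero = 0, add = (+),
     smult = (\<lambda>b z. the_elem (triv_char ` b) * z)\<rparr>"

type_synonym delta = "(smash set \<times> complex \<Rightarrow>\<^sub>0 int) set"

definition Delta_triv :: "nat \<Rightarrow> complex \<Rightarrow> (smash set, delta) module" where
  "Delta_triv n c =
     induced_module (y_poly_smash n) (cherednik n c) (y_poly_smash_to_H n c) triv_module"

definition L_kernel :: "nat \<Rightarrow> complex \<Rightarrow> delta set" where
  "L_kernel n c = (THE N. submodule N (cherednik n c) (Delta_triv n c) \<and>
     irreducible_module (cherednik n c) (quotient_module (Delta_triv n c) N))"

definition L_triv :: "nat \<Rightarrow> complex \<Rightarrow> (smash set, delta set) module" where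
  "L_triv n c = quotient_module (Delta_triv n c) (L_kernel n c)"

definition L_proj :: "nat \<Rightarrow> complex \<Rightarrow> delta \<Rightarrow> delta set" where
  "L_proj n c x = L_kernel n c +>\<^bsub>Delta_triv n c\<^esub> x"

section \<open>Combinatorics of sequences\<close>

definition seqs :: "nat \<Rightarrow> (nat \<Rightarrow> nat) set" where
  "seqs n = ({1..n} \<rightarrow>\<^sub>E UNIV)"

definition sort_perm :: "nat \<Rightarrow> (nat \<Rightarrow> nat) \<Rightarrow> nat \<Rightarrow> nat" where
  "sort_perm n a i = card {j \<in> {1..n}. a j < a i} + card {j \<in> {1..i}. a j = a i}"

definition wt :: "nat \<Rightarrow> complex \<Rightarrow> (nat \<Rightarrow> nat) \<Rightarrow> nat \<Rightarrow> complex" where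
  "wt n c a i = of_nat (a i) - (of_nat (sort_perm n a i) - 1) * c"

definition pi_seq :: "nat \<Rightarrow> (nat \<Rightarrow> nat) \<Rightarrow> nat \<Rightarrow> nat" where
  "pi_seq n a = (\<lambda>i \<in> {1..n}. if i = 1 then a n + 1 else a (i - 1))"

text \<open>Inverse to \<open>pi_seq n\<close> on sequences with \<open>a\<^sub>1 > 0\<close>; the subtraction truncates otherwise.\<close>

definition pi_inv_seq :: "nat \<Rightarrow> (nat \<Rightarrow> nat) \<Rightarrow> nat \<Rightarrow> nat" where
  "pi_inv_seq n a = (\<lambda>i \<in> {1..n}. if i = n then a 1 - 1 else a (i + 1))"

definition swap_seq :: "nat \<Rightarrow> (nat \<Rightarrow> nat) \<Rightarrow> nat \<Rightarrow> nat" where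
  "swap_seq i a = a(i := a (i + 1), i + 1 := a i)"

end

theory Submission
  imports Defs
begin

text \<open>
  The Dunkl operators \<open>y\<^sub>i = \<partial>\<^sub>i - c \<Sum>\<^sub>j\<^sub>\<noteq>\<^sub>i (1 - s\<^sub>i\<^sub>j) / (x\<^sub>i - x\<^sub>j)\<close> make \<open>\<complex>[x\<^sub>1, \<dots>, x\<^sub>n]\<close> an
  \<open>H\<^sub>c\<close>-module that is isomorphic to \<open>\<Delta>\<^sub>c(triv)\<close>: the defining relations rewrite every element
  \<open>h \<otimes> 1\<close> as \<open>f(x) \<otimes> 1\<close> for a polynomial \<open>f\<close>, and \<open>f\<close> is recovered as the action of \<open>h\<close> on \<open>1\<close>.

  On monomials, \<open>u\<^sub>i x\<^sup>a = w\<^sub>i x\<^sup>a\<close> up to monomials with a smaller value of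
  \<open>\<mu>(a) = \<Sum>\<^sub>l (n a\<^sub>l + l)\<^sup>2\<close>. As \<open>gcd(m, n) = 1\<close>, the weight \<open>w\<close> determines \<open>a\<close>, so a joint
  eigenvector of weight \<open>w(a)\<close> has leading monomial \<open>x\<^sup>a\<close> and is unique up to scaling; \<open>v\<^sub>a\<close> is the one
  with leading coefficient 1. It exists because \<open>\<tau>\<close> and the intertwiners
  \<open>s\<^sub>i - c / (w\<^sub>i - w\<^sub>i\<^sub>+\<^sub>1)\<close> for \<open>a\<^sub>i > a\<^sub>i\<^sub>+\<^sub>1\<close> reach every \<open>v\<^sub>a\<close> from \<open>v\<^sub>0 = 1\<close> and preserve leading
  coefficients. All formulas of part (a) follow by uniqueness.

  Since the joint spectrum is simple, submodules are spanned by subsets of the \<open>v\<^sub>a\<close>. The coefficient of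
  \<open>v\<close> at \<open>s\<^sub>i a\<close> in \<open>s\<^sub>i v\<^sub>a\<close> for \<open>a\<^sub>i < a\<^sub>i\<^sub>+\<^sub>1\<close> vanishes exactly when \<open>w\<^sub>i\<^sub>+\<^sub>1 - w\<^sub>i = \<plusminus>c\<close>, which cuts the
  sequences of part (b) off from the others: the remaining \<open>v\<^sub>a\<close> span a submodule, while every sequence of
  part (b) can be moved back to \<open>0\<close>. Hence that span is the largest proper submodule.
\<close>

text \<open>A difference of two weights has the form \<open>d - e c\<close> with integers
  \<open>d\<close>, \<open>e\<close> and \<open>|e| < n\<close>. If it vanishes, then
  \<open>d n = e m\<close>, so \<open>n\<close> divides \<open>e\<close> and
  \<open>d = e = 0\<close>; this separates weights. For the numerators
  \<open>w_{i+1} - w_i - c\<close> and \<open>w_{i+1} - w_i + c\<close> the range grows to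
  \<open>|e| \<le> n\<close>, and the new solutions have \<open>d = m\<close> or
  \<open>d = - m\<close>: this is where the bound \<open>m\<close> of part (b) comes from.

  The shape of \<open>mu\<close> is dictated by the divided differences. Dividing by
  \<open>x_i - x_j\<close> and multiplying by \<open>x_i\<close> yields exponent pairs between the
  two original ones, which lowers the sum of squares; only a monomial and its transpose tie, and the
  summand \<open>l\<close> decides between them in favour of the order used by \<open>g_a\<close>.

  The induced module is a quotient of a free abelian group, so neither a spanning set nor the
  absence of collapse is visible. Rewriting gives the first; the second follows because sending
  \<open>h \<otimes> v\<close> to \<open>v\<close> times the polynomial \<open>h(1)\<close> respects
  all tensor relations.

  The formulas for \<open>\<lambda>\<close> are obtained from those for \<open>\<tau>\<close> by
  \<open>\<tau> \<lambda> = u_1\<close> and the injectivity of \<open>\<tau>\<close>.\<close>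

abbreviation "lookup \<equiv> Poly_Mapping.lookup"
abbreviation "keys \<equiv> Poly_Mapping.keys"
abbreviation "single \<equiv> Poly_Mapping.single"
abbreviation "papply \<equiv> Perm.apply"
abbreviation "swp \<equiv> Perm.swap"

section \<open>Linear maps between monoid algebras\<close>

lemma poly_mapping_eq_sum_single: "f = (\<Sum>k\<in>keys f. single k (lookup f k))"
proof (rule poly_mapping_eqI)
  fix l
  have "(\<Sum>k\<in>keys f. lookup (single k (lookup f k)) l) = (\<Sum>k\<in>keys f. if k = l then lookup f l else 0)"
    by (rule sum.cong) (auto simp: lookup_single)
  also have "\<dots> = lookup f l"
    by (auto simp: in_keys_iff)
  finally show "lookup f l = lookup (\<Sum>k\<in>keys f. single k (lookup f k)) l"
    by (simp add: lookup_sum)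
qed

lemma poly_mapping_induct_on [consumes 1, case_names zero single add]:
  fixes f :: "'k \<Rightarrow>\<^sub>0 'v::comm_monoid_add"
  assumes "keys f \<subseteq> K"
    and "P 0"
    and "\<And>k v. k \<in> K \<Longrightarrow> P (single k v)"
    and "\<And>f g. keys f \<subseteq> K \<Longrightarrow> keys g \<subseteq> K \<Longrightarrow> P f \<Longrightarrow> P g \<Longrightarrow> P (f + g)"
  shows "P f"
proof -
  have "keys (\<Sum>k\<in>A. single k (lookup f k)) \<subseteq> K \<and> P (\<Sum>k\<in>A. single k (lookup f k))"
    if "finite A" "A \<subseteq> K" for A
    using that
  proof (induction A rule: finite_induct)
    case (insert x F)
    have "keys (single x (lookup f x)) \<subseteq> K" using insert.prems by simp
    moreover have "keys (single x (lookup f x) + (\<Sum>k\<in>F. single k (lookup f k)))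
       \<subseteq> keys (single x (lookup f x)) \<union> keys (\<Sum>k\<in>F. single k (lookup f k))"
      by (rule keys_add)
    ultimately show ?case using insert assms by auto
  qed (use assms in auto)
  from this[of "keys f"] show ?thesis
    using assms(1) by (simp flip: poly_mapping_eq_sum_single)
qed

text \<open>Polynomials and the smash product are both monoid algebras, with exponents and words as
  keys. Scalars are elements of the algebra itself, so the same notion of linearity covers maps
  between the two.\<close>

definition scl :: "complex \<Rightarrow> ('m::monoid_add \<Rightarrow>\<^sub>0 complex)" where
  "scl z = single 0 z"

lemma scl_0 [simp]: "scl 0 = 0" and scl_1 [simp]: "scl 1 = 1"
  by (simp_all add: scl_def)

lemma scl_add: "scl (a + b) = scl a + scl b"
  and scl_diff: "scl (a - b) = scl a - scl b"
  and scl_uminus: "scl (- a) = - scl a"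
  and scl_mult: "scl (a * b) = scl a * scl b"
  by (simp_all add: scl_def single_add single_diff single_uminus mult_single)

lemma scl_single: "scl z * single k v = single k (z * v)"
  by (simp add: scl_def mult_single)

lemma single_eq_scl: "single k v = scl v * single k 1"
  by (simp add: scl_single)

text \<open>The key \<open>0\<close> is neutral on both sides, so scalars are central even when the
  monoid of keys is not commutative, as for the smash product.\<close>

lemma scl_commute: "f * scl z = scl z * f"
proof -
  have "keys f \<subseteq> UNIV" by simp
  then show ?thesis
    by (induction f rule: poly_mapping_induct_on)
       (simp_all add: scl_def mult_single distrib_left distrib_right mult.commute)
qed

lemma lookup_scl_mult: "lookup (scl z * f) b = z * lookup f b"
proof -
  have "keys f \<subseteq> UNIV" by simp
  then show ?thesis
    by (induction f rule: poly_mapping_induct_on)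
       (simp_all add: scl_def mult_single lookup_single distrib_left lookup_add when_def)
qed

lemma lookup_scl: "lookup (scl z) b = (if b = 0 then z else 0)"
  by (auto simp: scl_def lookup_single when_def)

lemma scl_eq_0_iff [simp]: "scl z = 0 \<longleftrightarrow> z = 0"
  by (metis lookup_scl lookup_zero scl_0)

lemma scl_inverse_cancel: "z \<noteq> 0 \<Longrightarrow> scl (1 / z) * (scl z * f) = f"
  by (simp flip: mult.assoc scl_mult)

lemma keys_scl_mult: "keys (scl z * f) \<subseteq> keys f"
  by (auto simp: in_keys_iff lookup_scl_mult)

definition clinear :: "(('k::monoid_add \<Rightarrow>\<^sub>0 complex) \<Rightarrow> ('m::monoid_add \<Rightarrow>\<^sub>0 complex)) \<Rightarrow> bool" where
  "clinear L \<longleftrightarrow> (\<forall>f g. L (f + g) = L f + L g) \<and> (\<forall>z f. L (scl z * f) = scl z * L f)"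

lemma clinearI:
  "(\<And>f g. L (f + g) = L f + L g) \<Longrightarrow> (\<And>z f. L (scl z * f) = scl z * L f) \<Longrightarrow> clinear L"
  by (simp add: clinear_def)

context
  fixes L :: "('k::monoid_add \<Rightarrow>\<^sub>0 complex) \<Rightarrow> ('m::monoid_add \<Rightarrow>\<^sub>0 complex)"
  assumes L: "clinear L"
begin

lemma clinear_add: "L (f + g) = L f + L g"
  and clinear_scl: "L (scl z * f) = scl z * L f"
  using L by (simp_all add: clinear_def)

lemma clinear_0: "L 0 = 0"
  using clinear_scl[of 0 0] by simp

lemma clinear_uminus: "L (- f) = - L f"
  using clinear_scl[of "-1" f] by (simp add: scl_uminus)

lemma clinear_diff: "L (f - g) = L f - L g"
  using clinear_add[of f "- g"] by (simp add: clinear_uminus)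

lemma clinear_sum: "L (\<Sum>x\<in>A. h x) = (\<Sum>x\<in>A. L (h x))"
  by (induction A rule: infinite_finite_induct) (simp_all add: clinear_0 clinear_add)

end

lemma clinear_eqI:
  assumes "clinear L" "clinear L'" and "keys f \<subseteq> K"
    and "\<And>k. k \<in> K \<Longrightarrow> L (single k 1) = L' (single k 1)"
  shows "L f = L' f"
  using assms(3)
proof (induction f rule: poly_mapping_induct_on)
  case (single k v)
  then show ?case
    using assms by (subst (1 2) single_eq_scl) (simp add: clinear_scl)
qed (simp_all add: clinear_0 clinear_add assms)

lemma clinear_eqI':
  assumes "clinear L" "clinear L'" and "\<And>k. L (single k 1) = L' (single k 1)"
  shows "L f = L' f"
  using clinear_eqI[OF assms(1,2) subset_UNIV] assms(3) by blast

lemma clinear_id: "clinear (\<lambda>f. f)"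
  and clinear_const_0: "clinear (\<lambda>f. 0)"
  by (simp_all add: clinear_def)

lemma clinear_plus:
  "clinear L \<Longrightarrow> clinear L' \<Longrightarrow> clinear (\<lambda>f. L f + L' f)"
  by (simp add: clinear_def algebra_simps)

lemma clinear_minus:
  "clinear L \<Longrightarrow> clinear L' \<Longrightarrow> clinear (\<lambda>f. L f - L' f)"
  by (simp add: clinear_def algebra_simps)

lemma clinear_compose:
  "clinear L \<Longrightarrow> clinear L' \<Longrightarrow> clinear (\<lambda>f. L (L' f))"
  by (simp add: clinear_def)

lemma clinear_mult_left: "clinear L \<Longrightarrow> clinear (\<lambda>f. g * L f)"
  unfolding clinear_def by (metis distrib_left mult.assoc scl_commute)

lemma clinear_mult_right: "clinear L \<Longrightarrow> clinear (\<lambda>f. L f * g)"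
  by (simp add: clinear_def distrib_right mult.assoc)

lemma clinear_sum_fun: "(\<And>x. x \<in> A \<Longrightarrow> clinear (L x)) \<Longrightarrow> clinear (\<lambda>f. \<Sum>x\<in>A. L x f)"
  by (simp add: clinear_def sum.distrib sum_distrib_left)

lemmas clinear_intros = clinear_id clinear_const_0 clinear_plus clinear_minus
  clinear_mult_left clinear_mult_right clinear_sum_fun

definition lin_ext ::
  "('k \<Rightarrow> ('m::monoid_add \<Rightarrow>\<^sub>0 complex)) \<Rightarrow> ('k \<Rightarrow>\<^sub>0 complex) \<Rightarrow> ('m \<Rightarrow>\<^sub>0 complex)" where
  "lin_ext g f = (\<Sum>k\<in>keys f. scl (lookup f k) * g k)"

lemma lin_ext_superset:
  "finite A \<Longrightarrow> keys f \<subseteq> A \<Longrightarrow> lin_ext g f = (\<Sum>k\<in>A. scl (lookup f k) * g k)"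
  unfolding lin_ext_def by (rule sum.mono_neutral_left) (auto simp: in_keys_iff)

lemma lin_ext_add: "lin_ext g (f + h) = lin_ext g f + lin_ext g h"
proof -
  let ?A = "keys f \<union> keys h"
  have "lin_ext g (f + h) = (\<Sum>k\<in>?A. scl (lookup (f + h) k) * g k)"
    by (rule lin_ext_superset) (use keys_add[of f h] in auto)
  also have "\<dots> = (\<Sum>k\<in>?A. scl (lookup f k) * g k) + (\<Sum>k\<in>?A. scl (lookup h k) * g k)"
    by (simp add: lookup_add scl_add distrib_right sum.distrib)
  also have "\<dots> = lin_ext g f + lin_ext g h"
    by (simp add: lin_ext_superset[of ?A])
  finally show ?thesis .
qed

lemma lin_ext_single: "lin_ext g (single k v) = scl v * g k"
  by (cases "v = 0") (simp_all add: lin_ext_def)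

lemma clinear_lin_ext: "clinear (lin_ext g)"
proof (rule clinearI)
  fix z f
  have "lin_ext g (scl z * f) = (\<Sum>k\<in>keys f. scl (lookup (scl z * f) k) * g k)"
    by (rule lin_ext_superset) (auto simp: keys_scl_mult in_keys_iff lookup_scl_mult)
  then show "lin_ext g (scl z * f) = scl z * lin_ext g f"
    by (simp add: lin_ext_def sum_distrib_left lookup_scl_mult scl_mult mult.assoc)
qed (rule lin_ext_add)

lemma lin_ext_0 [simp]: "lin_ext g 0 = 0"
  by (simp add: lin_ext_def)

section \<open>Polynomials and Dunkl operators\<close>

type_synonym mpol = "(nat \<Rightarrow>\<^sub>0 nat) \<Rightarrow>\<^sub>0 complex"

definition var :: "nat \<Rightarrow> mpol" where
  "var i = single (single i 1) 1"

lemma var_mult_single: "var i * single a v = single (single i 1 + a) v"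
  by (simp add: var_def mult_single)

lemma var_diff_nonzero: "i \<noteq> j \<Longrightarrow> var i - var j \<noteq> 0"
proof
  assume ij: "i \<noteq> j" and "var i - var j = 0"
  then have "lookup (var i) (single i 1) = lookup (var j) (single i 1)" by simp
  then have "single i (1::nat) = single j 1"
    by (simp add: var_def lookup_single when_def split: if_splits)
  then have "lookup (single i (1::nat)) i = lookup (single j 1) i" by simp
  then show False using ij by (simp add: lookup_single_not_eq)
qed

text \<open>The inverse turns precomposition into a left action: the exponent of \<open>x_i\<close>
  becomes that of \<open>x_p(i)\<close>.\<close>

definition perm_mon :: "nat perm \<Rightarrow> (nat \<Rightarrow>\<^sub>0 nat) \<Rightarrow> (nat \<Rightarrow>\<^sub>0 nat)" where
  "perm_mon p a = Poly_Mapping.map_key (papply (inverse p)) a"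

lemma inj_papply [simp]: "inj (papply p)"
  using bij_apply bij_is_inj by blast

lemma papply_inverse_cancel [simp]:
  "papply (inverse p) (papply p i) = i" "papply p (papply (inverse p) i) = i"
  by (simp_all add: apply_sequence)

lemma lookup_perm_mon: "lookup (perm_mon p a) i = lookup a (papply (inverse p) i)"
  by (simp add: perm_mon_def map_key.rep_eq)

lemma perm_mon_add: "perm_mon p (a + b) = perm_mon p a + perm_mon p b"
  by (rule poly_mapping_eqI) (simp add: lookup_perm_mon lookup_add)

lemma perm_mon_0 [simp]: "perm_mon p 0 = 0"
  by (rule poly_mapping_eqI) (simp add: lookup_perm_mon)

lemma perm_mon_1 [simp]: "perm_mon 1 a = a"
  by (rule poly_mapping_eqI) (simp add: lookup_perm_mon)

lemma perm_mon_mult: "perm_mon (p * q) a = perm_mon p (perm_mon q a)"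
  by (rule poly_mapping_eqI) (simp add: lookup_perm_mon apply_times)

lemma perm_mon_single: "perm_mon p (single i v) = single (papply p i) v"
  by (rule poly_mapping_eqI) (auto simp: lookup_perm_mon lookup_single when_def)

definition pact :: "nat perm \<Rightarrow> mpol \<Rightarrow> mpol" where
  "pact p = lin_ext (\<lambda>a. single (perm_mon p a) 1)"

lemma clinear_pact: "clinear (pact p)"
  unfolding pact_def by (rule clinear_lin_ext)

lemma pact_single: "pact p (single a v) = single (perm_mon p a) v"
  by (simp add: pact_def lin_ext_single scl_single)

lemma clinear_pact': "clinear L \<Longrightarrow> clinear (\<lambda>f. pact p (L f))"
  by (rule clinear_compose[OF clinear_pact])

lemma pact_mult: "pact p (f * g) = pact p f * pact p g"
proof -
  have single: "pact p (single a 1 * g) = pact p (single a 1) * pact p g" for a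
    by (rule clinear_eqI'[where f = g])
       (auto intro!: clinear_intros clinear_pact clinear_pact' simp: mult_single pact_single perm_mon_add)
  show ?thesis
    by (rule clinear_eqI'[where f = f]) (auto intro!: clinear_intros clinear_pact clinear_pact' simp: single)
qed

lemma pact_1 [simp]: "pact 1 f = f"
  by (rule clinear_eqI'[where f = f]) (auto intro!: clinear_intros clinear_pact simp: pact_single)

lemma pact_times: "pact (p * q) f = pact p (pact q f)"
  by (rule clinear_eqI'[where f = f]) (auto intro!: clinear_intros clinear_pact clinear_pact' simp: pact_single perm_mon_mult)

lemma pact_one [simp]: "pact p 1 = 1"
  using pact_single[of p 0 1] by simp

lemma pact_scl [simp]: "pact p (scl z) = scl z"
  by (simp add: scl_def pact_single)

lemma pact_var: "pact p (var i) = var (papply p i)"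
  by (simp add: var_def pact_single perm_mon_single)

lemma pact_inverse [simp]: "pact p (pact (inverse p) f) = f" "pact (inverse p) (pact p f) = f"
  by (simp_all flip: pact_times)

lemma pact_swap_swap [simp]: "pact (swp i j) (pact (swp i j) f) = f"
  by (simp flip: pact_times)

text \<open>If \<open>x_i\<close> does not occur, the subtraction truncates, but the coefficient is
  then zero.\<close>

definition pderiv :: "nat \<Rightarrow> mpol \<Rightarrow> mpol" where
  "pderiv i = lin_ext (\<lambda>a. single (a - single i 1) (of_nat (lookup a i)))"

lemma clinear_pderiv: "clinear (pderiv i)"
  unfolding pderiv_def by (rule clinear_lin_ext)

lemma clinear_pderiv': "clinear L \<Longrightarrow> clinear (\<lambda>f. pderiv i (L f))"
  by (rule clinear_compose[OF clinear_pderiv])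

lemma pderiv_single: "pderiv i (single a v) = single (a - single i 1) (v * of_nat (lookup a i))"
  by (simp add: pderiv_def lin_ext_single scl_single)

lemma var_pderiv_single: "var i * pderiv i (single a v) = single a (v * of_nat (lookup a i))"
proof (cases "lookup a i = 0")
  case False
  then have "single i 1 + (a - single i 1) = a"
    by (intro poly_mapping_eqI) (auto simp: lookup_add lookup_minus lookup_single when_def)
  then show ?thesis by (simp add: pderiv_single var_mult_single)
qed (simp add: pderiv_single)

lemma pderiv_var_mult: "pderiv i (var j * f) = var j * pderiv i f + (if i = j then f else 0)"
proof (rule clinear_eqI'[where f = f])
  fix a :: "nat \<Rightarrow>\<^sub>0 nat"
  show "pderiv i (var j * single a 1) = var j * pderiv i (single a 1) + (if i = j then single a 1 else 0)"
  proof (cases "i = j")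
    case True
    have "single i 1 + a - single i 1 = a" by simp
    then have "pderiv j (var j * single a 1) = single a (1 + of_nat (lookup a j))"
      unfolding var_mult_single pderiv_single using True by (simp add: lookup_add)
    then show ?thesis using True
      by (simp only: var_pderiv_single single_add) (simp add: add.commute)
  next
    case False
    then have "single j 1 + a - single i 1 = single j 1 + (a - single i 1)"
      by (intro poly_mapping_eqI) (auto simp: lookup_add lookup_minus lookup_single when_def)
    then show ?thesis using False
      by (simp add: var_mult_single pderiv_single lookup_add lookup_single)
  qed
next
  show "clinear (\<lambda>f. var j * pderiv i f + (if i = j then f else 0))"
    by (cases "i = j") (auto intro!: clinear_intros clinear_pderiv)
qed (auto intro!: clinear_intros clinear_pderiv')

lemma pderiv_scl [simp]: "pderiv i (scl z) = 0"
  by (simp add: scl_def pderiv_single)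

lemma pact_pderiv: "pact p (pderiv i f) = pderiv (papply p i) (pact p f)"
proof (rule clinear_eqI'[where f = f])
  fix a :: "nat \<Rightarrow>\<^sub>0 nat"
  have "perm_mon p (a - single i 1) = perm_mon p a - single (papply p i) 1"
    by (rule poly_mapping_eqI) (auto simp: lookup_perm_mon lookup_minus lookup_single when_def)
  then show "pact p (pderiv i (single a 1)) = pderiv (papply p i) (pact p (single a 1))"
    by (simp add: pderiv_single pact_single lookup_perm_mon)
qed (auto intro!: clinear_intros clinear_pderiv' clinear_pact' clinear_pact clinear_pderiv)

definition upd2 :: "nat \<Rightarrow> nat \<Rightarrow> nat \<Rightarrow> nat \<Rightarrow> (nat \<Rightarrow>\<^sub>0 nat) \<Rightarrow> (nat \<Rightarrow>\<^sub>0 nat)" where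
  "upd2 i k j l a = Poly_Mapping.update i k (Poly_Mapping.update j l a)"

lemma lookup_upd2: "lookup (upd2 i k j l a) t = (if t = i then k else if t = j then l else lookup a t)"
  by (simp add: upd2_def lookup_update)

text \<open>The geometric sum for \<open>(x_i^p x_j^q - x_i^q x_j^p) / (x_i - x_j)\<close>, with the
  sign telling which exponent is larger. The explicit form is what the triangularity argument reads
  off.\<close>

definition divdiff_mon :: "nat \<Rightarrow> nat \<Rightarrow> (nat \<Rightarrow>\<^sub>0 nat) \<Rightarrow> mpol" where
  "divdiff_mon i j a = (let lo = min (lookup a i) (lookup a j); hi = max (lookup a i) (lookup a j) in
     (if lookup a i \<ge> lookup a j then 1 else - 1) *
     (\<Sum>k\<in>{lo..<hi}. single (upd2 i k j (lo + hi - 1 - k) a) 1))"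

text \<open>The divided difference \<open>f \<mapsto> (f - s\<^sub>i\<^sub>j f) / (x\<^sub>i - x\<^sub>j)\<close>.\<close>

definition divdiff :: "nat \<Rightarrow> nat \<Rightarrow> mpol \<Rightarrow> mpol" where
  "divdiff i j = lin_ext (divdiff_mon i j)"

lemma clinear_divdiff: "clinear (divdiff i j)"
  unfolding divdiff_def by (rule clinear_lin_ext)

lemma divdiff_single: "divdiff i j (single a 1) = divdiff_mon i j a"
  by (simp add: divdiff_def lin_ext_single)

lemma lookup_perm_mon_swap:
  "lookup (perm_mon (swp i j) a) t = (if t = i then lookup a j else if t = j then lookup a i else lookup a t)"
  by (simp add: lookup_perm_mon)

text \<open>Either variable merely shifts the index of the geometric sum. The two results have the
  same summands at \<open>Suc k\<close> and at \<open>k\<close>, so their difference telescopes in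
  \<open>divdiff_eq\<close>.\<close>

lemma var_divdiff_mon:
  assumes "i \<noteq> j"
  defines "lo \<equiv> \<lambda>a. min (lookup a i) (lookup a j)" and "hi \<equiv> \<lambda>a. max (lookup a i) (lookup a j)"
  shows "var i * divdiff_mon i j a = (if lookup a i \<ge> lookup a j then 1 else - 1) *
     (\<Sum>k\<in>{lo a..<hi a}. single (upd2 i (Suc k) j (lo a + hi a - Suc k) a) 1)"
    and "var j * divdiff_mon i j a = (if lookup a i \<ge> lookup a j then 1 else - 1) *
     (\<Sum>k\<in>{lo a..<hi a}. single (upd2 i k j (lo a + hi a - k) a) 1)"
proof -
  have 1: "single i 1 + upd2 i k j (lo a + hi a - 1 - k) a = upd2 i (Suc k) j (lo a + hi a - Suc k) a" for k
    by (rule poly_mapping_eqI) (use \<open>i \<noteq> j\<close> in \<open>auto simp: lookup_add lookup_upd2 lookup_single when_def\<close>)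
  have 2: "single j 1 + upd2 i k j (lo a + hi a - 1 - k) a = upd2 i k j (lo a + hi a - k) a" if "k < hi a" for k
    by (rule poly_mapping_eqI) (use \<open>i \<noteq> j\<close> that in \<open>auto simp: lookup_add lookup_upd2 lookup_single when_def\<close>)
  have c: "x * ((if P then 1 else - 1) * y) = (if P then 1 else - 1) * (x * y)" for P and x y :: mpol
    by simp
  show "var i * divdiff_mon i j a = (if lookup a i \<ge> lookup a j then 1 else - 1) *
     (\<Sum>k\<in>{lo a..<hi a}. single (upd2 i (Suc k) j (lo a + hi a - Suc k) a) 1)"
    unfolding divdiff_mon_def Let_def c sum_distrib_left[of "var i"] var_mult_single
    using 1 unfolding lo_def hi_def by (simp only:)
  have "(\<Sum>k\<in>{lo a..<hi a}. single (single j 1 + upd2 i k j (lo a + hi a - 1 - k) a) 1)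
      = (\<Sum>k\<in>{lo a..<hi a}. single (upd2 i k j (lo a + hi a - k) a) (1::complex))"
    by (rule sum.cong) (use 2 in auto)
  then show "var j * divdiff_mon i j a = (if lookup a i \<ge> lookup a j then 1 else - 1) *
     (\<Sum>k\<in>{lo a..<hi a}. single (upd2 i k j (lo a + hi a - k) a) 1)"
    unfolding divdiff_mon_def Let_def c sum_distrib_left[of "var j"] var_mult_single lo_def hi_def
    by (simp only:)
qed

lemma divdiff_eq:
  assumes "i \<noteq> j"
  shows "(var i - var j) * divdiff i j f = f - pact (swp i j) f"
proof (rule clinear_eqI'[where f = f])
  fix a :: "nat \<Rightarrow>\<^sub>0 nat"
  let ?lo = "min (lookup a i) (lookup a j)" and ?hi = "max (lookup a i) (lookup a j)"
  let ?T = "\<lambda>k. single (upd2 i k j (?lo + ?hi - k) a) (1::complex)"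
  have "(var i - var j) * divdiff_mon i j a = (if lookup a i \<ge> lookup a j then 1 else - 1) *
      (\<Sum>k\<in>{?lo..<?hi}. ?T (Suc k) - ?T k)"
    unfolding left_diff_distrib sum_subtractf right_diff_distrib
    using var_divdiff_mon[OF assms] by simp
  also have "(\<Sum>k\<in>{?lo..<?hi}. ?T (Suc k) - ?T k) = ?T ?hi - ?T ?lo"
    by (rule sum_Suc_diff') simp
  also have "(if lookup a i \<ge> lookup a j then 1 else - 1) * (?T ?hi - ?T ?lo)
     = single a 1 - single (perm_mon (swp i j) a) 1"
  proof (cases "lookup a i \<ge> lookup a j")
    case True
    have "upd2 i (lookup a i) j (lookup a j) a = a" "upd2 i (lookup a j) j (lookup a i) a = perm_mon (swp i j) a"
      by (rule poly_mapping_eqI; simp add: lookup_upd2 lookup_perm_mon_swap)+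
    then show ?thesis using True by simp
  next
    case False
    have "upd2 i (lookup a i) j (lookup a j) a = a" "upd2 i (lookup a j) j (lookup a i) a = perm_mon (swp i j) a"
      by (rule poly_mapping_eqI; simp add: lookup_upd2 lookup_perm_mon_swap)+
    then show ?thesis using False by simp
  qed
  finally show "(var i - var j) * divdiff i j (single a 1) = single a 1 - pact (swp i j) (single a 1)"
    by (simp add: divdiff_single pact_single)
qed (auto intro!: clinear_intros clinear_divdiff clinear_pact)

text \<open>As \<open>x_i - x_j\<close> is not a zero divisor, product rules and equivariance of
  divided differences can be checked after multiplying by it, without returning to
  monomials.\<close>

lemma divdiff_unique:
  assumes "i \<noteq> j" "(var i - var j) * g = f - pact (swp i j) f"
  shows "divdiff i j f = g"
  using assms divdiff_eq[of i j f] var_diff_nonzero[of i j] by (metis mult_left_cancel)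

text \<open>A twisted Leibniz rule: \<open>x_k - s_ij x_k\<close> is \<open>x_i - x_j\<close>, its
  negative or zero, and this factor cancels.\<close>

lemma divdiff_var_mult:
  assumes "i \<noteq> j"
  shows "divdiff i j (var k * f) = var k * divdiff i j f +
    (if k = i then pact (swp i j) f else if k = j then - pact (swp i j) f else 0)"
proof (rule divdiff_unique[OF assms])
  have "(var i - var j) * (var k * divdiff i j f) = var k * (f - pact (swp i j) f)"
    using divdiff_eq[OF assms, of f] by (simp add: mult.left_commute)
  moreover have "pact (swp i j) (var k * f) = var (papply (swp i j) k) * pact (swp i j) f"
    by (simp add: pact_mult pact_var)
  ultimately show "(var i - var j) * (var k * divdiff i j f +
    (if k = i then pact (swp i j) f else if k = j then - pact (swp i j) f else 0))
    = var k * f - pact (swp i j) (var k * f)"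
    using assms by (cases "k = i"; cases "k = j") (simp_all add: algebra_simps)
qed

lemma divdiff_scl [simp]: "i \<noteq> j \<Longrightarrow> divdiff i j (scl z) = 0"
  by (rule divdiff_unique) auto

lemma swap_conj: "p * swp i j = swp (papply p i) (papply p j) * p"
proof (rule perm_eqI)
  fix t
  have "papply (swp (papply p i) (papply p j)) (papply p t) = papply p (papply (swp i j) t)"
    by (cases "t = i"; cases "t = j") (auto simp: apply_inj)
  then show "papply (p * swp i j) t = papply (swp (papply p i) (papply p j) * p) t"
    by (simp add: apply_times)
qed

lemma pact_swap_conj: "pact p (pact (swp i j) f) = pact (swp (papply p i) (papply p j)) (pact p f)"
  by (simp add: swap_conj flip: pact_times)

lemma pact_divdiff:
  assumes "i \<noteq> j"
  shows "pact p (divdiff i j f) = divdiff (papply p i) (papply p j) (pact p f)"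
proof (rule divdiff_unique[symmetric])
  show "papply p i \<noteq> papply p j" using assms by (simp add: apply_inj)
  show "(var (papply p i) - var (papply p j)) * pact p (divdiff i j f)
      = pact p f - pact (swp (papply p i) (papply p j)) (pact p f)"
    using arg_cong[OF divdiff_eq[OF assms, of f], of "pact p"]
    by (simp add: pact_mult clinear_diff[OF clinear_pact] pact_var pact_swap_conj)
qed

text \<open>The defining relations describe how an operator passes a variable; building polynomials
  by multiplication with variables therefore reduces statements about operators to these
  relations.\<close>

lemma poly_induct_vars [consumes 1, case_names scl add var]:
  assumes "\<forall>a\<in>keys f. keys a \<subseteq> V"
    and scl: "\<And>z. P (scl z)"
    and add: "\<And>f g. \<forall>a\<in>keys f. keys a \<subseteq> V \<Longrightarrow> \<forall>a\<in>keys g. keys a \<subseteq> V \<Longrightarrow> P f \<Longrightarrow> P g \<Longrightarrow> P (f + g)"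
    and var: "\<And>i f. i \<in> V \<Longrightarrow> \<forall>a\<in>keys f. keys a \<subseteq> V \<Longrightarrow> P f \<Longrightarrow> P (var i * f)"
  shows "P f"
proof -
  have mono: "P (single a v)" if "keys a \<subseteq> V" for a v
    using that
  proof (induction "\<Sum>i\<in>keys a. lookup a i" arbitrary: a)
    case 0
    then have "a = 0" by (auto simp: in_keys_iff intro: poly_mapping_eqI)
    then show ?case using scl[of v] by (simp add: scl_def)
  next
    case (Suc d)
    then obtain i where i: "i \<in> keys a" by (metis Suc_neq_Zero equals0I sum.empty)
    define b where "b = a - single i 1"
    have a: "a = single i 1 + b"
      using i by (intro poly_mapping_eqI) (auto simp: b_def lookup_add lookup_minus lookup_single when_def in_keys_iff)
    have kb: "keys b \<subseteq> keys a"
      by (auto simp: b_def in_keys_iff lookup_minus)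
    have "(\<Sum>i\<in>keys b. lookup b i) = (\<Sum>i\<in>keys a. lookup b i)"
      by (rule sum.mono_neutral_left) (use kb in \<open>auto simp: in_keys_iff\<close>)
    moreover have "(\<Sum>i\<in>keys a. lookup a i) = (\<Sum>j\<in>keys a. (if j = i then 1 else 0) + lookup b j)"
      by (rule sum.cong) (use arg_cong[OF a, of lookup] in \<open>auto simp: fun_eq_iff lookup_add lookup_single when_def\<close>)
    ultimately have "d = (\<Sum>i\<in>keys b. lookup b i)"
      using Suc.hyps(2) i by (simp add: sum.distrib)
    then have "P (single b v)" using Suc.hyps(1) kb Suc.prems by blast
    then have "P (var i * single b v)"
      by (intro var) (use i Suc.prems kb in auto)
    then show ?case unfolding var_mult_single by (subst a)
  qed
  have "keys f \<subseteq> {a. keys a \<subseteq> V}" using assms(1) by auto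
  then show ?thesis
  proof (induction f rule: poly_mapping_induct_on)
    case zero
    then show ?case using scl[of 0] by simp
  next
    case (add f g)
    then show ?case by (intro assms(3)) auto
  qed (use mono in auto)
qed

section \<open>Dunkl operators and the defining relations of the algebra\<close>

locale dunkl =
  fixes n :: nat and c :: complex
begin

definition dk :: "nat \<Rightarrow> mpol \<Rightarrow> mpol" where
  "dk i f = pderiv i f - scl c * (\<Sum>j\<in>{1..n} - {i}. divdiff i j f)"

lemma clinear_dk: "clinear (dk i)"
  unfolding dk_def by (intro clinear_intros clinear_pderiv clinear_divdiff)

lemmas dk_linear = clinear_add[OF clinear_dk] clinear_diff[OF clinear_dk]
  clinear_scl[OF clinear_dk] clinear_sum[OF clinear_dk] clinear_0[OF clinear_dk]
lemmas pact_linear = clinear_add[OF clinear_pact] clinear_diff[OF clinear_pact]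
  clinear_scl[OF clinear_pact] clinear_sum[OF clinear_pact] clinear_0[OF clinear_pact]

lemma dk_scl [simp]: "dk i (scl z) = 0"
  by (simp add: dk_def)

lemma dk_one [simp]: "dk i 1 = 0"
  using dk_scl[of i 1] by simp

text \<open>The relation \<open>[y_i, x_j] = c (ij)\<close>: among the divided differences only the
  one for the pair \<open>i, j\<close> sees \<open>x_j\<close>.\<close>

lemma dk_var_mult:
  assumes "i \<in> {1..n}" "j \<in> {1..n}" "i \<noteq> j"
  shows "dk i (var j * f) = var j * dk i f + scl c * pact (swp i j) f"
proof -
  have "(\<Sum>k\<in>{1..n} - {i}. divdiff i k (var j * f))
      = (\<Sum>k\<in>{1..n} - {i}. var j * divdiff i k f - (if k = j then pact (swp i j) f else 0))"
    by (rule sum.cong) (use assms in \<open>auto simp: divdiff_var_mult\<close>)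
  also have "\<dots> = var j * (\<Sum>k\<in>{1..n} - {i}. divdiff i k f) - pact (swp i j) f"
    using assms by (simp add: sum_subtractf sum_distrib_left)
  finally have S: "(\<Sum>k\<in>{1..n} - {i}. divdiff i k (var j * f)) = \<dots>" .
  show ?thesis
    unfolding dk_def S pderiv_var_mult using assms by (simp add: algebra_simps)
qed

text \<open>The relation for \<open>[y_i, x_i]\<close>: the derivative contributes \<open>1\<close>,
  and every divided difference contributes its transposition.\<close>

lemma dk_var_mult_same:
  assumes "i \<in> {1..n}"
  shows "dk i (var i * f) = var i * dk i f + f - scl c * (\<Sum>j\<in>{1..n} - {i}. pact (swp i j) f)"
proof -
  have "(\<Sum>k\<in>{1..n} - {i}. divdiff i k (var i * f))
      = (\<Sum>k\<in>{1..n} - {i}. var i * divdiff i k f + pact (swp i k) f)"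
    by (rule sum.cong) (auto simp: divdiff_var_mult)
  also have "\<dots> = var i * (\<Sum>k\<in>{1..n} - {i}. divdiff i k f) + (\<Sum>k\<in>{1..n} - {i}. pact (swp i k) f)"
    by (simp add: sum.distrib sum_distrib_left)
  finally have S: "(\<Sum>k\<in>{1..n} - {i}. divdiff i k (var i * f)) = \<dots>" .
  show ?thesis
    unfolding dk_def S pderiv_var_mult by (simp add: algebra_simps)
qed

lemma dk_var_mult_outside:
  assumes "i \<in> {1..n}" "j \<notin> {1..n}"
  shows "dk i (var j * f) = var j * dk i f"
proof -
  have S: "(\<Sum>k\<in>{1..n} - {i}. divdiff i k (var j * f)) = (\<Sum>k\<in>{1..n} - {i}. var j * divdiff i k f)"
    by (rule sum.cong) (use assms in \<open>auto simp: divdiff_var_mult\<close>)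
  have "i \<noteq> j" using assms by auto
  then show ?thesis
    unfolding dk_def S pderiv_var_mult by (simp add: algebra_simps sum_distrib_left)
qed

lemma papply_in_iff:
  assumes "affected p \<subseteq> {1..n}"
  shows "papply p i \<in> {1..n} \<longleftrightarrow> i \<in> {1..n}"
  by (metis apply_affected assms in_affected subsetD)

text \<open>The permutation maps \<open>{1..n}\<close> onto itself, so it only reindexes the sum of
  divided differences. This is the smash product relation between permutations and
  \<open>y_i\<close>.\<close>

lemma pact_dk:
  assumes "affected p \<subseteq> {1..n}" "i \<in> {1..n}"
  shows "pact p (dk i f) = dk (papply p i) (pact p f)"
proof -
  have "(\<Sum>j\<in>{1..n} - {i}. divdiff (papply p i) (papply p j) (pact p f))
      = (\<Sum>j\<in>{1..n} - {papply p i}. divdiff (papply p i) j (pact p f))"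
    by (rule sum.reindex_bij_witness[where j = "papply p" and i = "papply (inverse p)"])
       (use assms papply_in_iff[of p] papply_in_iff[of "inverse p"] in \<open>auto simp: apply_inj\<close>)
  moreover have "(\<Sum>j\<in>{1..n} - {i}. pact p (divdiff i j f))
      = (\<Sum>j\<in>{1..n} - {i}. divdiff (papply p i) (papply p j) (pact p f))"
    by (rule sum.cong) (auto simp: pact_divdiff)
  ultimately show ?thesis
    by (simp add: dk_def pact_linear pact_pderiv)
qed

lemma affected_swap_subset: "i \<in> {1..n} \<Longrightarrow> j \<in> {1..n} \<Longrightarrow> affected (swp i j) \<subseteq> {1..n}"
  by (cases "i = j") (auto simp: affected_swap)

lemma dk_swap:
  assumes "i \<in> {1..n}" "j \<in> {1..n}" "k \<in> {1..n}"
  shows "dk k (pact (swp i j) f) = pact (swp i j) (dk (papply (swp i j) k) f)"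
proof -
  have "papply (swp i j) k \<in> {1..n}"
    using papply_in_iff[OF affected_swap_subset[OF assms(1,2)]] assms by simp
  moreover have "papply (swp i j) (papply (swp i j) k) = k"
    by (simp add: apply_sequence)
  ultimately show ?thesis
    using pact_dk[OF affected_swap_subset[OF assms(1,2)]] by simp
qed

text \<open>Since \<open>[[y\<^sub>i, y\<^sub>j], x\<^sub>k] = 0\<close> by the Jacobi identity and \<open>[y\<^sub>i, y\<^sub>j]\<close> kills constants, it vanishes.\<close>

lemma dk_commutator_var_same:
  assumes ij: "i \<in> {1..n}" "j \<in> {1..n}" "i \<noteq> j"
  shows "dk i (dk j (var i * f)) - dk j (dk i (var i * f)) = var i * (dk i (dk j f) - dk j (dk i f))"
proof -
  \<comment> \<open>\<open>y_j\<close> passes \<open>s_il\<close> unchanged except for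
    \<open>l = j\<close>, where it becomes \<open>y_i\<close>; the extra summand records this
    exception.\<close>
  have "(\<Sum>l\<in>{1..n} - {i}. dk j (pact (swp i l) f))
      = (\<Sum>l\<in>{1..n} - {i}. pact (swp i l) (dk j f) + (if l = j then pact (swp i j) (dk i f - dk j f) else 0))"
    by (rule sum.cong) (use ij in \<open>auto simp: dk_swap pact_linear\<close>)
  also have "\<dots> = (\<Sum>l\<in>{1..n} - {i}. pact (swp i l) (dk j f)) + pact (swp i j) (dk i f - dk j f)"
    using ij by (simp add: sum.distrib)
  finally have sum: "(\<Sum>l\<in>{1..n} - {i}. dk j (pact (swp i l) f)) = \<dots>" .
  have A: "dk i (dk j (var i * f)) = var i * dk i (dk j f) + dk j f
     - scl c * (\<Sum>l\<in>{1..n} - {i}. pact (swp i l) (dk j f)) + scl c * pact (swp i j) (dk j f)"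
    using ij by (simp add: dk_var_mult dk_var_mult_same dk_linear dk_swap swap_sym[of j i])
  have B: "dk j (dk i (var i * f)) = var i * dk j (dk i f) + scl c * pact (swp i j) (dk i f) + dk j f
     - scl c * (\<Sum>l\<in>{1..n} - {i}. dk j (pact (swp i l) f))"
    using ij by (simp add: dk_var_mult dk_var_mult_same dk_linear swap_sym[of j i])
  show ?thesis
    unfolding A B sum by (simp add: pact_linear algebra_simps)
qed

lemma dk_commute:
  assumes ij: "i \<in> {1..n}" "j \<in> {1..n}"
  shows "dk i (dk j f) = dk j (dk i f)"
proof (cases "i = j")
  case False
  have "\<forall>a\<in>keys f. keys a \<subseteq> UNIV" by simp
  then have "dk i (dk j f) - dk j (dk i f) = 0"
  proof (induction f rule: poly_induct_vars)
    case (add f g)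
    then show ?case by (simp add: dk_linear)
  next
    case (var k f)
    consider "k = i" | "k = j" | "k \<noteq> i" "k \<noteq> j" "k \<in> {1..n}" | "k \<notin> {1..n}" by blast
    then show ?case
    proof cases
      case 1
      then show ?thesis using dk_commutator_var_same[OF ij False, of f] var by simp
    next
      case 2
      then show ?thesis using dk_commutator_var_same[OF ij(2,1), of f] var False by simp
    next
      case 3
      \<comment> \<open>Both orders of application produce the corrections
        \<open>c s_ik y_j f\<close> and \<open>c s_jk y_i f\<close>, which cancel.\<close>
      then have "dk i (dk j (var k * f)) - dk j (dk i (var k * f)) = var k * (dk i (dk j f) - dk j (dk i f))"
        using ij False by (simp add: dk_var_mult dk_linear dk_swap) (simp add: algebra_simps)
      then show ?thesis using var by simp
    next
      case 4
      then have "dk i (dk j (var k * f)) - dk j (dk i (var k * f)) = var k * (dk i (dk j f) - dk j (dk i f))"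
        using ij by (simp add: dk_var_mult_outside) (simp add: algebra_simps)
      then show ?thesis using var by simp
    qed
  qed (simp add: dk_linear)
  then show ?thesis by simp
qed simp

section \<open>The operators \<open>u_i\<close>, \<open>\<tau>\<close>, \<open>\<lambda>\<close> and
  their commutation relations\<close>

definition uop :: "nat \<Rightarrow> mpol \<Rightarrow> mpol" where
  "uop i f = var i * dk i f - scl c * (\<Sum>j\<in>{1..<i}. pact (swp i j) f)"

definition tau :: "mpol \<Rightarrow> mpol" where
  "tau f = var 1 * pact (long_cycle n) f"

definition lam :: "mpol \<Rightarrow> mpol" where
  "lam f = pact (inverse (long_cycle n)) (dk 1 f)"

lemma clinear_uop: "clinear (uop i)"
  unfolding uop_def by (intro clinear_intros clinear_dk clinear_pact)

lemma clinear_tau: "clinear tau"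
  unfolding tau_def by (intro clinear_intros clinear_pact)

lemma clinear_lam: "clinear lam"
  unfolding lam_def by (intro clinear_pact' clinear_dk)

text \<open>The recursion for cycles keeps the head and removes the second element, so an induction
  has to speak about cycles with a gap after \<open>1\<close>.\<close>

lemma papply_cycle_from:
  assumes "1 < k" "k \<le> n + 1"
  shows "papply (Perm.cycle (1 # [k..<n + 1])) t =
    (if t = 1 then (if k \<le> n then k else 1)
     else if k \<le> t \<and> t < n then t + 1 else if k \<le> n \<and> t = n then 1 else t)"
  using assms(2,1)
proof (induction arbitrary: t rule: inc_induct)
  case base
  then show ?case by simp
next
  case (step k)
  have eq: "[k..<n + 1] = k # [Suc k..<n + 1]" using step.hyps by (simp add: upt_rec)
  have "papply (swp 1 k) t = (if t = 1 then k else if t = k then 1 else t)"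
    by simp
  then show ?case
    unfolding eq using step by (auto simp: apply_times)
qed

lemma papply_long_cycle:
  "papply (long_cycle n) t = (if 1 \<le> t \<and> t < n then t + 1 else if t = n \<and> 1 \<le> n then 1 else t)"
proof (cases "n = 0")
  case False
  then have "[1..<n + 1] = 1 # [2..<n + 1]" by (simp add: upt_rec numeral_2_eq_2)
  then show ?thesis
    unfolding long_cycle_def using False papply_cycle_from[of 2 t] by auto
qed (simp add: long_cycle_def)

lemma affected_long_cycle: "affected (long_cycle n) \<subseteq> {1..n}"
  by (auto simp: in_affected papply_long_cycle split: if_splits)

lemma pact_swap_sum:
  "pact p (\<Sum>j\<in>A. pact (swp i j) f) = (\<Sum>j\<in>papply p ` A. pact (swp (papply p i) j) (pact p f))"
  by (subst sum.reindex) (auto simp: pact_linear pact_swap_conj inj_on_def apply_inj)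

text \<open>Conjugation by the long cycle turns the transpositions of \<open>u_i\<close> into those
  of \<open>u_{i+1}\<close> except \<open>(i+1, 1)\<close>. That one is cancelled by the commutator
  of \<open>y_{i+1}\<close> with the factor \<open>x_1\<close> of \<open>\<tau>\<close>.\<close>

lemma uop_tau_Suc:
  assumes "i \<in> {1..<n}"
  shows "uop (i + 1) (tau f) = tau (uop i f)"
proof -
  let ?g = "long_cycle n"
  have gi: "papply ?g i = i + 1" using assms by (simp add: papply_long_cycle)
  have img: "papply ?g ` {1..<i} = {2..<i + 1}"
  proof -
    have "papply ?g ` {1..<i} = Suc ` {1..<i}"
      by (rule image_cong) (use assms in \<open>auto simp: papply_long_cycle\<close>)
    then show ?thesis by (simp add: numeral_2_eq_2)
  qed
  have sp: "{1..<i + 1} = insert 1 {2..<i + 1}" using assms by auto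
  have "(\<Sum>j\<in>{2..<i + 1}. pact (swp (i + 1) j) (tau f)) = (\<Sum>j\<in>{2..<i + 1}. var 1 * pact (swp (i + 1) j) (pact ?g f))"
    by (rule sum.cong) (use assms in \<open>auto simp: tau_def pact_mult pact_var\<close>)
  then have "(\<Sum>j\<in>{1..<i + 1}. pact (swp (i + 1) j) (tau f))
     = var (i + 1) * pact (swp (i + 1) 1) (pact ?g f) + var 1 * (\<Sum>j\<in>{2..<i + 1}. pact (swp (i + 1) j) (pact ?g f))"
    unfolding sp sum_distrib_left by (subst sum.insert) (auto simp: tau_def pact_mult pact_var)
  moreover have "dk (i + 1) (tau f) = var 1 * dk (i + 1) (pact ?g f) + scl c * pact (swp (i + 1) 1) (pact ?g f)"
    unfolding tau_def by (rule dk_var_mult) (use assms in auto)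
  moreover have "tau (uop i f) = var 1 * (var (i + 1) * dk (i + 1) (pact ?g f)
       - scl c * (\<Sum>j\<in>{2..<i + 1}. pact (swp (i + 1) j) (pact ?g f)))"
    using pact_dk[OF affected_long_cycle, of i f] assms
    by (simp only: tau_def uop_def pact_linear(2,3) pact_mult pact_var pact_swap_sum img gi) simp
  ultimately show ?thesis
    by (simp add: uop_def algebra_simps)
qed

text \<open>\<open>u_1\<close> has no transpositions of its own. The commutator
  \<open>[y_1, x_1]\<close> supplies all those coming from \<open>u_n\<close>, and its constant
  \<open>1\<close> gives the extra \<open>\<tau> f\<close>.\<close>

lemma uop_tau_1:
  assumes "n > 0"
  shows "uop 1 (tau f) = tau (uop n f) + tau f"
proof -
  let ?g = "long_cycle n"
  have gn: "papply ?g n = 1" using assms by (simp add: papply_long_cycle)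
  have img: "papply ?g ` {1..<n} = {1..n} - {1}"
  proof -
    have "papply ?g ` {1..<n} = Suc ` {1..<n}"
      by (rule image_cong) (auto simp: papply_long_cycle)
    then show ?thesis by auto
  qed
  have A: "dk 1 (tau f) = var 1 * dk 1 (pact ?g f) + pact ?g f - scl c * (\<Sum>j\<in>{1..n} - {1}. pact (swp 1 j) (pact ?g f))"
    unfolding tau_def by (rule dk_var_mult_same) (use assms in auto)
  have B: "tau (uop n f) = var 1 * (var 1 * dk 1 (pact ?g f)
       - scl c * (\<Sum>j\<in>{1..n} - {1}. pact (swp 1 j) (pact ?g f)))"
    using pact_dk[OF affected_long_cycle, of n f] assms
    by (simp only: tau_def uop_def pact_linear(2,3) pact_mult pact_var pact_swap_sum img gn) simp
  have "uop 1 (tau f) = var 1 * dk 1 (tau f)" by (simp add: uop_def)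
  then show ?thesis
    unfolding A B by (simp add: tau_def algebra_simps)
qed

lemma var_nonzero: "var i \<noteq> 0"
  by (simp add: var_def flip: keys_eq_empty)

lemma tau_eq_0_iff: "tau f = 0 \<longleftrightarrow> f = 0"
proof
  assume "tau f = 0"
  then have "pact (long_cycle n) f = 0" using var_nonzero by (simp add: tau_def)
  then show "f = 0" by (metis pact_inverse(2) pact_linear(5))
qed (simp add: tau_def pact_linear)

lemma tau_inject: "tau f = tau g \<longleftrightarrow> f = g"
  using tau_eq_0_iff[of "f - g"] by (simp add: clinear_diff[OF clinear_tau])

lemma tau_lam: "tau (lam f) = uop 1 f"
  by (simp add: tau_def lam_def uop_def)

text \<open>Cancel \<open>\<tau>\<close> from
  \<open>\<tau> \<lambda> \<tau> = u_1 \<tau> = \<tau> (u_n + 1)\<close>.\<close>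

lemma lam_tau: "n > 0 \<Longrightarrow> lam (tau f) = uop n f + f"
  using tau_lam[of "tau f"] uop_tau_1[of f] tau_inject
  by (metis clinear_add[OF clinear_tau])

text \<open>Conjugation by \<open>s_i\<close> sends \<open>u_i\<close> to \<open>u_{i+1}\<close>
  without its summand \<open>(i+1, i)\<close>, which is \<open>s_i\<close> itself and accounts for
  \<open>c f\<close>.\<close>

lemma swap_uop:
  assumes "i \<in> {1..<n}"
  shows "pact (swp i (i + 1)) (uop i f) = uop (i + 1) (pact (swp i (i + 1)) f) + scl c * f"
proof -
  let ?s = "swp i (i + 1)"
  have aff: "affected ?s \<subseteq> {1..n}" using assms by (intro affected_swap_subset) auto
  have img: "papply ?s ` {1..<i} = {1..<i}" by (auto simp: image_iff)
  have "{1..<i + 1} = insert i {1..<i}" using assms by auto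
  then have "(\<Sum>j\<in>{1..<i + 1}. pact (swp (i + 1) j) (pact ?s f)) = f + (\<Sum>j\<in>{1..<i}. pact (swp (i + 1) j) (pact ?s f))"
    by (simp add: swap_sym[of "Suc i" i])
  moreover have "pact ?s (uop i f) = var (i + 1) * dk (i + 1) (pact ?s f)
      - scl c * (\<Sum>j\<in>{1..<i}. pact (swp (i + 1) j) (pact ?s f))"
    using pact_dk[OF aff, of i f] assms
    by (simp only: uop_def pact_linear(2,3) pact_mult pact_var pact_swap_sum img) simp
  ultimately show ?thesis
    by (simp add: uop_def algebra_simps)
qed

lemma swap_uop_Suc:
  assumes "i \<in> {1..<n}"
  shows "pact (swp i (i + 1)) (uop (i + 1) f) = uop i (pact (swp i (i + 1)) f) - scl c * f"
proof -
  let ?s = "swp i (i + 1)"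
  have "uop i (pact ?s f) = pact ?s (uop (i + 1) f + scl c * pact ?s f)"
    using swap_uop[OF assms, of "pact ?s f"] by (metis pact_swap_swap)
  then show ?thesis
    by (simp add: pact_linear)
qed

lemma swap_uop_other:
  assumes "i \<in> {1..<n}" "j \<in> {1..n}" "j \<noteq> i" "j \<noteq> i + 1"
  shows "pact (swp i (i + 1)) (uop j f) = uop j (pact (swp i (i + 1)) f)"
proof -
  let ?s = "swp i (i + 1)"
  have aff: "affected ?s \<subseteq> {1..n}" using assms by (intro affected_swap_subset) auto
  have sj: "papply ?s j = j" using assms by simp
  \<comment> \<open>Since \<open>j\<close> is neither \<open>i\<close> nor \<open>i + 1\<close>,
    both of these lie below \<open>j\<close> or neither does.\<close>
  have "papply ?s t \<in> {1..<j}" if "t \<in> {1..<j}" for t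
    using that assms by (cases "t = i"; cases "t = i + 1") auto
  moreover have "papply ?s (papply ?s t) = t" for t by (simp add: apply_sequence)
  ultimately have img: "papply ?s ` {1..<j} = {1..<j}" by (metis (no_types, lifting) image_subset_iff subsetI subset_antisym image_eqI)
  show ?thesis
    using pact_dk[OF aff, of j f] assms(2)
    by (simp only: uop_def pact_linear(2,3) pact_mult pact_var pact_swap_sum img sj pact_scl)
qed

end

\<comment> \<open>Otherwise the simplifier turns \<open>{1..n}\<close> into \<open>{Suc 0..n}\<close>, which no longer matches the definitions.\<close>
declare One_nat_def [simp del]

lemma keys_upd2: "keys (upd2 i k j l a) \<subseteq> insert i (insert j (keys a))"
  by (auto simp: in_keys_iff lookup_upd2 split: if_splits)

lemma scl_sum: "scl (\<Sum>x\<in>A. f x) = (\<Sum>x\<in>A. scl (f x))"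
  by (induction A rule: infinite_finite_induct) (simp_all add: scl_add)

section \<open>Polynomials in the variables \<open>x_1, ..., x_n\<close>\<close>

context dunkl
begin

definition Pn :: "mpol set" where
  "Pn = {f. \<forall>a\<in>keys f. keys a \<subseteq> {1..n}}"

lemma Pn_single: "keys a \<subseteq> {1..n} \<Longrightarrow> single a v \<in> Pn"
  by (auto simp: Pn_def split: if_splits)

lemma Pn_0 [simp]: "0 \<in> Pn"
  and Pn_scl [simp]: "scl z \<in> Pn"
  and Pn_1 [simp]: "1 \<in> Pn"
  by (auto simp: Pn_def scl_def)

lemma Pn_add: "f \<in> Pn \<Longrightarrow> g \<in> Pn \<Longrightarrow> f + g \<in> Pn"
  using keys_add[of f g] by (fastforce simp: Pn_def)

lemma Pn_scl_mult: "f \<in> Pn \<Longrightarrow> scl z * f \<in> Pn"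
  using keys_scl_mult[of z f] by (auto simp: Pn_def)

lemma Pn_diff: "f \<in> Pn \<Longrightarrow> g \<in> Pn \<Longrightarrow> f - g \<in> Pn"
  using Pn_add[OF _ Pn_scl_mult[of g "-1"], of f] by (simp add: scl_uminus)

lemma Pn_uminus: "f \<in> Pn \<Longrightarrow> - f \<in> Pn"
  using Pn_diff[of 0 f] by simp

lemma Pn_sum: "(\<And>x. x \<in> A \<Longrightarrow> f x \<in> Pn) \<Longrightarrow> (\<Sum>x\<in>A. f x) \<in> Pn"
  by (induction A rule: infinite_finite_induct) (auto intro: Pn_add)

lemma Pn_clinear:
  assumes "clinear L" "\<And>a. keys a \<subseteq> {1..n} \<Longrightarrow> L (single a 1) \<in> Pn" "f \<in> Pn"
  shows "L f \<in> Pn"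
proof -
  have "keys f \<subseteq> {a. keys a \<subseteq> {1..n}}" using assms(3) by (auto simp: Pn_def)
  then show ?thesis
  proof (induction f rule: poly_mapping_induct_on)
    case (single k v)
    then show ?case using assms(1,2) by (subst single_eq_scl) (simp add: clinear_scl Pn_scl_mult)
  qed (auto simp: clinear_0[OF assms(1)] clinear_add[OF assms(1)] intro: Pn_add)
qed

lemma Pn_var_mult: "i \<in> {1..n} \<Longrightarrow> f \<in> Pn \<Longrightarrow> var i * f \<in> Pn"
proof (rule Pn_clinear[where f = f])
  fix a :: "nat \<Rightarrow>\<^sub>0 nat" assume "i \<in> {1..n}" "keys a \<subseteq> {1..n}"
  then show "var i * single a 1 \<in> Pn"
    unfolding var_mult_single using keys_add[of "single i 1" a] by (intro Pn_single) auto
qed (auto intro!: clinear_intros)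

lemma Pn_pact: "affected p \<subseteq> {1..n} \<Longrightarrow> f \<in> Pn \<Longrightarrow> pact p f \<in> Pn"
proof (rule Pn_clinear[where f = f])
  fix a :: "nat \<Rightarrow>\<^sub>0 nat" assume p: "affected p \<subseteq> {1..n}" and a: "keys a \<subseteq> {1..n}"
  have "keys (perm_mon p a) \<subseteq> {1..n}"
  proof
    fix t assume "t \<in> keys (perm_mon p a)"
    then have "papply (inverse p) t \<in> keys a" by (simp add: in_keys_iff lookup_perm_mon)
    then show "t \<in> {1..n}" using a p papply_in_iff[of "inverse p" t] by auto
  qed
  then show "pact p (single a 1) \<in> Pn"
    unfolding pact_single by (rule Pn_single)
qed (auto intro!: clinear_pact)

lemma Pn_pderiv: "f \<in> Pn \<Longrightarrow> pderiv i f \<in> Pn"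
proof (rule Pn_clinear[where f = f])
  fix a :: "nat \<Rightarrow>\<^sub>0 nat" assume "keys a \<subseteq> {1..n}"
  then show "pderiv i (single a 1) \<in> Pn"
    unfolding pderiv_single by (intro Pn_single) (auto simp: in_keys_iff lookup_minus)
qed (auto intro!: clinear_pderiv)

lemma Pn_divdiff: "i \<in> {1..n} \<Longrightarrow> j \<in> {1..n} \<Longrightarrow> f \<in> Pn \<Longrightarrow> divdiff i j f \<in> Pn"
proof (rule Pn_clinear[where f = f])
  fix a :: "nat \<Rightarrow>\<^sub>0 nat" assume *: "i \<in> {1..n}" "j \<in> {1..n}" "keys a \<subseteq> {1..n}"
  have "single (upd2 i k j l a) 1 \<in> Pn" for k l
    by (rule Pn_single) (use * keys_upd2[of i k j l a] in blast)
  then show "divdiff i j (single a 1) \<in> Pn"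
    unfolding divdiff_single divdiff_mon_def Let_def by (auto intro!: Pn_sum Pn_uminus)
qed (auto intro!: clinear_divdiff)

lemma Pn_dk: "i \<in> {1..n} \<Longrightarrow> f \<in> Pn \<Longrightarrow> dk i f \<in> Pn"
  unfolding dk_def by (intro Pn_diff Pn_pderiv Pn_scl_mult Pn_sum Pn_divdiff) auto

lemma Pn_tau: "n > 0 \<Longrightarrow> f \<in> Pn \<Longrightarrow> tau f \<in> Pn"
  unfolding tau_def by (intro Pn_var_mult Pn_pact affected_long_cycle) auto

section \<open>Triangularity of the commuting operators\<close>

text \<open>Zero outside \<open>{1..n}\<close>, so that arbitrary functions may name monomials and
  only their entries at \<open>1, ..., n\<close> matter.\<close>

definition exps :: "(nat \<Rightarrow> nat) \<Rightarrow> (nat \<Rightarrow>\<^sub>0 nat)" where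
  "exps a = Abs_poly_mapping (\<lambda>i. if i \<in> {1..n} then a i else 0)"

lemma lookup_exps: "lookup (exps a) i = (if i \<in> {1..n} then a i else 0)"
proof -
  have "finite {i. (if i \<in> {1..n} then a i else 0) \<noteq> 0}"
    by (rule finite_subset[of _ "{1..n}"]) auto
  then show ?thesis by (simp add: exps_def)
qed

lemma keys_exps: "keys (exps a) \<subseteq> {1..n}"
  by (auto simp: in_keys_iff lookup_exps split: if_splits)

lemma exps_lookup: "keys b \<subseteq> {1..n} \<Longrightarrow> exps (lookup b) = b"
  by (rule poly_mapping_eqI) (auto simp: lookup_exps in_keys_iff)

lemma exps_eq_iff: "exps a = exps b \<longleftrightarrow> (\<forall>i\<in>{1..n}. a i = b i)"
  by (auto simp: poly_mapping_eq_iff fun_eq_iff lookup_exps split: if_splits)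

text \<open>Up to a constant, \<open>n\<^sup>2 \<Sum> a\<^sub>l\<^sup>2 + 2 n \<Sum> l a\<^sub>l\<close>: balancing two entries decreases it,
  and so does moving the larger of two entries to the left.\<close>

definition mu :: "(nat \<Rightarrow> nat) \<Rightarrow> nat" where
  "mu a = (\<Sum>l\<in>{1..n}. (n * a l + l)\<^sup>2)"

lemma mu_cong: "(\<And>l. l \<in> {1..n} \<Longrightarrow> a l = b l) \<Longrightarrow> mu a = mu b"
  by (simp add: mu_def)

lemma mu_lookup_exps [simp]: "mu (lookup (exps a)) = mu a"
  by (rule mu_cong) (simp add: lookup_exps)

text \<open>Put \<open>A = n a_i + i\<close>, \<open>B = n a_j + j\<close> and
  \<open>A' = n b_i + i\<close>. The sum of the two terms is preserved, so the sum of their squares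
  changes by \<open>2 (A' - A) (A' - B)\<close>, which is negative when \<open>A'\<close> lies
  strictly between \<open>A\<close> and \<open>B\<close>; the last assumption expresses just
  that.\<close>

lemma mu_lessI:
  assumes ij: "i \<in> {1..n}" "j \<in> {1..n}" "i \<noteq> j"
    and eq: "\<And>l. l \<in> {1..n} \<Longrightarrow> l \<noteq> i \<Longrightarrow> l \<noteq> j \<Longrightarrow> b l = a l" and sum: "b i + b j = a i + a j"
    and less: "n * a j + j < n * b i + i \<and> b i < a i \<or> a i < b i \<and> n * b i + i < n * a j + j"
  shows "mu b < mu a"
proof -
  have dec: "mu x = (\<Sum>l\<in>{1..n} - {i} - {j}. (n * x l + l)\<^sup>2) + (n * x i + i)\<^sup>2 + (n * x j + j)\<^sup>2" for x
    unfolding mu_def using ij sum.remove[of "{1..n}" i "\<lambda>l. (n * x l + l)\<^sup>2"]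
      sum.remove[of "{1..n} - {i}" j "\<lambda>l. (n * x l + l)\<^sup>2"] by simp
  have rest: "(\<Sum>l\<in>{1..n} - {i} - {j}. (n * b l + l)\<^sup>2) = (\<Sum>l\<in>{1..n} - {i} - {j}. (n * a l + l)\<^sup>2)"
    by (rule sum.cong) (use eq in auto)
  define A B A' where "A = int (n * a i + i)" and "B = int (n * a j + j)" and "A' = int (n * b i + i)"
  have "n > 0" using ij by auto
  have "int (n * b j + j) = A + B - A'"
  proof -
    have "n * b i + n * b j = n * a i + n * a j" using sum by (metis distrib_left)
    then show ?thesis unfolding A_def B_def A'_def by linarith
  qed
  moreover have "A' < A \<and> B < A' \<or> A < A' \<and> A' < B"
    using less \<open>n > 0\<close> unfolding A_def B_def A'_def of_nat_less_iff by auto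
  then have "(A' - A) * (A' - B) < 0"
    by (auto simp: mult_less_0_iff)
  then have "A'\<^sup>2 + (A + B - A')\<^sup>2 < A\<^sup>2 + B\<^sup>2"
    by (simp add: power2_eq_square algebra_simps)
  ultimately have "int ((n * b i + i)\<^sup>2 + (n * b j + j)\<^sup>2) < int ((n * a i + i)\<^sup>2 + (n * a j + j)\<^sup>2)"
    unfolding of_nat_add of_nat_power by (simp only: A_def B_def A'_def of_nat_add)
  then show ?thesis unfolding dec rest by linarith
qed

definition lower :: "(nat \<Rightarrow> nat) \<Rightarrow> mpol set" where
  "lower a = {f \<in> Pn. \<forall>b\<in>keys f. mu (lookup b) < mu a}"

lemma lower_0 [simp]: "0 \<in> lower a"
  by (simp add: lower_def)

lemma lower_add: "f \<in> lower a \<Longrightarrow> g \<in> lower a \<Longrightarrow> f + g \<in> lower a"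
  using keys_add[of f g] by (auto simp: lower_def intro: Pn_add)

lemma lower_scl_mult: "f \<in> lower a \<Longrightarrow> scl z * f \<in> lower a"
  using keys_scl_mult[of z f] by (auto simp: lower_def intro: Pn_scl_mult)

lemma lower_uminus: "f \<in> lower a \<Longrightarrow> - f \<in> lower a"
  using lower_scl_mult[of f a "-1"] by (simp add: scl_uminus)

lemma lower_diff: "f \<in> lower a \<Longrightarrow> g \<in> lower a \<Longrightarrow> f - g \<in> lower a"
  using lower_add[OF _ lower_uminus, of f a g] by simp

lemma lower_sum: "(\<And>x. x \<in> A \<Longrightarrow> f x \<in> lower a) \<Longrightarrow> (\<Sum>x\<in>A. f x) \<in> lower a"
  by (induction A rule: infinite_finite_induct) (auto intro: lower_add)

lemma lower_single:
  assumes "keys b \<subseteq> {1..n}" "mu (lookup b) < mu a"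
  shows "single b v \<in> lower a"
  using assms Pn_single[OF assms(1)] by (auto simp: lower_def)

lemma exps_swap:
  assumes "i \<in> {1..n}" "j \<in> {1..n}"
  shows "perm_mon (swp i j) (exps a) = exps (a(i := a j, j := a i))"
  by (rule poly_mapping_eqI) (use assms in \<open>auto simp: lookup_perm_mon_swap lookup_exps\<close>)

text \<open>All inner terms of the geometric sum are more balanced than \<open>x^a\<close>. For
  \<open>a_j < a_i\<close> the outermost term is \<open>x^a\<close> itself. For
  \<open>a_i < a_j\<close> it is minus the transposed monomial, which the transposition in
  \<open>u_i\<close> cancels when \<open>j < i\<close> and which is lower when \<open>i < j\<close>.
  For equal entries only the transposition is left.\<close>

lemma var_divdiff_triangular:
  fixes a :: "nat \<Rightarrow> nat"
  assumes ij: "i \<in> {1..n}" "j \<in> {1..n}" "i \<noteq> j"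
  defines "M \<equiv> single (exps a) (1::complex)"
  shows "var i * divdiff i j M + (if j < i then pact (swp i j) M else 0)
    - scl (if a j < a i \<or> a j = a i \<and> j < i then 1 else 0) * M \<in> lower a"
proof -
  let ?lo = "min (a i) (a j)" and ?hi = "max (a i) (a j)"
  let ?T = "\<lambda>k. single (upd2 i k j (?lo + ?hi - k) (exps a)) (1::complex)"
  have lk: "lookup (exps a) i = a i" "lookup (exps a) j = a j"
    using ij by (simp_all add: lookup_exps)
  have sw: "pact (swp i j) M = single (upd2 i (a j) j (a i) (exps a)) 1"
    unfolding M_def pact_single
    by (rule arg_cong[where f = "\<lambda>x. single x 1"], rule poly_mapping_eqI)
       (simp add: lookup_upd2 lookup_perm_mon_swap lk)
  have low: "single (upd2 i k j l (exps a)) (1::complex) \<in> lower a"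
    if "k + l = a i + a j" "n * a j + j < n * k + i \<and> k < a i \<or> a i < k \<and> n * k + i < n * a j + j" for k l
  proof (rule lower_single)
    show "keys (upd2 i k j l (exps a)) \<subseteq> {1..n}"
      using ij keys_exps[of a] keys_upd2[of i k j l "exps a"] by blast
    show "mu (lookup (upd2 i k j l (exps a))) < mu a"
      by (rule mu_lessI[OF ij]) (use that ij in \<open>auto simp: lookup_upd2 lookup_exps\<close>)
  qed
  \<comment> \<open>A unit step in an entry outweighs any difference of positions; this is the
    reason for the factor \<open>n\<close> in \<open>mu\<close>.\<close>
  have step: "n * x + y < n * x' + y'" if "x < x'" "y \<in> {1..n}" "y' \<in> {1..n}" for x x' y y' :: nat
  proof -
    have "n * Suc x \<le> n * x'" using that by (intro mult_le_mono2) auto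
    then show ?thesis using that by auto
  qed
  have vd: "var i * divdiff i j M = (if a i \<ge> a j then 1 else - 1) * (\<Sum>k\<in>{?lo..<?hi}. ?T (Suc k))"
    using var_divdiff_mon(1)[OF ij(3), of "exps a"] unfolding M_def divdiff_single lk .
  consider "a j < a i" | "a j = a i" | "a i < a j" by linarith
  then show ?thesis
  proof cases
    case 1
    then have "{?lo..<?hi} = insert (a i - 1) {a j..<a i - 1}" by auto
    then have "var i * divdiff i j M = ?T (Suc (a i - 1)) + (\<Sum>k\<in>{a j..<a i - 1}. ?T (Suc k))"
      unfolding vd using 1 by simp
    moreover have "?T (Suc (a i - 1)) = M"
      unfolding M_def
      by (rule arg_cong[where f = "\<lambda>x. single x 1"], rule poly_mapping_eqI)
         (use 1 ij in \<open>auto simp: lookup_upd2 lookup_exps\<close>)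
    moreover have "(\<Sum>k\<in>{a j..<a i - 1}. ?T (Suc k)) \<in> lower a"
    proof (intro lower_sum low)
      fix k assume k: "k \<in> {a j..<a i - 1}"
      then have "n * a j + j < n * Suc k + i" by (intro step) (use ij in auto)
      then show "n * a j + j < n * Suc k + i \<and> Suc k < a i \<or> a i < Suc k \<and> n * Suc k + i < n * a j + j"
        using k by (simp del: mult_Suc_right) linarith
    qed (use 1 in auto)
    moreover have "(if j < i then pact (swp i j) M else 0) \<in> lower a"
      unfolding sw using 1 by (auto intro!: low)
    ultimately show ?thesis using 1 lower_add by simp
  next
    case 2
    then have "upd2 i (a j) j (a i) (exps a) = exps a"
      by (intro poly_mapping_eqI) (use lk in \<open>auto simp: lookup_upd2\<close>)
    then show ?thesis unfolding vd sw using 2 by (simp add: M_def)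
  next
    case 3
    then have "{?lo..<?hi} = insert (a j - 1) {a i..<a j - 1}" by auto
    then have "var i * divdiff i j M = - ?T (Suc (a j - 1)) - (\<Sum>k\<in>{a i..<a j - 1}. ?T (Suc k))"
      unfolding vd using 3 by simp
    moreover have "?T (Suc (a j - 1)) = pact (swp i j) M"
      unfolding sw using 3 by simp
    moreover have "(\<Sum>k\<in>{a i..<a j - 1}. ?T (Suc k)) \<in> lower a"
    proof (intro lower_sum low)
      fix k assume k: "k \<in> {a i..<a j - 1}"
      then have "n * Suc k + i < n * a j + j" by (intro step) (use ij in auto)
      then show "n * a j + j < n * Suc k + i \<and> Suc k < a i \<or> a i < Suc k \<and> n * Suc k + i < n * a j + j"
        using k by (simp del: mult_Suc_right)
    qed (use 3 in auto)
    moreover have "(if j < i then 0 else pact (swp i j) M) \<in> lower a"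
      unfolding sw using 3 ij by (auto intro!: low)
    ultimately show ?thesis using 3 lower_uminus lower_diff
      by (auto split: if_splits)
  qed
qed

text \<open>The rank of position \<open>i\<close> when positions are ordered by entry and then by
  index. The counted condition is the one under which \<open>var_divdiff_triangular\<close> has
  diagonal entry \<open>1\<close>.\<close>

lemma sort_perm_eq:
  assumes "i \<in> {1..n}"
  shows "sort_perm n a i = Suc (card {j \<in> {1..n} - {i}. a j < a i \<or> a j = a i \<and> j < i})"
proof -
  have "{j \<in> {1..i}. a j = a i} = insert i {j \<in> {1..<i}. a j = a i}" using assms by auto
  then have "card {j \<in> {1..i}. a j = a i} = Suc (card {j \<in> {1..<i}. a j = a i})" by simp
  moreover have "{j \<in> {1..n} - {i}. a j < a i \<or> a j = a i \<and> j < i}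
     = {j \<in> {1..n}. a j < a i} \<union> {j \<in> {1..<i}. a j = a i}" using assms by auto
  moreover have "card ({j \<in> {1..n}. a j < a i} \<union> {j \<in> {1..<i}. a j = a i})
    = card {j \<in> {1..n}. a j < a i} + card {j \<in> {1..<i}. a j = a i}"
    by (rule card_Un_disjoint) auto
  ultimately show ?thesis by (simp add: sort_perm_def)
qed

text \<open>\<open>x_i \<partial>_i\<close> contributes \<open>a_i\<close>, and each position ranked
  before \<open>i\<close> contributes \<open>- c\<close>, which adds up to the weight.\<close>

lemma uop_triangular:
  fixes a :: "nat \<Rightarrow> nat"
  assumes i: "i \<in> {1..n}"
  defines "M \<equiv> single (exps a) (1::complex)"
  shows "uop i M - scl (wt n c a i) * M \<in> lower a"
proof -
  let ?A = "{1..n} - {i}"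
  let ?e = "\<lambda>j. if a j < a i \<or> a j = a i \<and> j < i then 1 else (0::complex)"
  let ?t = "\<lambda>j. var i * divdiff i j M + (if j < i then pact (swp i j) M else 0)"
  have "(\<Sum>j\<in>?A. if j < i then pact (swp i j) M else 0) = (\<Sum>j\<in>{1..<i}. pact (swp i j) M)"
    by (rule sum.mono_neutral_cong_right) (use i in auto)
  moreover have "var i * pderiv i M = scl (of_nat (a i)) * M"
    unfolding M_def var_pderiv_single scl_single using i by (simp add: lookup_exps)
  ultimately have u: "uop i M = scl (of_nat (a i)) * M - scl c * (\<Sum>j\<in>?A. ?t j)"
    by (simp add: uop_def dk_def sum.distrib sum_distrib_left algebra_simps)
  have "(\<Sum>j\<in>?A. ?e j) = of_nat (card {j \<in> ?A. a j < a i \<or> a j = a i \<and> j < i})"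
    by (simp add: sum.If_cases Int_def)
  then have w: "wt n c a i = of_nat (a i) - c * (\<Sum>j\<in>?A. ?e j)"
    unfolding wt_def sort_perm_eq[OF i] by (simp add: mult.commute)
  have "uop i M - scl (wt n c a i) * M = - (scl c * (\<Sum>j\<in>?A. ?t j - scl (?e j) * M))"
    unfolding u w scl_diff scl_mult scl_sum
    by (simp only: sum_subtractf sum_distrib_right left_diff_distrib right_diff_distrib mult.assoc) simp
  also have "\<dots> \<in> lower a"
  proof (intro lower_uminus lower_scl_mult lower_sum)
    fix j assume "j \<in> ?A"
    then show "?t j - scl (?e j) * M \<in> lower a"
      unfolding M_def using var_divdiff_triangular[of i j a] i by blast
  qed
  finally show ?thesis .
qed

lemma sort_perm_bounds:
  assumes "i \<in> {1..n}"
  shows "1 \<le> sort_perm n a i" "sort_perm n a i \<le> n"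
proof -
  have "card {j \<in> {1..n} - {i}. a j < a i \<or> a j = a i \<and> j < i} \<le> card ({1..n} - {i})"
    by (intro card_mono) auto
  also have "\<dots> = n - 1" using assms by simp
  finally show "1 \<le> sort_perm n a i" "sort_perm n a i \<le> n"
    using sort_perm_eq[OF assms, of a] assms by auto
qed

lemma sort_perm_cong:
  assumes "i \<in> {1..n}" "\<And>j. j \<in> {1..n} \<Longrightarrow> a j = b j"
  shows "sort_perm n a i = sort_perm n b i"
proof -
  have "{j \<in> {1..n} - {i}. a j < a i \<or> a j = a i \<and> j < i} = {j \<in> {1..n} - {i}. b j < b i \<or> b j = b i \<and> j < i}"
    using assms by auto
  then show ?thesis by (simp only: sort_perm_eq[OF assms(1)])
qed

lemma wt_cong:
  assumes "i \<in> {1..n}" "\<And>j. j \<in> {1..n} \<Longrightarrow> a j = b j"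
  shows "wt n c a i = wt n c b i"
  unfolding wt_def using sort_perm_cong[OF assms] assms by simp

end

lemma clinear_expand:
  assumes "clinear L"
  shows "L f = (\<Sum>k\<in>keys f. scl (lookup f k) * L (single k 1))"
proof -
  have "L f = L (\<Sum>k\<in>keys f. scl (lookup f k) * single k 1)"
    using poly_mapping_eq_sum_single[of f] by (simp add: scl_single)
  then show ?thesis by (simp add: clinear_sum[OF assms] clinear_scl[OF assms])
qed

lemma lookup_var_mult: "lookup (var i * f) (single i 1 + b) = lookup f b"
proof -
  have "keys f \<subseteq> UNIV" by simp
  then show ?thesis
    by (induction f rule: poly_mapping_induct_on)
       (simp_all add: var_mult_single lookup_single when_def distrib_left lookup_add)
qed

lemma perm_mon_inject: "perm_mon p a = perm_mon p b \<longleftrightarrow> a = b"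
  by (metis perm.left_inverse perm_mon_1 perm_mon_mult)

lemma lookup_pact: "lookup (pact p f) (perm_mon p b) = lookup f b"
proof -
  have "keys f \<subseteq> UNIV" by simp
  then show ?thesis
    by (induction f rule: poly_mapping_induct_on)
       (simp_all add: clinear_0[OF clinear_pact] clinear_add[OF clinear_pact] pact_single
         lookup_single when_def lookup_add perm_mon_inject)
qed

section \<open>Weights of moved sequences and leading monomials\<close>

context dunkl
begin

text \<open>A rank depends only on how position \<open>i\<close> compares with the others, so it is
  enough that the permutation preserves these comparisons.\<close>

lemma sort_perm_transport:
  assumes p: "affected p \<subseteq> {1..n}" and i: "i \<in> {1..n}"
    and eq: "\<And>j. j \<in> {1..n} \<Longrightarrow> j \<noteq> i \<Longrightarrow>
      (b (papply p j) < b (papply p i) \<or> b (papply p j) = b (papply p i) \<and> papply p j < papply p i)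
      \<longleftrightarrow> (a j < a i \<or> a j = a i \<and> j < i)"
  shows "sort_perm n b (papply p i) = sort_perm n a i"
proof -
  let ?B = "{j \<in> {1..n} - {papply p i}. b j < b (papply p i) \<or> b j = b (papply p i) \<and> j < papply p i}"
  let ?A = "{j \<in> {1..n} - {i}. a j < a i \<or> a j = a i \<and> j < i}"
  have "?B = papply p ` ?A"
  proof
    show "papply p ` ?A \<subseteq> ?B"
    proof
      fix j assume "j \<in> papply p ` ?A"
      then obtain k where k: "j = papply p k" "k \<in> ?A" by blast
      then have "papply p k \<in> {1..n}" using papply_in_iff[OF p, of k] by blast
      then show "j \<in> ?B" using k eq[of k] by (simp add: apply_inj)
    qed
    show "?B \<subseteq> papply p ` ?A"
    proof
      fix j assume j: "j \<in> ?B"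
      define k where "k = papply (inverse p) j"
      have jk: "j = papply p k" by (simp add: k_def)
      have "k \<in> {1..n}" using j papply_in_iff[OF p, of k] unfolding jk by blast
      then have "k \<in> ?A" using j eq[of k] unfolding jk by (simp add: apply_inj)
      then show "j \<in> papply p ` ?A" using jk by blast
    qed
  qed
  then have "card ?B = card ?A" by (simp add: card_image inj_on_def apply_inj)
  moreover have "papply p i \<in> {1..n}" using papply_in_iff[OF p] i by simp
  ultimately show ?thesis by (simp only: sort_perm_eq i)
qed

lemma pi_seq_papply:
  "j \<in> {1..n} \<Longrightarrow> pi_seq n a (papply (long_cycle n) j) = a j + (if j = n then 1 else 0)"
  by (auto simp: pi_seq_def papply_long_cycle)

text \<open>The last position ranks after every equal entry. Once it is moved to the front and
  raised by one, these ties have become strict inequalities, so the ranks are preserved and only the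
  entry grows.\<close>

lemma wt_pi_seq:
  assumes "i \<in> {1..n}"
  shows "wt n c (pi_seq n a) (papply (long_cycle n) i) = wt n c a i + (if i = n then 1 else 0)"
proof -
  have "sort_perm n (pi_seq n a) (papply (long_cycle n) i) = sort_perm n a i"
    by (rule sort_perm_transport[OF affected_long_cycle assms])
       (use assms in \<open>auto simp: pi_seq_papply, auto simp: papply_long_cycle split: if_splits\<close>)
  then show ?thesis using assms by (simp add: wt_def pi_seq_papply)
qed

lemma swap_seq_papply: "swap_seq i a (papply (swp i (i + 1)) j) = a j"
  by (cases "j = i"; cases "j = i + 1") (auto simp: swap_seq_def)

text \<open>Only the pair \<open>i, i + 1\<close> changes its relative position, and its entries
  differ, so no tie is resolved differently.\<close>

lemma wt_swap_seq:
  assumes i: "i \<in> {1..<n}" and j: "j \<in> {1..n}" and ne: "a i \<noteq> a (i + 1)"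
  shows "wt n c (swap_seq i a) (papply (swp i (i + 1)) j) = wt n c a j"
proof -
  have "papply (swp i (i + 1)) k < papply (swp i (i + 1)) j \<longleftrightarrow> k < j" if "a k = a j" for k
    using ne that by (cases "k = i"; cases "k = i + 1"; cases "j = i"; cases "j = i + 1") auto
  then have "sort_perm n (swap_seq i a) (papply (swp i (i + 1)) j) = sort_perm n a j"
    by (intro sort_perm_transport affected_swap_subset) (use i j in \<open>auto simp: swap_seq_papply\<close>)
  then show ?thesis using swap_seq_papply[of i a j] by (simp add: wt_def)
qed

lemma exps_pi_seq: "n > 0 \<Longrightarrow> exps (pi_seq n a) = single 1 1 + perm_mon (long_cycle n) (exps a)"
proof (rule poly_mapping_eqI)
  fix t assume n: "n > 0"
  define j where "j = papply (inverse (long_cycle n)) t"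
  have t: "t = papply (long_cycle n) j" by (simp add: j_def)
  have "t \<in> {1..n} \<longleftrightarrow> j \<in> {1..n}" unfolding t by (rule papply_in_iff[OF affected_long_cycle])
  moreover have "t = 1 \<longleftrightarrow> j = n"
    using n unfolding t by (auto simp: papply_long_cycle split: if_splits)
  moreover have "lookup (single 1 1 + perm_mon (long_cycle n) (exps a)) t = (if t = 1 then 1 else 0) + lookup (exps a) j"
    by (simp add: lookup_add lookup_single when_def lookup_perm_mon j_def)
  ultimately show "lookup (exps (pi_seq n a)) t = lookup (single 1 1 + perm_mon (long_cycle n) (exps a)) t"
    using pi_seq_papply[of j a] n by (simp add: lookup_exps flip: t)
qed

lemma exps_swap_seq: "i \<in> {1..<n} \<Longrightarrow> exps (swap_seq i a) = perm_mon (swp i (i + 1)) (exps a)"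
  using exps_swap[of i "i + 1" a] by (simp add: swap_seq_def)

lemma mu_swap_seq_less:
  assumes "i \<in> {1..<n}" "a i < a (i + 1)"
  shows "mu (swap_seq i a) < mu a"
  by (rule mu_lessI[of i "i + 1"]) (use assms in \<open>auto simp: swap_seq_def\<close>)

lemma swap_seq_swap_seq: "swap_seq i (swap_seq i a) = a"
  by (auto simp: swap_seq_def)

lemma pi_seq_pi_inv_seq: "a 1 > 0 \<Longrightarrow> l \<in> {1..n} \<Longrightarrow> pi_seq n (pi_inv_seq n a) l = a l"
  by (auto simp: pi_seq_def pi_inv_seq_def)

text \<open>Undoing \<open>\<pi>\<close> lowers the sum of the entries; swapping an ascent keeps the
  sum and lowers \<open>mu\<close>, hence the nested induction. If neither applies, the sequence is
  weakly decreasing and starts with \<open>0\<close>, so it vanishes.\<close>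

lemma seq_induct [consumes 1, case_names zero pi swap]:
  fixes P :: "(nat \<Rightarrow> nat) \<Rightarrow> bool"
  assumes n: "n > 0"
    and zero: "\<And>a. \<forall>l\<in>{1..n}. a l = 0 \<Longrightarrow> P a"
    and pi: "\<And>a. a 1 > 0 \<Longrightarrow> P (pi_inv_seq n a) \<Longrightarrow> P a"
    and swap: "\<And>a i. i \<in> {1..<n} \<Longrightarrow> a i < a (i + 1) \<Longrightarrow> P (swap_seq i a) \<Longrightarrow> P a"
  shows "P a"
proof (induction "\<Sum>l\<in>{1..n}. a l" arbitrary: a rule: less_induct)
  case less
  note outer = this
  have "P b" if "(\<Sum>l\<in>{1..n}. b l) = (\<Sum>l\<in>{1..n}. a l)" for b
    using that
  proof (induction "mu b" arbitrary: b rule: less_induct)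
    case less
    show ?case
    proof (cases "b 1 > 0")
      case True
      have "(\<Sum>l\<in>{1..n}. b l) = (\<Sum>l\<in>{1..n}. pi_inv_seq n b l) + 1"
      proof -
        have "(\<Sum>l\<in>{1..n}. b l) = b 1 + (\<Sum>l\<in>{1..n} - {1}. b l)"
          by (rule sum.remove) (use n in auto)
        also have "(\<Sum>l\<in>{1..n} - {1}. b l) = (\<Sum>l\<in>{1..n} - {n}. pi_inv_seq n b l)"
          by (rule sum.reindex_bij_witness[where j = "\<lambda>l. l - 1" and i = "\<lambda>l. l + 1"])
             (auto simp: pi_inv_seq_def)
        also have "(\<Sum>l\<in>{1..n}. pi_inv_seq n b l) = pi_inv_seq n b n + (\<Sum>l\<in>{1..n} - {n}. pi_inv_seq n b l)"
          by (rule sum.remove) (use n in auto)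
        then have "b 1 + (\<Sum>l\<in>{1..n} - {n}. pi_inv_seq n b l) = (\<Sum>l\<in>{1..n}. pi_inv_seq n b l) + 1"
          using True n by (simp add: pi_inv_seq_def)
        finally show ?thesis .
      qed
      then show ?thesis using outer less.prems True pi by simp
    next
      case False
      show ?thesis
      proof (cases "\<exists>i\<in>{1..<n}. b i < b (i + 1)")
        case True
        then obtain i where i: "i \<in> {1..<n}" "b i < b (i + 1)" by blast
        have "(\<Sum>l\<in>{1..n}. swap_seq i b l) = (\<Sum>l\<in>{1..n}. b l)"
          by (rule sum.reindex_bij_witness[where j = "papply (swp i (i + 1))" and i = "papply (swp i (i + 1))"])
             (use papply_in_iff[OF affected_swap_subset, of i "i + 1"] i swap_seq_papply[of i "swap_seq i b"]
               in \<open>auto simp: apply_sequence swap_seq_swap_seq\<close>)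
        then show ?thesis
          using less.hyps[OF mu_swap_seq_less[OF i]] less.prems swap i by simp
      next
        case none: False
        have "b l = 0" if "1 \<le> l" "l \<le> n" for l
          using that
        proof (induction l rule: dec_induct)
          case base
          then show ?case using False by simp
        next
          case (step l)
          then have "l \<in> {1..<n}" by auto
          then have "\<not> b l < b (l + 1)" using none by blast
          then show ?case using step by (simp add: Suc_eq_plus1)
        qed
        then show ?thesis by (intro zero) auto
      qed
    qed
  qed
  then show ?case by blast
qed

text \<open>At a monomial of maximal \<open>mu\<close> in \<open>f\<close>, the operators \<open>u\<^sub>i\<close> act through their diagonal entries.\<close>

lemma eigenvector_leading:
  assumes f: "f \<in> Pn" and eig: "\<And>i. i \<in> {1..n} \<Longrightarrow> uop i f = scl (w i) * f"
    and b: "b \<in> keys f" "\<And>b'. b' \<in> keys f \<Longrightarrow> mu (lookup b') \<le> mu (lookup b)" and i: "i \<in> {1..n}"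
  shows "w i = wt n c (lookup b) i"
proof -
  have lk: "lookup (uop i (single b' 1)) b = (if b' = b then wt n c (lookup b) i else 0)" if "b' \<in> keys f" for b'
  proof -
    have kb: "keys b' \<subseteq> {1..n}" using f that by (auto simp: Pn_def)
    define r where "r = uop i (single b' 1) - scl (wt n c (lookup b') i) * single b' 1"
    have "r \<in> lower (lookup b')"
      unfolding r_def using uop_triangular[OF i, of "lookup b'"] exps_lookup[OF kb] by simp
    then have "b \<notin> keys r" using b(2)[OF that] unfolding lower_def by (metis (lifting) mem_Collect_eq not_less)
    then have "lookup r b = 0" by (simp add: in_keys_iff)
    then show ?thesis
      by (auto simp: r_def lookup_minus lookup_scl_mult lookup_single when_def)
  qed
  have "lookup (uop i f) b = (\<Sum>b'\<in>keys f. lookup f b' * lookup (uop i (single b' 1)) b)"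
    by (subst clinear_expand[OF clinear_uop]) (simp add: lookup_sum lookup_scl_mult)
  also have "\<dots> = (\<Sum>b'\<in>keys f. if b' = b then lookup f b * wt n c (lookup b) i else 0)"
    by (rule sum.cong) (auto simp: lk)
  also have "\<dots> = lookup f b * wt n c (lookup b) i" using b(1) by simp
  finally have "w i * lookup f b = lookup f b * wt n c (lookup b) i"
    by (simp add: eig[OF i] lookup_scl_mult)
  then show ?thesis using b(1) by (simp add: in_keys_iff)
qed

lemma ex_maximal_key:
  assumes "f \<noteq> (0 :: mpol)"
  obtains b where "b \<in> keys f" "\<And>b'. b' \<in> keys f \<Longrightarrow> mu (lookup b') \<le> mu (lookup b)"
proof -
  let ?M = "(\<lambda>b. mu (lookup b)) ` keys f"
  have ne: "finite ?M" "?M \<noteq> {}" using assms by auto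
  from Max_in[OF ne] obtain b where b: "b \<in> keys f" "Max ?M = mu (lookup b)" by auto
  show ?thesis
    by (rule that[OF b(1)]) (use Max_ge[OF ne(1)] b(2) in auto)
qed

definition eigvec :: "(nat \<Rightarrow> nat) \<Rightarrow> mpol \<Rightarrow> bool" where
  "eigvec a f \<longleftrightarrow> f \<in> Pn \<and> (\<forall>i\<in>{1..n}. uop i f = scl (wt n c a i) * f)"

lemma eigvec_cong: "(\<And>l. l \<in> {1..n} \<Longrightarrow> a l = b l) \<Longrightarrow> eigvec a f = eigvec b f"
  using wt_cong[of _ a b] by (auto simp: eigvec_def)

lemma eigvec_diff: "eigvec a f \<Longrightarrow> eigvec a g \<Longrightarrow> eigvec a (f - g)"
  by (auto simp: eigvec_def Pn_diff clinear_diff[OF clinear_uop] right_diff_distrib)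

lemma eigvec_tau:
  assumes "n > 0" "eigvec a f"
  shows "eigvec (pi_seq n a) (tau f)" and "lookup (tau f) (exps (pi_seq n a)) = lookup f (exps a)"
proof -
  have "uop j (tau f) = scl (wt n c (pi_seq n a) j) * tau f" if j: "j \<in> {1..n}" for j
  proof -
    define i where "i = papply (inverse (long_cycle n)) j"
    have ji: "j = papply (long_cycle n) i" by (simp add: i_def)
    have i: "i \<in> {1..n}" using j papply_in_iff[OF affected_long_cycle] unfolding ji by blast
    have ui: "uop i f = scl (wt n c a i) * f" using assms i by (simp add: eigvec_def)
    show ?thesis
    proof (cases "i = n")
      case True
      then have "j = 1" using ji assms(1) by (simp add: papply_long_cycle)
      then show ?thesis
        using uop_tau_1[OF assms(1), of f] ui wt_pi_seq[OF i, of a] True ji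
        by (simp add: clinear_scl[OF clinear_tau] scl_add distrib_right)
    next
      case False
      then have "j = i + 1" "i \<in> {1..<n}" using ji i by (auto simp: papply_long_cycle)
      then show ?thesis
        using uop_tau_Suc[of i f] ui wt_pi_seq[OF i, of a] False ji
        by (simp add: clinear_scl[OF clinear_tau])
    qed
  qed
  then show "eigvec (pi_seq n a) (tau f)"
    using assms by (simp add: eigvec_def Pn_tau)
  show "lookup (tau f) (exps (pi_seq n a)) = lookup f (exps a)"
    unfolding exps_pi_seq[OF assms(1)] tau_def by (simp add: lookup_var_mult lookup_pact)
qed

end

section \<open>Joint eigenvectors for \<open>c = m / n\<close>\<close>

locale rational_dunkl = dunkl n c for n :: nat and c :: complex +
  fixes m :: nat
  assumes m_pos: "m > 0" and n_pos: "n > 0" and coprime_mn: "coprime m n"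
    and c_eq: "c = of_nat m / of_nat n"
begin

lemma c_nonzero: "c \<noteq> 0"
  using m_pos n_pos by (simp add: c_eq)

lemma of_int_eq_mult_c_iff: "of_int d = of_int e * c \<longleftrightarrow> d * int n = e * int m"
proof -
  have "of_int d = of_int e * c \<longleftrightarrow> of_int (d * int n) = (of_int (e * int m) :: complex)"
    using n_pos by (simp add: c_eq field_simps)
  then show ?thesis by (simp only: of_int_eq_iff)
qed

text \<open>Clearing denominators gives \<open>d n = e m\<close>; as \<open>m\<close> and
  \<open>n\<close> are coprime, \<open>n\<close> divides \<open>e\<close>, which is too small to be
  a nonzero multiple.\<close>

lemma of_int_eq_mult_cD:
  assumes "of_int d = of_int e * c" "\<bar>e\<bar> < int n"
  shows "d = 0" "e = 0"
proof -
  have eq: "d * int n = e * int m" using assms(1) of_int_eq_mult_c_iff by simp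
  then have "int n dvd e * int m" by (metis dvd_triv_right)
  then have "int n dvd e" using coprime_mn by (simp add: coprime_dvd_mult_left_iff coprime_commute)
  then show "e = 0" using assms(2) by (meson zdvd_not_zless dvd_abs_iff zero_less_abs_iff)
  then show "d = 0" using eq n_pos by simp
qed

lemma wt_diff: "wt n c a i - wt n c b j
    = of_int (int (a i) - int (b j)) - of_int (int (sort_perm n a i) - int (sort_perm n b j)) * c"
  by (simp add: wt_def algebra_simps)

text \<open>Ranks lie between \<open>1\<close> and \<open>n\<close>, so two of them differ by less
  than \<open>n\<close> and the arithmetic above applies. The two weights may belong to different
  sequences and positions.\<close>

lemma wt_eqD:
  assumes "wt n c a i = wt n c b j" "i \<in> {1..n}" "j \<in> {1..n}"
  shows "a i = b j" "sort_perm n a i = sort_perm n b j"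
proof -
  have "of_int (int (a i) - int (b j)) = of_int (int (sort_perm n a i) - int (sort_perm n b j)) * c"
    using assms(1) wt_diff[of a i b j] by simp
  moreover have "\<bar>int (sort_perm n a i) - int (sort_perm n b j)\<bar> < int n"
    using sort_perm_bounds[OF assms(2), of a] sort_perm_bounds[OF assms(3), of b] by linarith
  ultimately show "a i = b j" "sort_perm n a i = sort_perm n b j"
    using of_int_eq_mult_cD by fastforce+
qed

text \<open>Distinct monomials may share a value of \<open>mu\<close>, so maximality alone does not
  give a unique leading term. But at every maximal monomial the eigenvalues are the weights of that
  monomial, and these force it to be \<open>x^a\<close>.\<close>

lemma eigvec_leading:
  assumes "eigvec a f" "f \<noteq> 0"
  shows "lookup f (exps a) \<noteq> 0" and "\<And>b. b \<in> keys f \<Longrightarrow> b \<noteq> exps a \<Longrightarrow> mu (lookup b) < mu a"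
proof -
  have f: "f \<in> Pn" and e: "\<And>i. i \<in> {1..n} \<Longrightarrow> uop i f = scl (wt n c a i) * f"
    using assms(1) by (auto simp: eigvec_def)
  have max: "b = exps a" if b: "b \<in> keys f" "\<And>b'. b' \<in> keys f \<Longrightarrow> mu (lookup b') \<le> mu (lookup b)" for b
  proof -
    have "keys b \<subseteq> {1..n}" using f b by (auto simp: Pn_def)
    moreover have "a i = lookup b i" if "i \<in> {1..n}" for i
      using eigenvector_leading[OF f e b that] wt_eqD(1) that by blast
    ultimately show ?thesis using exps_lookup exps_eq_iff by metis
  qed
  obtain b where b: "b \<in> keys f" "\<And>b'. b' \<in> keys f \<Longrightarrow> mu (lookup b') \<le> mu (lookup b)"
    using ex_maximal_key[OF assms(2)] by blast
  have ba: "b = exps a" using max b by blast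
  then show "lookup f (exps a) \<noteq> 0" using b(1) by (simp add: in_keys_iff)
  fix b' assume b': "b' \<in> keys f" "b' \<noteq> exps a"
  show "mu (lookup b') < mu a"
  proof (rule ccontr)
    assume "\<not> mu (lookup b') < mu a"
    then have "mu (lookup b'') \<le> mu (lookup b')" if "b'' \<in> keys f" for b''
      using b(2)[OF that] ba by simp
    then show False using max b' by blast
  qed
qed

lemma eigvec_unique:
  assumes "eigvec a f" "eigvec a g" "lookup f (exps a) = lookup g (exps a)"
  shows "f = g"
  using eigvec_leading(1)[OF eigvec_diff[OF assms(1,2)]] assms(3) by (auto simp: lookup_minus)

lemma wt_neq: "i \<in> {1..n} \<Longrightarrow> j \<in> {1..n} \<Longrightarrow> a i \<noteq> a j \<Longrightarrow> wt n c a i \<noteq> wt n c a j"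
  using wt_eqD(1) by blast

text \<open>By \<open>s_i u_i = u_{i+1} s_i + c\<close>, the vector \<open>s_i f\<close> has the
  exchanged weights up to a multiple of \<open>f\<close>. The subtracted scalar is the one that
  removes this multiple; \<open>kw\<close> is the equation it satisfies.\<close>

lemma eigvec_swap:
  assumes i: "i \<in> {1..<n}" and ne: "a i \<noteq> a (i + 1)" and f: "eigvec a f"
  defines "g \<equiv> pact (swp i (i + 1)) f - scl (c / (wt n c a i - wt n c a (i + 1))) * f"
  shows "eigvec (swap_seq i a) g"
proof -
  let ?s = "swp i (i + 1)" and ?w = "wt n c a"
  define k where "k = c / (?w i - ?w (i + 1))"
  have i': "i \<in> {1..n}" "i + 1 \<in> {1..n}" using i by auto
  have "?w i \<noteq> ?w (i + 1)" using wt_neq[OF i' ne] .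
  then have kw: "k * ?w i = c + k * ?w (i + 1)"
    by (simp add: k_def field_simps)
  have sw: "scl k * scl (?w i) = (scl c + scl k * scl (?w (i + 1)) :: mpol)"
    using kw by (metis scl_add scl_mult)
  have fP: "f \<in> Pn" and fe: "\<And>j. j \<in> {1..n} \<Longrightarrow> uop j f = scl (?w j) * f"
    using f by (auto simp: eigvec_def)
  have g: "g = pact ?s f - scl k * f" by (simp add: g_def k_def)
  have lin: "uop j g = uop j (pact ?s f) - scl k * uop j f" for j
    unfolding g by (simp add: clinear_diff[OF clinear_uop] clinear_scl[OF clinear_uop])
  have "uop j g = scl (wt n c (swap_seq i a) j) * g" if j: "j \<in> {1..n}" for j
  proof -
    consider "j = i" | "j = i + 1" | "j \<noteq> i" "j \<noteq> i + 1" by blast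
    then show ?thesis
    proof cases
      case 1
      have w: "wt n c (swap_seq i a) i = ?w (i + 1)"
        using wt_swap_seq[OF i i'(2) ne] by simp
      have "uop i (pact ?s f) = scl (?w (i + 1)) * pact ?s f + scl c * f"
        using swap_uop_Suc[OF i, of f] fe[OF i'(2)] by (simp add: pact_linear)
      moreover have "scl k * uop i f = (scl c + scl k * scl (?w (i + 1))) * f"
        unfolding fe[OF i'(1)] by (simp add: sw flip: mult.assoc)
      ultimately show ?thesis
        unfolding 1 lin w unfolding g by (simp add: algebra_simps)
    next
      case 2
      have w: "wt n c (swap_seq i a) (i + 1) = ?w i"
        using wt_swap_seq[OF i i'(1) ne] by simp
      have "uop (i + 1) (pact ?s f) = scl (?w i) * pact ?s f - scl c * f"
        using swap_uop[OF i, of f] fe[OF i'(1)] by (simp add: pact_linear)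
      moreover have "scl (?w i) * (scl k * f) = scl c * f + scl k * (scl (?w (i + 1)) * f)"
        using arg_cong[OF sw, of "\<lambda>x. x * f"] by (simp add: algebra_simps)
      ultimately show ?thesis
        unfolding 2 lin w fe[OF i'(2)] unfolding g by (simp add: right_diff_distrib)
    next
      case 3
      have w: "wt n c (swap_seq i a) j = ?w j"
        using wt_swap_seq[OF i j ne] 3 by simp
      have "uop j (pact ?s f) = scl (?w j) * pact ?s f"
        using swap_uop_other[OF i j 3, of f] fe[OF j] by (simp add: pact_linear)
      then show ?thesis
        unfolding lin w fe[OF j] unfolding g by (simp add: algebra_simps)
    qed
  qed
  moreover have "g \<in> Pn"
    unfolding g using i' by (intro Pn_diff Pn_pact Pn_scl_mult affected_swap_subset fP)
  ultimately show ?thesis by (simp add: eigvec_def)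
qed

text \<open>The swapped monomial has larger \<open>mu\<close> than the leading monomial of
  \<open>f\<close>, so it does not occur in \<open>f\<close>; its coefficient comes from
  \<open>s_i f\<close> alone.\<close>

lemma lookup_eigvec_swap:
  assumes i: "i \<in> {1..<n}" and gt: "a i > a (i + 1)" and f: "eigvec a f"
  shows "lookup (pact (swp i (i + 1)) f - scl k * f) (exps (swap_seq i a)) = lookup f (exps a)"
proof -
  have "mu a < mu (swap_seq i a)"
    using mu_swap_seq_less[OF i, of "swap_seq i a"] gt by (simp add: swap_seq_swap_seq) (simp add: swap_seq_def)
  then have "exps (swap_seq i a) \<notin> keys f"
    using eigvec_leading(2)[OF f, of "exps (swap_seq i a)"] by (metis keys_zero empty_iff less_asym mu_lookup_exps)
  then have "lookup f (exps (swap_seq i a)) = 0" by (simp add: in_keys_iff)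
  then show ?thesis
    using i by (simp add: lookup_minus lookup_scl_mult) (simp add: exps_swap_seq lookup_pact)
qed

text \<open>Equal neighbours have consecutive ranks, so \<open>w_i - w_{i+1} = c\<close> and
  \<open>s_i f - f\<close> has the exchanged weights. If it were nonzero, its leading monomial would
  have entries \<open>a_{s_i(j)} = a_j\<close>, hence the original weights, and
  \<open>w_i = w_{i+1}\<close> would contradict \<open>c \<noteq> 0\<close>.\<close>

lemma eigvec_swap_equal:
  assumes i: "i \<in> {1..<n}" and eq: "a i = a (i + 1)" and f: "eigvec a f"
  shows "pact (swp i (i + 1)) f = f"
proof (rule ccontr)
  let ?s = "swp i (i + 1)" and ?w = "wt n c a"
  assume "pact ?s f \<noteq> f"
  define h where "h = pact ?s f - f"
  have h0: "h \<noteq> 0" using \<open>pact ?s f \<noteq> f\<close> by (simp add: h_def)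
  have i': "i \<in> {1..n}" "i + 1 \<in> {1..n}" using i by auto
  have fP: "f \<in> Pn" and fe: "\<And>j. j \<in> {1..n} \<Longrightarrow> uop j f = scl (?w j) * f"
    using f by (auto simp: eigvec_def)
  have "{j \<in> {1..n} - {i + 1}. a j < a (i + 1) \<or> a j = a (i + 1) \<and> j < i + 1}
      = insert i {j \<in> {1..n} - {i}. a j < a i \<or> a j = a i \<and> j < i}"
    using i eq by auto
  then have sp: "sort_perm n a (i + 1) = Suc (sort_perm n a i)"
    unfolding sort_perm_eq[OF i'(1)] sort_perm_eq[OF i'(2)] by simp
  then have w: "?w i = c + ?w (i + 1)"
    by (simp add: wt_def eq algebra_simps)
  define w' where "w' = (\<lambda>j. ?w (papply ?s j))"
  have "uop j h = scl (w' j) * h" if j: "j \<in> {1..n}" for j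
  proof -
    have lin: "uop j h = uop j (pact ?s f) - uop j f"
      unfolding h_def by (rule clinear_diff[OF clinear_uop])
    consider "j = i" | "j = i + 1" | "j \<noteq> i" "j \<noteq> i + 1" by blast
    then show ?thesis
    proof cases
      case 1
      have "uop i (pact ?s f) = scl (?w (i + 1)) * pact ?s f + scl c * f"
        using swap_uop_Suc[OF i, of f] fe[OF i'(2)] by (simp add: pact_linear)
      then show ?thesis
        using lin fe[OF i'(1)] w unfolding 1 by (simp add: w'_def h_def scl_add algebra_simps)
    next
      case 2
      have "uop (i + 1) (pact ?s f) = scl (?w i) * pact ?s f - scl c * f"
        using swap_uop[OF i, of f] fe[OF i'(1)] by (simp add: pact_linear)
      then show ?thesis
        using lin fe[OF i'(2)] w unfolding 2 by (simp add: w'_def h_def scl_add algebra_simps)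
    next
      case 3
      have "uop j (pact ?s f) = scl (?w j) * pact ?s f"
        using swap_uop_other[OF i j 3, of f] fe[OF j] by (simp add: pact_linear)
      then show ?thesis
        using lin fe[OF j] 3 by (simp add: w'_def h_def algebra_simps)
    qed
  qed
  note he = this
  have hP: "h \<in> Pn" unfolding h_def using i' by (intro Pn_diff Pn_pact affected_swap_subset fP)
  obtain b where b: "b \<in> keys h" "\<And>b'. b' \<in> keys h \<Longrightarrow> mu (lookup b') \<le> mu (lookup b)"
    using ex_maximal_key[OF h0] by blast
  have wb: "w' j = wt n c (lookup b) j" if "j \<in> {1..n}" for j
    by (rule eigenvector_leading[OF hP he b that])
  have sj: "papply ?s j \<in> {1..n}" if "j \<in> {1..n}" for j
    using papply_in_iff[OF affected_swap_subset[OF i']] that by simp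
  have "lookup b j = a j" if "j \<in> {1..n}" for j
  proof -
    have "lookup b j = a (papply ?s j)"
      using wt_eqD(1)[of a "papply ?s j" "lookup b" j] wb that sj by (simp add: w'_def)
    then show ?thesis using eq by (cases "j = i"; cases "j = i + 1") auto
  qed
  then have "wt n c (lookup b) i = ?w i" by (intro wt_cong i') auto
  then have "?w (i + 1) = ?w i" using wb[OF i'(1)] by (simp add: w'_def)
  then show False using w c_nonzero by simp
qed

lemma eigvec_one:
  assumes zero: "\<forall>l\<in>{1..n}. a l = 0"
  shows "eigvec a 1" "lookup 1 (exps a) = (1::complex)"
proof -
  have u: "uop i 1 = scl (wt n c a i) * 1" if i: "i \<in> {1..n}" for i
  proof -
    have "{j \<in> {1..n} - {i}. a j < a i \<or> a j = a i \<and> j < i} = {1..<i}"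
      using zero i by auto
    then have "sort_perm n a i = i" unfolding sort_perm_eq[OF i] using i by simp
    then have "wt n c a i = - (c * of_nat (i - 1))"
      using zero i by (simp add: wt_def of_nat_diff)
    moreover have "uop i 1 = - (scl c * of_nat (i - 1))"
      by (simp add: uop_def)
    moreover have "scl (of_nat k) = (of_nat k :: mpol)" for k by (simp add: scl_def)
    ultimately show ?thesis by (simp add: scl_uminus scl_mult)
  qed
  have 0: "exps a = 0" by (rule poly_mapping_eqI) (use zero in \<open>auto simp: lookup_exps\<close>)
  show "eigvec a 1" using u by (simp add: eigvec_def)
  show "lookup 1 (exps a) = (1::complex)" by (simp add: 0)
qed

lemma eigvec_exists: "\<exists>f. eigvec a f \<and> lookup f (exps a) = 1"
  using n_pos
proof (induction a rule: seq_induct)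
  case (zero a)
  then show ?case using eigvec_one by blast
next
  case (pi a)
  then obtain f where "eigvec (pi_inv_seq n a) f" "lookup f (exps (pi_inv_seq n a)) = 1" by blast
  note f = eigvec_tau[OF n_pos this(1)] this(2)
  have "pi_seq n (pi_inv_seq n a) l = a l" if "l \<in> {1..n}" for l
    using pi_seq_pi_inv_seq pi(1) that by blast
  then have "eigvec a (tau f)" "exps (pi_seq n (pi_inv_seq n a)) = exps a"
    using eigvec_cong[of "pi_seq n (pi_inv_seq n a)" a "tau f"] f(1) exps_eq_iff by auto
  then show ?case using f(2,3) by auto
next
  case (swap a i)
  then obtain f where f: "eigvec (swap_seq i a) f" "lookup f (exps (swap_seq i a)) = 1" by blast
  have gt: "swap_seq i a i > swap_seq i a (i + 1)" using swap by (simp add: swap_seq_def)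
  then show ?case
    using eigvec_swap[OF swap(1) _ f(1)] lookup_eigvec_swap[OF swap(1) gt f(1)] f(2)
    unfolding swap_seq_swap_seq by (metis less_irrefl)
qed

definition V :: "(nat \<Rightarrow> nat) \<Rightarrow> mpol" where
  "V a = (THE f. eigvec a f \<and> lookup f (exps a) = 1)"

lemma V_eqI: "eigvec a f \<Longrightarrow> lookup f (exps a) = 1 \<Longrightarrow> V a = f"
  unfolding V_def by (rule the_equality) (auto intro: eigvec_unique)

lemma eigvec_V: "eigvec a (V a)" and lookup_V: "lookup (V a) (exps a) = 1"
  using eigvec_exists[of a] V_eqI by blast+

lemma V_cong: "(\<And>l. l \<in> {1..n} \<Longrightarrow> a l = b l) \<Longrightarrow> V a = V b"
  using eigvec_cong[of a b] exps_eq_iff[of a b] unfolding V_def by auto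

lemma V_in_Pn: "V a \<in> Pn" and uop_V: "i \<in> {1..n} \<Longrightarrow> uop i (V a) = scl (wt n c a i) * V a"
  using eigvec_V by (auto simp: eigvec_def)

lemma V_nonzero: "V a \<noteq> 0"
  using lookup_V[of a] by auto

lemma V_zero: "\<forall>l\<in>{1..n}. a l = 0 \<Longrightarrow> V a = 1"
  using V_eqI eigvec_one by blast

lemma tau_V: "tau (V a) = V (pi_seq n a)"
  using V_eqI eigvec_tau[OF n_pos eigvec_V] lookup_V by metis

lemma V_pi_inv: "a 1 > 0 \<Longrightarrow> V a = tau (V (pi_inv_seq n a))"
  unfolding tau_V by (rule V_cong) (simp add: pi_seq_pi_inv_seq)

text \<open>Write \<open>V a\<close> as \<open>\<tau>\<close> of \<open>V\<close> at
  \<open>\<pi>^{-1} a\<close> and use \<open>\<lambda> \<tau> = u_n + 1\<close>; the resulting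
  factor is the weight that \<open>\<pi>\<close> moves to the front.\<close>

lemma lam_V:
  assumes "a 1 > 0"
  shows "lam (V a) = scl (wt n c a 1) * V (pi_inv_seq n a)"
proof -
  let ?b = "pi_inv_seq n a"
  have "wt n c a 1 = wt n c (pi_seq n ?b) 1"
    by (rule wt_cong) (use n_pos assms in \<open>auto simp: pi_seq_pi_inv_seq\<close>)
  also have "\<dots> = wt n c ?b n + 1"
    using wt_pi_seq[of n ?b] n_pos by (simp add: papply_long_cycle)
  finally show ?thesis
    unfolding V_pi_inv[of a, OF assms] lam_tau[OF n_pos] using uop_V[of n ?b] n_pos
    by (simp add: scl_add distrib_right)
qed

lemma wt_1_zero:
  assumes "a 1 = 0"
  shows "wt n c a 1 = 0"
proof -
  have "{j \<in> {1..n} - {1}. a j < a 1 \<or> a j = a 1 \<and> j < 1} = {}" using assms by auto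
  then have "sort_perm n a 1 = 1" using sort_perm_eq[of 1 a] n_pos by simp
  then show ?thesis using assms by (simp add: wt_def)
qed

text \<open>\<open>\<tau> \<lambda> = u_1\<close> acts by \<open>w_1 = 0\<close>, and
  \<open>\<tau>\<close> is injective.\<close>

lemma lam_V_zero:
  assumes "a 1 = 0"
  shows "lam (V a) = 0"
proof -
  have "tau (lam (V a)) = 0" unfolding tau_lam using uop_V[of 1 a] n_pos wt_1_zero[of a, OF assms] by simp
  then show ?thesis by (simp add: tau_eq_0_iff)
qed

lemma wt_1_nonzero:
  assumes "a 1 > 0"
  shows "wt n c a 1 \<noteq> 0"
proof
  assume "wt n c a 1 = 0"
  then have "of_int (int (a 1)) = of_int (int (sort_perm n a 1) - 1) * c"
    by (simp add: wt_def)
  moreover have "\<bar>int (sort_perm n a 1) - 1\<bar> < int n"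
    using sort_perm_bounds[of 1 a] n_pos by auto
  ultimately show False using of_int_eq_mult_cD(1) assms by fastforce
qed

lemma swap_V_gt:
  assumes "i \<in> {1..<n}" "a i > a (i + 1)"
  shows "pact (swp i (i + 1)) (V a) = V (swap_seq i a) + scl (c / (wt n c a i - wt n c a (i + 1))) * V a"
proof -
  have "V (swap_seq i a) = pact (swp i (i + 1)) (V a) - scl (c / (wt n c a i - wt n c a (i + 1))) * V a"
    by (rule V_eqI) (use assms eigvec_swap[OF _ _ eigvec_V] lookup_eigvec_swap[OF _ _ eigvec_V] lookup_V in auto)
  then show ?thesis by simp
qed

text \<open>The descending formula holds for \<open>s_i a\<close>, whose weights are exchanged, so
  its scalar is \<open>- k\<close>. Applying the involution \<open>s_i\<close> once more gives the
  coefficient \<open>1 - k^2\<close>, which factors as stated.\<close>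

lemma swap_V_lt:
  assumes i: "i \<in> {1..<n}" and lt: "a i < a (i + 1)"
  defines "w \<equiv> wt n c a"
  shows "pact (swp i (i + 1)) (V a)
    = scl ((w (i + 1) - w i - c) * (w (i + 1) - w i + c) / (w i - w (i + 1))\<^sup>2) * V (swap_seq i a)
      + scl (c / (w i - w (i + 1))) * V a"
proof -
  let ?s = "swp i (i + 1)" and ?b = "swap_seq i a"
  have i': "i \<in> {1..n}" "i + 1 \<in> {1..n}" using i by auto
  have ne: "a i \<noteq> a (i + 1)" using lt by simp
  have wne: "w i - w (i + 1) \<noteq> 0" using wt_neq[OF i' ne] by (simp add: w_def)
  define k where "k = c / (w i - w (i + 1))"
  have "wt n c ?b i = w (i + 1)" "wt n c ?b (i + 1) = w i"
    using wt_swap_seq[OF i i'(2) ne] wt_swap_seq[OF i i'(1) ne] by (simp_all add: w_def)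
  then have kb: "c / (wt n c ?b i - wt n c ?b (i + 1)) = - k"
    using wne by (simp add: k_def divide_simps) (simp add: algebra_simps)
  have "?b i > ?b (i + 1)" using lt by (simp add: swap_seq_def)
  from swap_V_gt[of i ?b, OF i this]
  have 1: "pact ?s (V ?b) = V a - scl k * V ?b"
    unfolding kb swap_seq_swap_seq by (simp add: scl_uminus)
  then have "V a = pact ?s (V ?b) + scl k * V ?b" by simp
  then have "pact ?s (V a) = V ?b + scl k * pact ?s (V ?b)"
    by (metis pact_linear(1,3) pact_swap_swap)
  also have "\<dots> = scl (1 - k * k) * V ?b + scl k * V a"
    unfolding 1 by (simp add: scl_diff scl_mult algebra_simps)
  also have "1 - k * k = (w (i + 1) - w i - c) * (w (i + 1) - w i + c) / (w i - w (i + 1))\<^sup>2"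
  proof -
    define d where "d = w i - w (i + 1)"
    have "(w (i + 1) - w i - c) * (w (i + 1) - w i + c) = d * d - c * c"
      by (simp add: d_def algebra_simps)
    moreover have "d \<noteq> 0" using wne by (simp add: d_def)
    ultimately show ?thesis
      unfolding k_def d_def[symmetric] by (simp add: power2_eq_square divide_simps)
  qed
  finally show ?thesis by (simp add: k_def)
qed

lemma swap_V_eq: "i \<in> {1..<n} \<Longrightarrow> a i = a (i + 1) \<Longrightarrow> pact (swp i (i + 1)) (V a) = V a"
  using eigvec_swap_equal eigvec_V by blast

end

section \<open>Subspaces stable under the algebra\<close>

context dunkl
begin

text \<open>Uses \<open>s_{i,j+1} = s_j s_{ij} s_j\<close>, where \<open>s_j\<close> is the adjacent
  transposition.\<close>

lemma pact_swap_closed: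
  assumes adj: "\<And>i f. i \<in> {1..<n} \<Longrightarrow> f \<in> N \<Longrightarrow> pact (swp i (i + 1)) f \<in> N"
    and "1 \<le> i" "i < j" "j \<le> n" "f \<in> N"
  shows "pact (swp i j) f \<in> N"
proof -
  have "Suc i \<le> j" using assms by simp
  then show ?thesis using \<open>j \<le> n\<close> \<open>f \<in> N\<close>
  proof (induction arbitrary: f rule: dec_induct)
    case base
    then show ?case using adj[of i f] \<open>1 \<le> i\<close> by (simp add: Suc_eq_plus1)
  next
    case (step j)
    let ?s = "swp j (j + 1)"
    have j: "j \<in> {1..<n}" using step.hyps step.prems by auto
    have "pact (swp i (j + 1)) f = pact ?s (pact (swp i j) (pact ?s f))"
      using pact_swap_conj[of ?s i j "pact ?s f"] step.hyps by simp
    then show ?case using step adj j by (simp add: Suc_eq_plus1)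
  qed
qed

text \<open>Composing \<open>p\<close> with the transposition of \<open>i\<close> and
  \<open>p(i)\<close> fixes \<open>i\<close> and moves no new point, so the support shrinks.\<close>

lemma pact_closed:
  assumes adj: "\<And>i f. i \<in> {1..<n} \<Longrightarrow> f \<in> N \<Longrightarrow> pact (swp i (i + 1)) f \<in> N"
    and "affected p \<subseteq> {1..n}" "f \<in> N"
  shows "pact p f \<in> N"
  using assms(2,3)
proof (induction "card (affected p)" arbitrary: p f rule: less_induct)
  case less
  show ?case
  proof (cases "p = 1")
    case False
    then obtain i where i: "i \<in> affected p" using affected_empty_iff by blast
    let ?j = "papply p i"
    let ?q = "swp i ?j * p"
    have ij: "?j \<noteq> i" "i \<in> {1..n}" "?j \<in> {1..n}"
      using i less.prems(1) papply_in_iff[OF less.prems(1)] by (auto simp: in_affected)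
    have "affected ?q \<subseteq> affected p"
      using affected_times[of "swp i ?j" p] ij i by (auto simp: affected_swap)
    moreover have "i \<notin> affected ?q"
      by (simp add: in_affected apply_times)
    ultimately have sub: "affected ?q \<subset> affected p" using i by blast
    then have "card (affected ?q) < card (affected p)" by (simp add: psubset_card_mono)
    then have "pact ?q f \<in> N" using less sub by blast
    then have "pact (swp i ?j) (pact ?q f) \<in> N"
      using pact_swap_closed[where N = N, OF adj, of i ?j] pact_swap_closed[where N = N, OF adj, of ?j i] ij
      by (cases "i < ?j") (auto simp: swap_sym[of ?j i])
    moreover have "pact (swp i ?j) (pact ?q f) = pact p f"
      by (simp add: pact_times)
    ultimately show ?thesis by simp
  qed (use less in simp)
qed

text \<open>Submodules of the polynomial representation, described through generators. Their match
  with submodules of the standard module is given by \<open>submodule_E_image\<close> and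
  \<open>submodule_D_stable\<close>.\<close>

definition stable :: "mpol set \<Rightarrow> bool" where
  "stable N \<longleftrightarrow> N \<subseteq> Pn \<and> 0 \<in> N \<and> (\<forall>f\<in>N. \<forall>g\<in>N. f + g \<in> N) \<and> (\<forall>z. \<forall>f\<in>N. scl z * f \<in> N) \<and>
     (\<forall>p. affected p \<subseteq> {1..n} \<longrightarrow> (\<forall>f\<in>N. pact p f \<in> N)) \<and>
     (\<forall>i\<in>{1..n}. \<forall>f\<in>N. var i * f \<in> N) \<and> (\<forall>i\<in>{1..n}. \<forall>f\<in>N. dk i f \<in> N)"

lemma stableD:
  assumes "stable N"
  shows "f \<in> N \<Longrightarrow> f \<in> Pn" "0 \<in> N" "f \<in> N \<Longrightarrow> g \<in> N \<Longrightarrow> f + g \<in> N" "f \<in> N \<Longrightarrow> scl z * f \<in> N"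
    "affected p \<subseteq> {1..n} \<Longrightarrow> f \<in> N \<Longrightarrow> pact p f \<in> N"
    "i \<in> {1..n} \<Longrightarrow> f \<in> N \<Longrightarrow> var i * f \<in> N" "i \<in> {1..n} \<Longrightarrow> f \<in> N \<Longrightarrow> dk i f \<in> N"
  using assms unfolding stable_def by blast+

lemma stable_diff: "stable N \<Longrightarrow> f \<in> N \<Longrightarrow> g \<in> N \<Longrightarrow> f - g \<in> N"
  using stableD(3)[of N f "scl (-1) * g"] stableD(4)[of N g "-1"] by (simp add: scl_uminus)

lemma stable_sum: "stable N \<Longrightarrow> (\<And>x. x \<in> A \<Longrightarrow> f x \<in> N) \<Longrightarrow> (\<Sum>x\<in>A. f x) \<in> N"
  by (induction A rule: infinite_finite_induct) (auto intro: stableD)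

lemma stable_uop: "stable N \<Longrightarrow> i \<in> {1..n} \<Longrightarrow> f \<in> N \<Longrightarrow> uop i f \<in> N"
  unfolding uop_def
  by (intro stable_diff stableD(4,5,6,7) stable_sum affected_swap_subset) auto

lemma stable_lam: "stable N \<Longrightarrow> n > 0 \<Longrightarrow> f \<in> N \<Longrightarrow> lam f \<in> N"
  unfolding lam_def using affected_long_cycle by (intro stableD(5,7)) auto

text \<open>The \<open>s_i\<close> with \<open>\<tau>\<close> and \<open>\<lambda>\<close> generate
  the algebra: with \<open>g\<close> the long cycle, \<open>x_1 = \<tau> g^{-1}\<close> and
  \<open>y_1 = g \<lambda>\<close>, and transpositions conjugate these to all \<open>x_i\<close> and
  \<open>y_i\<close>.\<close>

lemma stableI:
  assumes n: "n > 0" and sub: "N \<subseteq> Pn" and "0 \<in> N" "\<And>f g. f \<in> N \<Longrightarrow> g \<in> N \<Longrightarrow> f + g \<in> N"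
    and "\<And>z f. f \<in> N \<Longrightarrow> scl z * f \<in> N"
    and adj: "\<And>i f. i \<in> {1..<n} \<Longrightarrow> f \<in> N \<Longrightarrow> pact (swp i (i + 1)) f \<in> N"
    and tau: "\<And>f. f \<in> N \<Longrightarrow> tau f \<in> N" and lam: "\<And>f. f \<in> N \<Longrightarrow> lam f \<in> N"
  shows "stable N"
proof -
  have pact: "pact p f \<in> N" if "affected p \<subseteq> {1..n}" "f \<in> N" for p f
    by (rule pact_closed) (use adj that in auto)
  have cyc: "affected (inverse (long_cycle n)) \<subseteq> {1..n}" using affected_long_cycle by simp
  have sw: "affected (swp 1 i) \<subseteq> {1..n}" if "i \<in> {1..n}" for i
    using affected_swap_subset[of 1 i] that n by simp
  have var1: "var 1 * f \<in> N" if "f \<in> N" for f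
    using tau[OF pact[OF cyc that]] by (simp add: tau_def)
  have var: "var i * f \<in> N" if i: "i \<in> {1..n}" and f: "f \<in> N" for i f
  proof -
    have "var i * f = pact (swp 1 i) (var 1 * pact (swp 1 i) f)"
      by (simp add: pact_mult pact_var)
    then show ?thesis using pact[OF sw[OF i]] var1 f by simp
  qed
  have dk1: "dk 1 f \<in> N" if "f \<in> N" for f
    using pact[OF affected_long_cycle lam[OF that]] by (simp add: lam_def)
  have dk: "dk i f \<in> N" if i: "i \<in> {1..n}" and f: "f \<in> N" for i f
  proof -
    have "dk i f = pact (swp 1 i) (dk 1 (pact (swp 1 i) f))"
      using pact_dk[OF sw[OF i], of 1 "pact (swp 1 i) f"] n by simp
    then show ?thesis using pact[OF sw[OF i]] dk1 f by simp
  qed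
  show ?thesis
    unfolding stable_def by (intro conjI allI ballI impI assms(2-5) pact var dk)
qed

lemma stable_one_imp_all:
  assumes "stable N" "1 \<in> N"
  shows "N = Pn"
proof
  show "Pn \<subseteq> N"
  proof
    fix f assume "f \<in> Pn"
    then have "\<forall>a\<in>keys f. keys a \<subseteq> {1..n}" by (simp add: Pn_def)
    then show "f \<in> N"
    proof (induction f rule: poly_induct_vars)
      case (scl z)
      show ?case using stableD(4)[OF assms, of z] by simp
    qed (use stableD[OF assms(1)] in blast)+
  qed
qed (use stableD(1)[OF assms(1)] in blast)

lemma stable_zero: "stable {0}"
  by (simp add: stable_def pact_linear dk_linear)

end

section \<open>The sequences of part (b)\<close>

context rational_dunkl
begin

definition good :: "(nat \<Rightarrow> nat) \<Rightarrow> bool" where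
  "good a \<longleftrightarrow> (\<forall>i\<in>{1..n}. \<forall>j\<in>{1..n}.
     \<bar>int (a i) - int (a j)\<bar> \<le> int m \<and> (int (a i) - int (a j) = int m \<longrightarrow> i < j))"

text \<open>Failure of the condition as one inequality whose threshold depends on the order of the
  positions, so that its behaviour under \<open>\<pi>\<close> and \<open>s_i\<close> can be followed
  pair by pair.\<close>

definition bad_pair :: "(nat \<Rightarrow> nat) \<Rightarrow> nat \<Rightarrow> nat \<Rightarrow> bool" where
  "bad_pair a i j \<longleftrightarrow> a j + m + (if i < j then 1 else 0) \<le> a i"

lemma not_good_iff: "\<not> good a \<longleftrightarrow> (\<exists>i\<in>{1..n}. \<exists>j\<in>{1..n}. bad_pair a i j)"
proof
  assume "\<not> good a"
  then obtain i j where ij: "i \<in> {1..n}" "j \<in> {1..n}"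
    and ng: "\<not> (\<bar>int (a i) - int (a j)\<bar> \<le> int m \<and> (int (a i) - int (a j) = int m \<longrightarrow> i < j))"
    unfolding good_def by blast
  then have "bad_pair a i j \<or> bad_pair a j i"
    unfolding bad_pair_def by (auto split: if_splits)
  then show "\<exists>i\<in>{1..n}. \<exists>j\<in>{1..n}. bad_pair a i j" using ij by blast
next
  assume "\<exists>i\<in>{1..n}. \<exists>j\<in>{1..n}. bad_pair a i j"
  then obtain i j where ij: "i \<in> {1..n}" "j \<in> {1..n}" and "bad_pair a i j" by blast
  then have "\<not> (\<bar>int (a i) - int (a j)\<bar> \<le> int m \<and> (int (a i) - int (a j) = int m \<longrightarrow> i < j))"
    unfolding bad_pair_def by (auto split: if_splits)
  then show "\<not> good a" using ij unfolding good_def by blast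
qed

lemma good_cong: "(\<And>l. l \<in> {1..n} \<Longrightarrow> a l = b l) \<Longrightarrow> good a = good b"
  by (simp add: good_def)

lemma good_zero: "\<forall>l\<in>{1..n}. a l = 0 \<Longrightarrow> good a"
  using m_pos by (simp add: good_def)

text \<open>Moving the last position to the front reverses its order with all others and shifts the
  threshold by one, which the increase of its entry compensates exactly. Bad pairs thus correspond
  to bad pairs.\<close>

lemma good_pi_seq: "good (pi_seq n a) \<longleftrightarrow> good a"
proof -
  let ?g = "papply (long_cycle n)"
  have iff: "bad_pair (pi_seq n a) (?g i) (?g j) \<longleftrightarrow> bad_pair a i j" if "i \<in> {1..n}" "j \<in> {1..n}" for i j
    using that m_pos unfolding bad_pair_def pi_seq_papply[OF that(1)] pi_seq_papply[OF that(2)]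
    by (auto simp: papply_long_cycle)
  have in_iff: "?g i \<in> {1..n} \<longleftrightarrow> i \<in> {1..n}" for i
    by (rule papply_in_iff[OF affected_long_cycle])
  have surj: "\<exists>j\<in>{1..n}. i = ?g j" if "i \<in> {1..n}" for i
    using that in_iff[of "papply (inverse (long_cycle n)) i"] by (metis papply_inverse_cancel(2))
  have "(\<exists>i\<in>{1..n}. \<exists>j\<in>{1..n}. bad_pair (pi_seq n a) i j) \<longleftrightarrow> (\<exists>i\<in>{1..n}. \<exists>j\<in>{1..n}. bad_pair a i j)"
  proof
    assume "\<exists>i\<in>{1..n}. \<exists>j\<in>{1..n}. bad_pair (pi_seq n a) i j"
    then obtain i j where ij: "i \<in> {1..n}" "j \<in> {1..n}" "bad_pair (pi_seq n a) i j" by blast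
    obtain i' where i': "i' \<in> {1..n}" "i = ?g i'" using surj ij(1) by blast
    obtain j' where j': "j' \<in> {1..n}" "j = ?g j'" using surj ij(2) by blast
    then show "\<exists>i\<in>{1..n}. \<exists>j\<in>{1..n}. bad_pair a i j" using iff[of i' j'] i' ij by blast
  next
    assume "\<exists>i\<in>{1..n}. \<exists>j\<in>{1..n}. bad_pair a i j"
    then show "\<exists>i\<in>{1..n}. \<exists>j\<in>{1..n}. bad_pair (pi_seq n a) i j" using iff in_iff by blast
  qed
  then show ?thesis using not_good_iff by blast
qed

lemma good_pi_inv_seq: "a 1 > 0 \<Longrightarrow> good (pi_inv_seq n a) \<longleftrightarrow> good a"
  using good_pi_seq[of "pi_inv_seq n a"] good_cong[of "pi_seq n (pi_inv_seq n a)" a]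
  by (simp add: pi_seq_pi_inv_seq)

lemma bad_pair_swap_seq:
  assumes "\<not> (p = i \<and> q = i + 1)" "\<not> (p = i + 1 \<and> q = i)"
  shows "bad_pair (swap_seq i a) (papply (swp i (i + 1)) p) (papply (swp i (i + 1)) q) \<longleftrightarrow> bad_pair a p q"
proof -
  have "papply (swp i (i + 1)) p < papply (swp i (i + 1)) q \<longleftrightarrow> p < q"
    using assms by (cases "p = i"; cases "p = i + 1"; cases "q = i"; cases "q = i + 1") auto
  then show ?thesis by (simp only: bad_pair_def swap_seq_papply)
qed

lemma swap_seq_simps: "swap_seq i a i = a (i + 1)" "swap_seq i a (i + 1) = a i"
  "j \<noteq> i \<Longrightarrow> j \<noteq> i + 1 \<Longrightarrow> swap_seq i a j = a j"
  by (auto simp: swap_seq_def)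

text \<open>Only the pair \<open>i, i + 1\<close> changes its order; when the larger entry moves
  right, the threshold for being bad drops from \<open>m + 1\<close> to \<open>m\<close>.\<close>

lemma not_good_swap_seq_gt:
  assumes i: "i \<in> {1..<n}" and gt: "a i > a (i + 1)" and bad: "\<not> good a"
  shows "\<not> good (swap_seq i a)"
proof -
  have i': "i \<in> {1..n}" "i + 1 \<in> {1..n}" using i by auto
  obtain p q where pq: "p \<in> {1..n}" "q \<in> {1..n}" "bad_pair a p q" using bad not_good_iff by blast
  show ?thesis
  proof (cases "p = i \<and> q = i + 1")
    case True
    then have "bad_pair (swap_seq i a) (i + 1) i"
      using pq(3) unfolding bad_pair_def swap_seq_simps by simp
    then show ?thesis using i' not_good_iff by blast
  next
    case False
    moreover have "\<not> (p = i + 1 \<and> q = i)" using pq(3) gt by (auto simp: bad_pair_def)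
    ultimately have "bad_pair (swap_seq i a) (papply (swp i (i + 1)) p) (papply (swp i (i + 1)) q)"
      using bad_pair_swap_seq pq(3) by blast
    then show ?thesis
      using papply_in_iff[OF affected_swap_subset[OF i']] pq(1,2) not_good_iff by blast
  qed
qed

text \<open>If swapping makes a bad sequence good, then the swapped entries are the first and the last
  one in sorting order and differ by \<open>m\<close>, so that their weights differ by \<open>m - (n - 1) c = c\<close>.\<close>

lemma swap_coefficient_zero:
  assumes i: "i \<in> {1..<n}" and lt: "a i < a (i + 1)" and bad: "\<not> good a" and good: "good (swap_seq i a)"
  shows "wt n c a (i + 1) - wt n c a i = c"
proof -
  let ?b = "swap_seq i a"
  have i': "i \<in> {1..n}" "i + 1 \<in> {1..n}" using i by auto
  have nb: "\<not> bad_pair ?b p q" if "p \<in> {1..n}" "q \<in> {1..n}" for p q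
    using good not_good_iff that by blast
  obtain p q where pq: "p \<in> {1..n}" "q \<in> {1..n}" "bad_pair a p q" using bad not_good_iff by blast
  have "p = i + 1 \<and> q = i"
  proof (rule ccontr)
    assume "\<not> (p = i + 1 \<and> q = i)"
    moreover have "\<not> (p = i \<and> q = i + 1)" using pq(3) lt by (auto simp: bad_pair_def)
    ultimately have "bad_pair ?b (papply (swp i (i + 1)) p) (papply (swp i (i + 1)) q)"
      using bad_pair_swap_seq pq(3) by blast
    then show False
      using papply_in_iff[OF affected_swap_subset[OF i']] pq(1,2) nb by blast
  qed
  then have "a i + m \<le> a (i + 1)" using pq(3) by (simp add: bad_pair_def)
  moreover have "\<not> a i + m + 1 \<le> a (i + 1)"
    using nb[OF i'] unfolding bad_pair_def swap_seq_simps by simp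
  ultimately have am: "a (i + 1) = a i + m" by linarith
  \<comment> \<open>In the swapped sequence position \<open>i\<close> holds \<open>a_i + m\<close>,
    so a position \<open>j\<close> ranked before \<open>i\<close> would make the pair
    \<open>i, j\<close> bad there. The last rank of \<open>i + 1\<close> follows in the same way
    from the pairs \<open>j, i + 1\<close>.\<close>
  have "\<not> (a j < a i \<or> a j = a i \<and> j < i)" if j: "j \<in> {1..n} - {i}" for j
  proof (cases "j = i + 1")
    case False
    then have "?b j = a j" using j by (simp add: swap_seq_simps)
    then show ?thesis
      using nb[OF i'(1), of j] j am unfolding bad_pair_def swap_seq_simps(1) by (auto split: if_splits)
  qed (use lt in auto)
  then have "{j \<in> {1..n} - {i}. a j < a i \<or> a j = a i \<and> j < i} = {}" by blast
  then have s1: "sort_perm n a i = 1" using sort_perm_eq[OF i'(1), of a] by simp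
  have "a j < a (i + 1) \<or> a j = a (i + 1) \<and> j < i + 1" if j: "j \<in> {1..n} - {i + 1}" for j
  proof (cases "j = i")
    case False
    then have "?b j = a j" using j by (simp add: swap_seq_simps)
    then show ?thesis
      using nb[OF _ i'(2), of j] j am unfolding bad_pair_def swap_seq_simps(2) by (auto split: if_splits)
  qed (use lt in auto)
  then have "{j \<in> {1..n} - {i + 1}. a j < a (i + 1) \<or> a j = a (i + 1) \<and> j < i + 1} = {1..n} - {i + 1}" by blast
  then have s2: "sort_perm n a (i + 1) = n" using sort_perm_eq[OF i'(2), of a] i' n_pos by simp
  show ?thesis
    unfolding wt_def s1 s2 am using n_pos by (simp add: c_eq field_simps)
qed

text \<open>A zero of a factor means \<open>d = e' c\<close> with \<open>e' = e + 1\<close> or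
  \<open>e' = e - 1\<close>, so \<open>|e'| \<le> n\<close>. This forces \<open>d\<close> to be
  \<open>0\<close>, \<open>m\<close> or \<open>- m\<close>, whereas an ascent without a bad pair has
  \<open>0 < d < m\<close>.\<close>

lemma good_swap_seq_lt:
  assumes i: "i \<in> {1..<n}" and lt: "a i < a (i + 1)" and good: "good a"
  shows "good (swap_seq i a)"
    and "(wt n c a (i + 1) - wt n c a i - c) * (wt n c a (i + 1) - wt n c a i + c) \<noteq> 0"
proof -
  have i': "i \<in> {1..n}" "i + 1 \<in> {1..n}" using i by auto
  have nb: "\<not> bad_pair a (i + 1) i" using good not_good_iff i' by blast
  show "good (swap_seq i a)"
  proof (rule ccontr)
    assume "\<not> good (swap_seq i a)"
    then have "\<not> good (swap_seq i (swap_seq i a))"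
      using not_good_swap_seq_gt[OF i, of "swap_seq i a"] lt swap_seq_simps(1,2)[of i a] by simp
    then show False using good by (simp add: swap_seq_swap_seq)
  qed
  define d e where "d = int (a (i + 1)) - int (a i)" and "e = int (sort_perm n a (i + 1)) - int (sort_perm n a i)"
  have wd: "wt n c a (i + 1) - wt n c a i = of_int d - of_int e * c"
    by (simp add: d_def e_def wt_diff)
  have e: "\<bar>e\<bar> < int n"
    using sort_perm_bounds[OF i'(1), of a] sort_perm_bounds[OF i'(2), of a] unfolding e_def by linarith
  have d: "0 < d" "d < int m" using lt nb by (auto simp: d_def bad_pair_def)
  have ne: "of_int d \<noteq> of_int e' * c" if "\<bar>e'\<bar> \<le> int n" for e'
  proof
    assume eq: "of_int d = of_int e' * c"
    show False
    proof (cases "\<bar>e'\<bar> < int n")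
      case True
      then show False using of_int_eq_mult_cD(1)[OF eq] d by simp
    next
      case False
      then have "e' = int n \<or> e' = - int n" using that by linarith
      moreover have "d * int n = e' * int m" using eq of_int_eq_mult_c_iff by simp
      ultimately have "d * int n = int m * int n \<or> d * int n = (- int m) * int n" by auto
      then have "d = int m \<or> d = - int m" using n_pos unfolding mult_cancel_right by auto
      then show False using d by auto
    qed
  qed
  have "wt n c a (i + 1) - wt n c a i - c \<noteq> 0"
    using ne[of "e + 1"] e unfolding wd by (simp add: algebra_simps)
  moreover have "wt n c a (i + 1) - wt n c a i + c \<noteq> 0"
    using ne[of "e - 1"] e unfolding wd by (simp add: algebra_simps)
  ultimately show "(wt n c a (i + 1) - wt n c a i - c) * (wt n c a (i + 1) - wt n c a i + c) \<noteq> 0"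
    by simp
qed

section \<open>Spans of joint eigenvectors\<close>

definition vspan :: "(nat \<Rightarrow> nat) set \<Rightarrow> mpol set" where
  "vspan S = {f. \<exists>F k. finite F \<and> F \<subseteq> S \<and> f = (\<Sum>a\<in>F. scl (k a) * V a)}"

lemma vspan_sum: "finite F \<Longrightarrow> F \<subseteq> S \<Longrightarrow> (\<Sum>a\<in>F. scl (k a) * V a) \<in> vspan S"
  by (auto simp: vspan_def)

lemma vspan_0: "0 \<in> vspan S"
  using vspan_sum[of "{}"] by simp

lemma vspan_V: "a \<in> S \<Longrightarrow> V a \<in> vspan S"
  using vspan_sum[of "{a}" S "\<lambda>_. 1"] by simp

lemma vspan_scl: "f \<in> vspan S \<Longrightarrow> scl z * f \<in> vspan S"
proof -
  assume "f \<in> vspan S"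
  then obtain F k where F: "finite F" "F \<subseteq> S" "f = (\<Sum>a\<in>F. scl (k a) * V a)" by (auto simp: vspan_def)
  then have "scl z * f = (\<Sum>a\<in>F. scl (z * k a) * V a)" by (simp add: sum_distrib_left scl_mult mult.assoc)
  then show ?thesis using vspan_sum F by simp
qed

lemma vspan_add:
  assumes "f \<in> vspan S" "g \<in> vspan S"
  shows "f + g \<in> vspan S"
proof -
  obtain F k where F: "finite F" "F \<subseteq> S" "f = (\<Sum>a\<in>F. scl (k a) * V a)"
    using assms by (auto simp: vspan_def)
  obtain G l where G: "finite G" "G \<subseteq> S" "g = (\<Sum>a\<in>G. scl (l a) * V a)"
    using assms by (auto simp: vspan_def)
  have "f = (\<Sum>a\<in>F \<union> G. scl (if a \<in> F then k a else 0) * V a)"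
    unfolding F by (rule sum.mono_neutral_cong_left) (use F G in auto)
  moreover have "g = (\<Sum>a\<in>F \<union> G. scl (if a \<in> G then l a else 0) * V a)"
    unfolding G by (rule sum.mono_neutral_cong_left) (use F G in auto)
  ultimately have "f + g = (\<Sum>a\<in>F \<union> G. scl ((if a \<in> F then k a else 0) + (if a \<in> G then l a else 0)) * V a)"
    by (simp only: scl_add distrib_right sum.distrib)
  then show ?thesis using vspan_sum[of "F \<union> G"] F G by simp
qed

lemma vspan_sum_closed: "(\<And>x. x \<in> A \<Longrightarrow> f x \<in> vspan S) \<Longrightarrow> (\<Sum>x\<in>A. f x) \<in> vspan S"
  by (induction A rule: infinite_finite_induct) (auto intro: vspan_add vspan_0)

lemma vspan_clinear:
  assumes "clinear L" "\<And>a. a \<in> S \<Longrightarrow> L (V a) \<in> vspan T" "f \<in> vspan S"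
  shows "L f \<in> vspan T"
proof -
  obtain F k where F: "finite F" "F \<subseteq> S" "f = (\<Sum>a\<in>F. scl (k a) * V a)"
    using assms by (auto simp: vspan_def)
  show ?thesis unfolding F clinear_sum[OF assms(1)] clinear_scl[OF assms(1)]
    by (intro vspan_sum_closed vspan_scl assms(2)) (use F in auto)
qed

lemma vspan_subset_Pn: "vspan S \<subseteq> Pn"
  by (auto simp: vspan_def intro!: Pn_sum Pn_scl_mult V_in_Pn)

lemma restrict_in_seqs: "restrict a {1..n} \<in> seqs n"
  by (simp add: seqs_def)

text \<open>\<open>V a\<close> is \<open>x^a\<close> plus monomials of smaller \<open>mu\<close>, so
  this unitriangular change of basis is inverted by induction on \<open>mu\<close>.\<close>

lemma Pn_eq_vspan: "Pn = vspan (seqs n)"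
proof
  have mon: "single (exps a) 1 \<in> vspan (seqs n)" for a
  proof (induction "mu a" arbitrary: a rule: less_induct)
    case less
    define r where "r = V a - single (exps a) 1"
    have "lookup r (exps a) = 0" by (simp add: r_def lookup_minus lookup_V)
    have "scl (lookup r b) * single b 1 \<in> vspan (seqs n)" if "b \<in> keys r" for b
    proof -
      have "b \<noteq> exps a" using that \<open>lookup r (exps a) = 0\<close> by (auto simp: in_keys_iff)
      then have bV: "b \<in> keys (V a)"
        using that by (simp add: r_def in_keys_iff lookup_minus lookup_single_not_eq)
      then have "mu (lookup b) < mu a"
        using eigvec_leading(2)[OF eigvec_V V_nonzero] \<open>b \<noteq> exps a\<close> by blast
      moreover have "keys b \<subseteq> {1..n}" using bV V_in_Pn[of a] by (auto simp: Pn_def)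
      ultimately show ?thesis using less[of "lookup b"] exps_lookup by (auto intro: vspan_scl)
    qed
    then have "(\<Sum>b\<in>keys r. scl (lookup r b) * single b 1) \<in> vspan (seqs n)"
      by (rule vspan_sum_closed)
    then have r: "r \<in> vspan (seqs n)"
      using clinear_expand[OF clinear_id, of r] by simp
    \<comment> \<open>\<open>seqs n\<close> consists of extensional functions, while
      \<open>a\<close> is arbitrary here.\<close>
    have "V a = V (restrict a {1..n})" by (rule V_cong) simp
    then have "V a \<in> vspan (seqs n)" using vspan_V[OF restrict_in_seqs[of a]] by simp
    then have "V a + scl (-1) * r \<in> vspan (seqs n)" using r by (intro vspan_add vspan_scl)
    then show ?case by (simp add: r_def scl_uminus)
  qed
  show "Pn \<subseteq> vspan (seqs n)"
  proof
    fix f assume f: "f \<in> Pn"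
    have "f = (\<Sum>b\<in>keys f. scl (lookup f b) * single b 1)" using clinear_expand[OF clinear_id, of f] by simp
    also have "\<dots> \<in> vspan (seqs n)"
    proof (intro vspan_sum_closed vspan_scl)
      fix b assume "b \<in> keys f"
      then have "keys b \<subseteq> {1..n}" using f by (auto simp: Pn_def)
      then show "single b 1 \<in> vspan (seqs n)" using mon[of "lookup b"] exps_lookup by simp
    qed
    finally show "f \<in> vspan (seqs n)" .
  qed
qed (rule vspan_subset_Pn)

lemma seqs_eqI: "a \<in> seqs n \<Longrightarrow> b \<in> seqs n \<Longrightarrow> (\<And>i. i \<in> {1..n} \<Longrightarrow> a i = b i) \<Longrightarrow> a = b"
  unfolding seqs_def by (rule PiE_ext)

text \<open>Distinct sequences have distinct weights, so a stable subspace contains the components of its elements.\<close>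

lemma stable_component:
  assumes N: "stable N" and "finite F" "F \<subseteq> seqs n" "(\<Sum>a\<in>F. scl (k a) * V a) \<in> N" "a \<in> F" "k a \<noteq> 0"
  shows "V a \<in> N"
  using assms(2-)
proof (induction F arbitrary: k a rule: finite_induct)
  case (insert b F)
  have sum: "(\<Sum>a\<in>insert b F. scl (k a) * V a) = scl (k b) * V b + (\<Sum>a\<in>F. scl (k a) * V a)"
    using insert by simp
  have F: "V x \<in> N" if x: "x \<in> F" "k x \<noteq> 0" for x
  proof -
    have "x \<noteq> b" using x insert by auto
    then obtain i where i: "i \<in> {1..n}" "x i \<noteq> b i"
      using seqs_eqI[of x b] insert.prems x by blast
    then have ne: "wt n c x i \<noteq> wt n c b i" using wt_eqD(1) by blast
    let ?f = "\<Sum>a\<in>insert b F. scl (k a) * V a"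
    \<comment> \<open>\<open>u_i - w_i(b)\<close> kills the summand of \<open>b\<close> and scales
      that of \<open>x\<close> by a nonzero number, so the induction hypothesis applies with changed
      coefficients.\<close>
    have u: "uop i (scl (k a) * V a) - scl (wt n c b i) * (scl (k a) * V a)
       = scl (k a * (wt n c a i - wt n c b i)) * V a" for a
      using uop_V[OF i(1), of a]
      by (simp add: clinear_scl[OF clinear_uop] scl_mult scl_diff algebra_simps)
    have "uop i ?f - scl (wt n c b i) * ?f = (\<Sum>a\<in>insert b F. scl (k a * (wt n c a i - wt n c b i)) * V a)"
      unfolding u[symmetric] clinear_sum[OF clinear_uop] sum_distrib_left sum_subtractf ..
    also have "\<dots> = (\<Sum>a\<in>F. scl (k a * (wt n c a i - wt n c b i)) * V a)"
      using insert by simp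
    finally have eq: "uop i ?f - scl (wt n c b i) * ?f = (\<Sum>a\<in>F. scl (k a * (wt n c a i - wt n c b i)) * V a)" .
    have "uop i ?f - scl (wt n c b i) * ?f \<in> N"
      by (intro stable_diff[OF N] stable_uop[OF N i(1)] stableD(4)[OF N] insert.prems(2))
    then have "(\<Sum>a\<in>F. scl (k a * (wt n c a i - wt n c b i)) * V a) \<in> N"
      unfolding eq .
    then show ?thesis
      using insert.IH[of "\<lambda>a. k a * (wt n c a i - wt n c b i)" x] insert.prems ne x by auto
  qed
  show ?case
  proof (cases "a = b")
    case True
    have "scl (k x) * V x \<in> N" if "x \<in> F" for x
      using F[OF that] stableD(2,4)[OF N] by (cases "k x = 0") auto
    then have "(\<Sum>a\<in>F. scl (k a) * V a) \<in> N" by (rule stable_sum[OF N])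
    then have "(\<Sum>a\<in>insert b F. scl (k a) * V a) - (\<Sum>a\<in>F. scl (k a) * V a) \<in> N"
      using insert.prems by (intro stable_diff[OF N])
    then have "scl (k b) * V b \<in> N" unfolding sum by simp
    then have "scl (1 / k b) * (scl (k b) * V b) \<in> N" by (rule stableD(4)[OF N])
    then show ?thesis using True insert.prems(4) by (simp add: scl_inverse_cancel)
  next
    case False
    then show ?thesis using F insert.prems by blast
  qed
qed simp

text \<open>The zero space is stable, so a vanishing combination with a nonzero coefficient would
  force some \<open>V a\<close> to be zero.\<close>

lemma V_independent:
  assumes "finite F" "F \<subseteq> seqs n" "(\<Sum>a\<in>F. scl (k a) * V a) = 0" "a \<in> F"
  shows "k a = 0"
  using stable_component[OF stable_zero assms(1,2), of k a] assms(3,4) V_nonzero[of a] by auto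

lemma V_in_vspanD:
  assumes "a \<in> seqs n" "S \<subseteq> seqs n" "V a \<in> vspan S"
  shows "a \<in> S"
proof (rule ccontr)
  assume a: "a \<notin> S"
  obtain F k where F: "finite F" "F \<subseteq> S" "V a = (\<Sum>b\<in>F. scl (k b) * V b)"
    using assms by (auto simp: vspan_def)
  let ?k = "\<lambda>b. if b = a then - 1 else k b"
  have "a \<notin> F" using a F by auto
  then have "(\<Sum>b\<in>F. scl (?k b) * V b) = (\<Sum>b\<in>F. scl (k b) * V b)"
    by (intro sum.cong) auto
  then have "(\<Sum>b\<in>insert a F. scl (?k b) * V b) = 0"
    using F \<open>a \<notin> F\<close> by (simp add: scl_uminus)
  then have "?k a = 0"
    by (rule V_independent[rotated 2]) (use F assms in auto)
  then show False by simp
qed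

definition bad_span :: "mpol set" where
  "bad_span = vspan {a \<in> seqs n. \<not> good a}"

lemma swap_seq_in_seqs: "i \<in> {1..<n} \<Longrightarrow> a \<in> seqs n \<Longrightarrow> swap_seq i a \<in> seqs n"
  by (auto simp: seqs_def swap_seq_def PiE_def extensional_def)

lemma pi_seq_in_seqs: "pi_seq n a \<in> seqs n" and pi_inv_seq_in_seqs: "pi_inv_seq n a \<in> seqs n"
  by (simp_all add: seqs_def pi_seq_def pi_inv_seq_def)

lemma stable_bad_span: "stable bad_span"
proof (rule stableI[OF n_pos])
  show "bad_span \<subseteq> Pn" unfolding bad_span_def by (rule vspan_subset_Pn)
  show "0 \<in> bad_span" unfolding bad_span_def by (rule vspan_0)
  show "f + g \<in> bad_span" if "f \<in> bad_span" "g \<in> bad_span" for f g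
    using that unfolding bad_span_def by (rule vspan_add)
  show "scl z * f \<in> bad_span" if "f \<in> bad_span" for z f
    using that unfolding bad_span_def by (rule vspan_scl)
  let ?B = "{a \<in> seqs n. \<not> good a}"
  show "pact (swp i (i + 1)) f \<in> bad_span" if i: "i \<in> {1..<n}" and f: "f \<in> bad_span" for i f
    using f unfolding bad_span_def
  proof (rule vspan_clinear[OF clinear_pact, rotated])
    fix a assume a: "a \<in> ?B"
    then have sa: "swap_seq i a \<in> seqs n" using i swap_seq_in_seqs by blast
    have Va: "V a \<in> vspan ?B" using a by (rule vspan_V)
    consider "a i > a (i + 1)" | "a i = a (i + 1)" | "a i < a (i + 1)" by linarith
    then show "pact (swp i (i + 1)) (V a) \<in> vspan ?B"
    proof cases
      case 1
      then have "swap_seq i a \<in> ?B" using not_good_swap_seq_gt[OF i 1] a sa by blast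
      then show ?thesis unfolding swap_V_gt[of i a, OF i 1] by (intro vspan_add vspan_scl Va vspan_V)
    next
      case 2
      then show ?thesis using swap_V_eq[of i a, OF i] Va by simp
    next
      case 3
      show ?thesis
      proof (cases "good (swap_seq i a)")
        case True
        then have "wt n c a (i + 1) - wt n c a i = c" using swap_coefficient_zero[of i a, OF i 3] a by blast
        then show ?thesis unfolding swap_V_lt[of i a, OF i 3] by (simp add: vspan_scl Va)
      next
        case False
        then have "swap_seq i a \<in> ?B" using sa by blast
        then show ?thesis unfolding swap_V_lt[of i a, OF i 3] by (intro vspan_add vspan_scl Va vspan_V)
      qed
    qed
  qed
  show "tau f \<in> bad_span" if f: "f \<in> bad_span" for f
    using f unfolding bad_span_def
    by (rule vspan_clinear[OF clinear_tau, rotated]) (auto simp: tau_V good_pi_seq pi_seq_in_seqs intro!: vspan_V)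
  show "lam f \<in> bad_span" if f: "f \<in> bad_span" for f
    using f unfolding bad_span_def
  proof (rule vspan_clinear[OF clinear_lam, rotated])
    fix a assume a: "a \<in> ?B"
    show "lam (V a) \<in> vspan ?B"
    proof (cases "a 1 > 0")
      case True
      then have "pi_inv_seq n a \<in> ?B" using a good_pi_inv_seq[of a] pi_inv_seq_in_seqs by blast
      then show ?thesis unfolding lam_V[of a, OF True] by (intro vspan_scl vspan_V)
    qed (use lam_V_zero[of a] vspan_0 in auto)
  qed
qed

text \<open>Follows the reductions of \<open>seq_induct\<close>: \<open>\<lambda>\<close> undoes
  \<open>\<pi>\<close> with the factor \<open>w_1\<close>, nonzero for \<open>a_1 > 0\<close>, and
  \<open>s_i\<close> minus its diagonal part undoes an ascent with a factor that is nonzero on good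
  sequences. Both moves preserve goodness.\<close>

lemma stable_good_imp_one:
  assumes N: "stable N"
  shows "good a \<Longrightarrow> V a \<in> N \<Longrightarrow> 1 \<in> N"
  using n_pos
proof (induction a rule: seq_induct)
  case (zero a)
  then show ?case using V_zero[of a] by simp
next
  case (pi a)
  have "scl (wt n c a 1) * V (pi_inv_seq n a) \<in> N"
    using stable_lam[OF N n_pos pi.prems(2)] lam_V[of a, OF pi.hyps] by simp
  then have "scl (1 / wt n c a 1) * (scl (wt n c a 1) * V (pi_inv_seq n a)) \<in> N" by (rule stableD(4)[OF N])
  then have "V (pi_inv_seq n a) \<in> N" using wt_1_nonzero[of a, OF pi.hyps] scl_inverse_cancel by metis
  then show ?case using pi good_pi_inv_seq[of a] by blast
next
  case (swap a i)
  let ?k = "(wt n c a (i + 1) - wt n c a i - c) * (wt n c a (i + 1) - wt n c a i + c) / (wt n c a i - wt n c a (i + 1))\<^sup>2"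
  have i': "i \<in> {1..n}" "i + 1 \<in> {1..n}" using swap by auto
  have "wt n c a i \<noteq> wt n c a (i + 1)" using wt_neq[OF i', of a] swap by simp
  then have k: "?k \<noteq> 0" using good_swap_seq_lt(2)[of i a] swap by simp
  have "pact (swp i (i + 1)) (V a) - scl (c / (wt n c a i - wt n c a (i + 1))) * V a \<in> N"
    by (intro stable_diff[OF N] stableD(4,5)[OF N] affected_swap_subset i' swap)
  then have "scl ?k * V (swap_seq i a) \<in> N"
    unfolding swap_V_lt[of i a, OF swap(1,2)] by simp
  then have "scl (1 / ?k) * (scl ?k * V (swap_seq i a)) \<in> N" by (rule stableD(4)[OF N])
  then have "V (swap_seq i a) \<in> N" using k scl_inverse_cancel by metis
  then show ?case using swap good_swap_seq_lt(1) by blast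
qed

lemma Pn_decompose:
  assumes "f \<in> Pn"
  obtains F k where "finite F" "F \<subseteq> {a \<in> seqs n. good a}"
    "f - (\<Sum>a\<in>F. scl (k a) * V a) \<in> bad_span"
proof -
  obtain F k where F: "finite F" "F \<subseteq> seqs n" "f = (\<Sum>a\<in>F. scl (k a) * V a)"
    using assms unfolding Pn_eq_vspan by (auto simp: vspan_def)
  let ?G = "{a \<in> F. good a}" and ?B = "{a \<in> F. \<not> good a}"
  have "f = (\<Sum>a\<in>?G. scl (k a) * V a) + (\<Sum>a\<in>?B. scl (k a) * V a)"
    unfolding F(3) by (subst sum.union_disjoint[symmetric]) (use F in \<open>auto intro!: sum.cong\<close>)
  moreover have "(\<Sum>a\<in>?B. scl (k a) * V a) \<in> bad_span"
    unfolding bad_span_def by (rule vspan_sum) (use F in auto)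
  ultimately show ?thesis by (intro that[of ?G k]) (use F in auto)
qed

lemma stable_not_subset_bad_span:
  assumes N: "stable N" and f: "f \<in> N" "f \<notin> bad_span"
  shows "N = Pn"
proof -
  obtain F k where F: "finite F" "F \<subseteq> seqs n" "f = (\<Sum>a\<in>F. scl (k a) * V a)"
    using stableD(1)[OF N f(1)] unfolding Pn_eq_vspan by (auto simp: vspan_def)
  have "\<exists>a\<in>F. good a \<and> k a \<noteq> 0"
  proof (rule ccontr)
    assume *: "\<not> ?thesis"
    have "f = (\<Sum>a\<in>{a \<in> F. \<not> good a}. scl (k a) * V a)"
      unfolding F(3) by (rule sum.mono_neutral_right) (use F * in auto)
    also have "\<dots> \<in> bad_span" unfolding bad_span_def by (rule vspan_sum) (use F in auto)
    finally show False using f by simp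
  qed
  then obtain a where a: "a \<in> F" "good a" "k a \<noteq> 0" by blast
  then have "V a \<in> N" using stable_component[OF N F(1,2), of k a] F(3) f by blast
  then show ?thesis using stable_one_imp_all[OF N] stable_good_imp_one[OF N a(2)] by blast
qed

lemma good_independent_mod_bad_span:
  assumes "finite F" "F \<subseteq> {a \<in> seqs n. good a}" "(\<Sum>a\<in>F. scl (k a) * V a) \<in> bad_span" "a \<in> F"
  shows "k a = 0"
proof (rule ccontr)
  assume "k a \<noteq> 0"
  then have "V a \<in> bad_span"
    using stable_component[OF stable_bad_span assms(1) _ assms(3,4)] assms(2) by blast
  then have "a \<in> {a \<in> seqs n. \<not> good a}"
    unfolding bad_span_def by (rule V_in_vspanD[rotated 2]) (use assms(2,4) in auto)
  then show False using assms(2,4) by blast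
qed

lemma one_notin_bad_span: "1 \<notin> bad_span"
proof
  assume 1: "1 \<in> bad_span"
  let ?a = "restrict (\<lambda>_. 0) {1..n}"
  have "V ?a \<in> bad_span" using V_zero[of ?a] 1 by simp
  then have "?a \<in> {a \<in> seqs n. \<not> good a}"
    unfolding bad_span_def by (rule V_in_vspanD[OF restrict_in_seqs, rotated]) auto
  then show False using good_zero[of ?a] by simp
qed

end

section \<open>The polynomial representation of the Cherednik algebra\<close>

definition smash_keys :: "letter set \<Rightarrow> nat \<Rightarrow> smash_word set" where
  "smash_keys X n = {k. set (word k) \<subseteq> X \<and> affected (perm k) \<subseteq> {1..n}}"

lemma smash_algebra_simps:
  "carrier (smash_algebra X n) = {f. keys f \<subseteq> smash_keys X n}"
  "x \<otimes>\<^bsub>smash_algebra X n\<^esub> y = x * y" "\<one>\<^bsub>smash_algebra X n\<^esub> = 1"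
  "x \<oplus>\<^bsub>smash_algebra X n\<^esub> y = x + y" "\<zero>\<^bsub>smash_algebra X n\<^esub> = 0"
  by (auto simp: smash_algebra_def smash_keys_def)

lemma smash_keys_add:
  assumes "\<And>p x. affected p \<subseteq> {1..n} \<Longrightarrow> x \<in> X \<Longrightarrow> perm_letter p x \<in> X"
    and "k \<in> smash_keys X n" "l \<in> smash_keys X n"
  shows "k + l \<in> smash_keys X n"
proof -
  have "affected (perm k * perm l) \<subseteq> {1..n}"
    using affected_times[of "perm k" "perm l"] assms(2,3) unfolding smash_keys_def by blast
  then show ?thesis
    using assms unfolding smash_keys_def plus_smash_word_def by auto
qed

lemma ring_smash_algebra:
  assumes "\<And>p x. affected p \<subseteq> {1..n} \<Longrightarrow> x \<in> X \<Longrightarrow> perm_letter p x \<in> X"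
  shows "ring (smash_algebra X n)"
proof -
  let ?R = "smash_algebra X n"
  have add: "x + y \<in> carrier ?R" if "x \<in> carrier ?R" "y \<in> carrier ?R" for x y
    using that keys_add[of x y] by (auto simp: smash_algebra_simps)
  have mult: "x * y \<in> carrier ?R" if "x \<in> carrier ?R" "y \<in> carrier ?R" for x y
    using that keys_mult[of x y] smash_keys_add[OF assms] by (auto simp: smash_algebra_simps) blast
  have one: "1 \<in> carrier ?R" and zero: "0 \<in> carrier ?R"
    by (auto simp: smash_algebra_simps smash_keys_def zero_smash_word_def)
  have neg: "- x \<in> carrier ?R" if "x \<in> carrier ?R" for x
    using that by (simp add: smash_algebra_simps)
  show ?thesis
  proof (rule ringI)
    show "abelian_group ?R"
    proof (rule abelian_groupI)
      show "\<exists>y\<in>carrier ?R. y \<oplus>\<^bsub>?R\<^esub> x = \<zero>\<^bsub>?R\<^esub>" if "x \<in> carrier ?R" for x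
        using neg[OF that] by (intro bexI[of _ "- x"]) (auto simp: smash_algebra_simps)
    qed (use add zero in \<open>auto simp: smash_algebra_simps(2-) algebra_simps\<close>)
    show "monoid ?R"
      by (rule monoidI) (use mult one in \<open>auto simp: smash_algebra_simps(2-) mult.assoc\<close>)
  qed (auto simp: smash_algebra_simps(2-) algebra_simps)
qed

lemma smash_algebra_uminus:
  assumes "ring (smash_algebra X n)" "x \<in> carrier (smash_algebra X n)"
  shows "\<ominus>\<^bsub>smash_algebra X n\<^esub> x = - x"
proof -
  interpret ring "smash_algebra X n" by fact
  have "- x \<in> carrier (smash_algebra X n)" using assms(2) by (simp add: smash_algebra_simps)
  moreover have "- x \<oplus>\<^bsub>smash_algebra X n\<^esub> x = \<zero>\<^bsub>smash_algebra X n\<^esub>" by (simp add: smash_algebra_simps)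
  ultimately show ?thesis using minus_equality assms(2) by blast
qed

lemma subgroup_smash_algebraI:
  assumes R: "ring (smash_algebra X n)" and "I \<subseteq> carrier (smash_algebra X n)" "0 \<in> I"
    and "\<And>a b. a \<in> I \<Longrightarrow> b \<in> I \<Longrightarrow> a + b \<in> I" "\<And>a. a \<in> I \<Longrightarrow> - a \<in> I"
  shows "subgroup I (add_monoid (smash_algebra X n))"
proof -
  interpret ring "smash_algebra X n" by fact
  show ?thesis
    by (rule add.subgroupI)
       (use assms smash_algebra_uminus[OF R] in \<open>auto simp: smash_algebra_simps(2-) a_inv_def[symmetric]\<close>)
qed

lemma smash_ideal_closed:
  assumes "ring (smash_algebra X n)" "ideal I (smash_algebra X n)"
  shows "a \<in> I \<Longrightarrow> a \<in> carrier (smash_algebra X n)" "0 \<in> I"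
    "a \<in> I \<Longrightarrow> b \<in> I \<Longrightarrow> a + b \<in> I" "a \<in> I \<Longrightarrow> - a \<in> I" "a \<in> I \<Longrightarrow> b \<in> I \<Longrightarrow> a - b \<in> I"
    "a \<in> I \<Longrightarrow> b \<in> carrier (smash_algebra X n) \<Longrightarrow> b * a \<in> I"
    "a \<in> I \<Longrightarrow> b \<in> carrier (smash_algebra X n) \<Longrightarrow> a * b \<in> I"
proof -
  interpret ideal I "smash_algebra X n" by fact
  show car: "a \<in> carrier (smash_algebra X n)" if "a \<in> I" for a using Icarr that .
  show "0 \<in> I" using additive_subgroup.zero_closed[OF is_additive_subgroup] by (simp only: smash_algebra_simps)
  show add: "a + b \<in> I" if "a \<in> I" "b \<in> I" for a b
    using additive_subgroup.a_closed[OF is_additive_subgroup that] by (simp only: smash_algebra_simps)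
  show neg: "- a \<in> I" if "a \<in> I" for a
    using additive_subgroup.a_inv_closed[OF is_additive_subgroup that] smash_algebra_uminus[OF assms(1) car[OF that]] by simp
  show "a - b \<in> I" if "a \<in> I" "b \<in> I" for a b
    using add[OF that(1) neg[OF that(2)]] by simp
  show "b * a \<in> I" if "a \<in> I" "b \<in> carrier (smash_algebra X n)" for a b
    using I_l_closed[OF that] by (simp only: smash_algebra_simps)
  show "a * b \<in> I" if "a \<in> I" "b \<in> carrier (smash_algebra X n)" for a b
    using I_r_closed[OF that] by (simp only: smash_algebra_simps)
qed

lemma smash_coset: "I +>\<^bsub>smash_algebra X n\<^esub> a = {i + a |i. i \<in> I}"
  by (auto simp: a_r_coset_def r_coset_def smash_algebra_def)

lemma smash_set_add: "A <+>\<^bsub>smash_algebra X n\<^esub> B = {a + b |a b. a \<in> A \<and> b \<in> B}"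
  by (auto simp: set_add_def set_mult_def smash_algebra_def)

context dunkl
begin

fun letter_act :: "letter \<Rightarrow> mpol \<Rightarrow> mpol" where
  "letter_act (Xl i) f = var i * f"
| "letter_act (Yl i) f = dk i f"

definition word_act :: "letter list \<Rightarrow> mpol \<Rightarrow> mpol" where
  "word_act w = foldr letter_act w"

lemma word_act_simps [simp]: "word_act [] f = f" "word_act (l # w) f = letter_act l (word_act w f)"
  and word_act_append: "word_act (u @ w) f = word_act u (word_act w f)"
  by (simp_all add: word_act_def)

lemma clinear_letter_act: "clinear (letter_act l)"
  by (cases l) (auto simp: clinear_def dk_linear distrib_left mult.left_commute)

lemma clinear_word_act: "clinear (word_act w)"
  by (induction w) (auto intro: clinear_id clinear_compose[OF clinear_letter_act] simp: word_act_def clinear_def clinear_add[OF clinear_letter_act] clinear_scl[OF clinear_letter_act])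

abbreviation xy_letters :: "letter set" where
  "xy_letters \<equiv> Xl ` {1..n} \<union> Yl ` {1..n}"

lemma xy_letters_perm: "affected p \<subseteq> {1..n} \<Longrightarrow> x \<in> xy_letters \<Longrightarrow> perm_letter p x \<in> xy_letters"
  using papply_in_iff[of p] by auto

lemma y_letters_perm: "affected p \<subseteq> {1..n} \<Longrightarrow> x \<in> Yl ` {1..n} \<Longrightarrow> perm_letter p x \<in> Yl ` {1..n}"
  using papply_in_iff[of p] by auto

lemma pact_letter_act:
  assumes "affected p \<subseteq> {1..n}" "l \<in> xy_letters"
  shows "pact p (letter_act l f) = letter_act (perm_letter p l) (pact p f)"
  using assms pact_dk[OF assms(1)] by (cases l) (auto simp: pact_mult pact_var)

lemma pact_word_act:
  assumes "affected p \<subseteq> {1..n}" "set w \<subseteq> xy_letters"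
  shows "pact p (word_act w f) = word_act (map (perm_letter p) w) (pact p f)"
  using assms(2) by (induction w) (auto simp: pact_letter_act[OF assms(1)])

definition smash_act :: "smash_word \<Rightarrow> mpol \<Rightarrow> mpol" where
  "smash_act k f = word_act (word k) (pact (perm k) f)"

text \<open>Equivariance of \<open>x_i\<close> and \<open>y_i\<close> under permutations is exactly
  what the semidirect product law asks for.\<close>

lemma smash_act_add:
  assumes "k \<in> smash_keys xy_letters n" "l \<in> smash_keys xy_letters n"
  shows "smash_act (k + l) f = smash_act k (smash_act l f)"
  using assms by (simp add: smash_act_def plus_smash_word_def smash_keys_def word_act_append pact_word_act pact_times)

lemma clinear_smash_act: "clinear (smash_act k)"
  unfolding smash_act_def by (rule clinear_compose[OF clinear_word_act clinear_pact])

definition rho :: "smash \<Rightarrow> mpol \<Rightarrow> mpol" where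
  "rho a f = lin_ext (\<lambda>k. smash_act k f) a"

lemma clinear_rho: "clinear (\<lambda>a. rho a f)"
  unfolding rho_def by (rule clinear_lin_ext)

lemmas rho_linear = clinear_add[OF clinear_rho] clinear_diff[OF clinear_rho]
  clinear_scl[OF clinear_rho] clinear_sum[OF clinear_rho] clinear_0[OF clinear_rho] clinear_uminus[OF clinear_rho]

lemma clinear_rho2: "clinear (rho a)"
  unfolding rho_def lin_ext_def by (intro clinear_intros clinear_smash_act)

lemma rho_single: "rho (single k v) f = scl v * smash_act k f"
  by (simp add: rho_def lin_ext_single)

abbreviation C :: "smash set" where
  "C \<equiv> carrier (xy_smash n)"

lemma C_eq: "C = {f. keys f \<subseteq> smash_keys xy_letters n}"
  by (simp only: xy_smash_def smash_algebra_simps)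

lemma rho_mult:
  assumes "a \<in> C" "b \<in> C"
  shows "rho (a * b) f = rho a (rho b f)"
proof -
  have ka: "keys a \<subseteq> smash_keys xy_letters n" and kb: "keys b \<subseteq> smash_keys xy_letters n"
    using assms by (auto simp: C_eq)
  have "rho (single k 1 * b) f = rho (single k 1) (rho b f)" if k: "k \<in> smash_keys xy_letters n" for k
  proof (rule clinear_eqI[OF _ _ kb])
    show "clinear (\<lambda>b. rho (single k 1 * b) f)"
      by (rule clinear_compose[OF clinear_rho clinear_mult_left[OF clinear_id]])
    show "clinear (\<lambda>b. rho (single k 1) (rho b f))"
      by (rule clinear_compose[OF clinear_rho2 clinear_rho])
  qed (simp add: mult_single rho_single smash_act_add[OF k])
  then show ?thesis
  proof (rule clinear_eqI[OF _ _ ka, rotated 2])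
    show "clinear (\<lambda>a. rho (a * b) f)"
      by (rule clinear_compose[OF clinear_rho clinear_mult_right[OF clinear_id]])
    show "clinear (\<lambda>a. rho a (rho b f))"
      by (rule clinear_rho)
  qed
qed

lemma ring_xy_smash: "ring (xy_smash n)"
  unfolding xy_smash_def by (rule ring_smash_algebra) (rule xy_letters_perm)

lemma ring_y_smash: "ring (y_smash n)"
  unfolding y_smash_def by (rule ring_smash_algebra) (rule y_letters_perm)

lemma const_eq_scl: "const z = scl z"
  by (simp add: const_def scl_def)

lemma C_closed:
  "0 \<in> C" "1 \<in> C" "a \<in> C \<Longrightarrow> b \<in> C \<Longrightarrow> a + b \<in> C" "a \<in> C \<Longrightarrow> b \<in> C \<Longrightarrow> a * b \<in> C"
  "a \<in> C \<Longrightarrow> - a \<in> C"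
  using ring.ring_simprules[OF ring_xy_smash] smash_algebra_uminus[OF ring_xy_smash[unfolded xy_smash_def]]
  by (simp_all only: xy_smash_def smash_algebra_simps(2-))

lemma C_diff: "a \<in> C \<Longrightarrow> b \<in> C \<Longrightarrow> a - b \<in> C"
  using C_closed(3)[of a "- b"] C_closed(5)[of b] by simp

lemma C_sum: "(\<And>x. x \<in> A \<Longrightarrow> f x \<in> C) \<Longrightarrow> (\<Sum>x\<in>A. f x) \<in> C"
  by (induction A rule: infinite_finite_induct) (auto intro: C_closed)

lemma C_gens:
  "i \<in> {1..n} \<Longrightarrow> xg i \<in> C" "i \<in> {1..n} \<Longrightarrow> yg i \<in> C" "affected p \<subseteq> {1..n} \<Longrightarrow> pg p \<in> C" "scl z \<in> C"
  by (auto simp: C_eq smash_keys_def xg_def yg_def pg_def scl_def zero_smash_word_def split: if_splits)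

lemma C_pg_swap: "i \<in> {1..n} \<Longrightarrow> j \<in> {1..n} \<Longrightarrow> pg (swp i j) \<in> C"
  by (intro C_gens affected_swap_subset)

lemma rho_gens [simp]:
  "rho (xg i) f = var i * f" "rho (yg i) f = dk i f" "rho (pg p) f = pact p f" "rho (scl z) f = scl z * f"
  "rho 1 f = f"
proof -
  show s: "rho (scl z) f = scl z * f" for z
    by (simp add: scl_def rho_single smash_act_def zero_smash_word_def)
  show "rho 1 f = f" using s[of 1] by simp
qed (simp_all add: xg_def yg_def pg_def rho_single smash_act_def)

lemma Pn_word_act: "set w \<subseteq> xy_letters \<Longrightarrow> f \<in> Pn \<Longrightarrow> word_act w f \<in> Pn"
  by (induction w) (auto intro!: Pn_var_mult Pn_dk)

lemma Pn_rho:
  assumes "a \<in> C" "f \<in> Pn"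
  shows "rho a f \<in> Pn"
  unfolding rho_def lin_ext_def smash_act_def
  by (intro Pn_sum Pn_scl_mult Pn_word_act Pn_pact assms) (use assms in \<open>auto simp: C_eq smash_keys_def\<close>)

lemma stable_rho:
  assumes N: "stable N" and "a \<in> C" "f \<in> N"
  shows "rho a f \<in> N"
proof -
  have w: "word_act w g \<in> N" if "set w \<subseteq> xy_letters" "g \<in> N" for w g
    using that by (induction w) (auto intro!: stableD[OF N])
  show ?thesis
    unfolding rho_def lin_ext_def smash_act_def
    by (intro stable_sum[OF N] stableD(4,5)[OF N] w assms(3)) (use assms(2) in \<open>auto simp: C_eq smash_keys_def\<close>)
qed

abbreviation "I \<equiv> cherednik_ideal n c"

lemma relators_subset: "cherednik_relators n c \<subseteq> C"
  unfolding cherednik_relators_def const_eq_scl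
  by (auto intro!: C_diff C_closed(2-4) C_gens(1,2,4) C_sum C_pg_swap)

lemma ideal_I: "ideal I (xy_smash n)"
  unfolding cherednik_ideal_def using ring.genideal_ideal[OF ring_xy_smash relators_subset] .

lemma relators_in_I: "r \<in> cherednik_relators n c \<Longrightarrow> r \<in> I"
  unfolding cherednik_ideal_def using ring.genideal_self[OF ring_xy_smash relators_subset] by blast

lemmas I_closed = smash_ideal_closed[OF ring_xy_smash[unfolded xy_smash_def] ideal_I[unfolded xy_smash_def],
    folded xy_smash_def]

lemma kernel_ideal:
  assumes R: "ring (smash_algebra X n)" and X: "X \<subseteq> xy_letters"
  shows "ideal {a \<in> carrier (smash_algebra X n). \<forall>f. rho a f = 0} (smash_algebra X n)"
    (is "ideal ?K ?R")
proof (rule idealI[OF R])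
  have sub: "x \<in> C" if "x \<in> carrier ?R" for x
    using that X unfolding C_eq smash_algebra_simps smash_keys_def by blast
  note rs = ring.ring_simprules[OF R, unfolded smash_algebra_simps(2-)]
  show "subgroup ?K (add_monoid ?R)"
    by (rule subgroup_smash_algebraI[OF R])
       (use rs(1,2,3) smash_algebra_uminus[OF R] in \<open>auto simp: rho_linear\<close>)
  show "x \<otimes>\<^bsub>?R\<^esub> a \<in> ?K" if "a \<in> ?K" "x \<in> carrier ?R" for a x
    using that rs(5)[of x a] sub by (simp add: smash_algebra_simps(2) rho_mult clinear_0[OF clinear_rho2])
  show "a \<otimes>\<^bsub>?R\<^esub> x \<in> ?K" if "a \<in> ?K" "x \<in> carrier ?R" for a x
    using that rs(5)[of a x] sub by (simp add: smash_algebra_simps(2) rho_mult)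
qed

text \<open>The elements acting by zero form a two-sided ideal, and it contains the relators because
  multiplication and Dunkl operators satisfy the defining relations.\<close>

lemma rho_I:
  assumes "a \<in> I"
  shows "rho a f = 0"
proof -
  let ?K = "{a \<in> C. \<forall>f. rho a f = 0}"
  have "cherednik_relators n c \<subseteq> ?K"
  proof
    fix r assume r: "r \<in> cherednik_relators n c"
    have "rho r f = 0" for f
      using r unfolding cherednik_relators_def const_eq_scl
      by (elim UnE) (auto simp: rho_linear rho_mult C_gens C_closed C_diff C_sum C_pg_swap
          dk_commute dk_var_mult dk_var_mult_same)
    then show "r \<in> ?K" using r relators_subset by blast
  qed
  then have "I \<subseteq> ?K"
    unfolding cherednik_ideal_def
    using ring.genideal_minimal[OF ring_xy_smash] kernel_ideal[OF ring_xy_smash[unfolded xy_smash_def]]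
    unfolding xy_smash_def by blast
  then show ?thesis using assms by blast
qed

abbreviation "cl \<equiv> H_class n c"

lemma H_class_eq: "cl a = {i + a |i. i \<in> I}"
  by (simp add: H_class_def xy_smash_def smash_coset)

lemma H_class_self: "a \<in> cl a"
  unfolding H_class_eq using I_closed(2) by force

lemma H_class_eqI: "a - b \<in> I \<Longrightarrow> cl a = cl b"
proof -
  have *: "cl a \<subseteq> cl b" if "a - b \<in> I" for a b
  proof
    fix x assume "x \<in> cl a"
    then obtain i where i: "i \<in> I" "x = i + a" by (auto simp: H_class_eq)
    then have "x = (i + (a - b)) + b" by simp
    then show "x \<in> cl b" unfolding H_class_eq using I_closed(3)[OF i(1) that] by blast
  qed
  assume ab: "a - b \<in> I"
  then have "b - a \<in> I" using I_closed(4)[OF ab] by simp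
  then show ?thesis using * ab by blast
qed

abbreviation "H \<equiv> cherednik n c"

lemma ring_H: "ring H"
  unfolding cherednik_def by (rule ideal.quotient_is_ring[OF ideal_I])

lemma carrier_H: "carrier H = cl ` C"
  by (auto simp: cherednik_def FactRing_def A_RCOSETS_def' H_class_def)

lemma H_class_in: "a \<in> C \<Longrightarrow> cl a \<in> carrier H"
  by (simp add: carrier_H)

lemma H_class_mult: "a \<in> C \<Longrightarrow> b \<in> C \<Longrightarrow> cl a \<otimes>\<^bsub>H\<^esub> cl b = cl (a * b)"
  and H_class_add: "a \<in> C \<Longrightarrow> b \<in> C \<Longrightarrow> cl a \<oplus>\<^bsub>H\<^esub> cl b = cl (a + b)"
  using ring_hom_mult[OF ideal.rcos_ring_hom[OF ideal_I]] ring_hom_add[OF ideal.rcos_ring_hom[OF ideal_I]]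
  by (simp_all add: cherednik_def H_class_def) (simp_all add: xy_smash_def smash_algebra_simps(2-))

text \<open>The choice of a representative is immaterial, since the ideal acts by zero.\<close>

definition hact :: "smash set \<Rightarrow> mpol \<Rightarrow> mpol" where
  "hact h f = rho (SOME a. a \<in> h) f"

lemma hact_class: "hact (cl a) f = rho a f"
proof -
  have "(SOME b. b \<in> cl a) \<in> cl a" using H_class_self by (rule someI)
  then obtain i where "i \<in> I" "(SOME b. b \<in> cl a) = i + a" by (auto simp: H_class_eq)
  then show ?thesis by (simp add: hact_def rho_linear rho_I)
qed

definition Iy :: "smash set" where
  "Iy = genideal (y_smash n) {yg i * yg j - yg j * yg i | i j. i \<in> {1..n} \<and> j \<in> {1..n}}"

lemma Cy_subset: "carrier (y_smash n) \<subseteq> C"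
  by (auto simp: C_eq y_smash_def smash_algebra_simps smash_keys_def)

lemma Cy_gens:
  "i \<in> {1..n} \<Longrightarrow> yg i \<in> carrier (y_smash n)" "affected p \<subseteq> {1..n} \<Longrightarrow> pg p \<in> carrier (y_smash n)"
  "scl z \<in> carrier (y_smash n)"
  by (auto simp: y_smash_def smash_algebra_simps smash_keys_def yg_def pg_def scl_def zero_smash_word_def split: if_splits)

lemma y_relators_subset: "{yg i * yg j - yg j * yg i | i j. i \<in> {1..n} \<and> j \<in> {1..n}} \<subseteq> carrier (y_smash n)"
proof -
  note R = ring.ring_simprules[OF ring_y_smash]
  have "yg i * yg j - yg j * yg i \<in> carrier (y_smash n)" if "i \<in> {1..n}" "j \<in> {1..n}" for i j
  proof -
    have "yg i * yg j \<in> carrier (y_smash n)" "yg j * yg i \<in> carrier (y_smash n)"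
      using R(5)[OF Cy_gens(1)[OF that(1)] Cy_gens(1)[OF that(2)]] R(5)[OF Cy_gens(1)[OF that(2)] Cy_gens(1)[OF that(1)]]
      by (simp_all only: y_smash_def smash_algebra_simps(2))
    then show ?thesis
      using R(4) smash_algebra_uminus[OF ring_y_smash[unfolded y_smash_def]] R(1)
      unfolding y_smash_def smash_algebra_simps(2-)
      by (metis R(3) diff_conv_add_uminus y_smash_def smash_algebra_simps(4))
  qed
  then show ?thesis by blast
qed

lemma ideal_Iy: "ideal Iy (y_smash n)"
  unfolding Iy_def using ring.genideal_ideal[OF ring_y_smash y_relators_subset] .

text \<open>The Cherednik ideal cuts out an ideal of the smaller algebra that contains its relators.
  This makes the canonical map from the \<open>y\<close>-part to the Cherednik algebra well defined
  on cosets.\<close>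

lemma Iy_subset_I: "Iy \<subseteq> I"
proof -
  have sub: "x \<in> C" if "x \<in> carrier (y_smash n)" for x using Cy_subset that by blast
  have "ideal (I \<inter> carrier (y_smash n)) (y_smash n)"
  proof (rule idealI[OF ring_y_smash])
    note rs = ring.ring_simprules[OF ring_y_smash[unfolded y_smash_def], unfolded smash_algebra_simps(2-), folded y_smash_def]
    show "subgroup (I \<inter> carrier (y_smash n)) (add_monoid (y_smash n))"
      unfolding y_smash_def
      by (rule subgroup_smash_algebraI[OF ring_y_smash[unfolded y_smash_def]])
         (use rs(1,2,3) I_closed smash_algebra_uminus[OF ring_y_smash[unfolded y_smash_def]] in \<open>auto simp: y_smash_def\<close>)
    show "x \<otimes>\<^bsub>y_smash n\<^esub> a \<in> I \<inter> carrier (y_smash n)"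
      "a \<otimes>\<^bsub>y_smash n\<^esub> x \<in> I \<inter> carrier (y_smash n)"
      if "a \<in> I \<inter> carrier (y_smash n)" "x \<in> carrier (y_smash n)" for a x
      using that rs(5) I_closed(6,7) sub by (simp_all add: y_smash_def smash_algebra_simps(2))
  qed
  moreover have "{yg i * yg j - yg j * yg i | i j. i \<in> {1..n} \<and> j \<in> {1..n}} \<subseteq> I \<inter> carrier (y_smash n)"
  proof -
    have "{yg i * yg j - yg j * yg i | i j. i \<in> {1..n} \<and> j \<in> {1..n}} \<subseteq> cherednik_relators n c"
      unfolding cherednik_relators_def by blast
    then show ?thesis using y_relators_subset relators_in_I by blast
  qed
  ultimately show ?thesis unfolding Iy_def using ring.genideal_minimal[OF ring_y_smash] by blast
qed

lemma word_act_y_one: "set w \<subseteq> Yl ` {1..n} \<Longrightarrow> word_act w 1 = (if w = [] then 1 else 0)"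
  by (induction w) (auto simp: dk_linear)

text \<open>The \<open>y_i\<close> kill the constant \<open>1\<close> and permutations fix it, so
  \<open>1\<close> spans a copy of the trivial representation of the \<open>y\<close>-part.\<close>

lemma rho_one_y:
  assumes "a \<in> carrier (y_smash n)"
  shows "rho a 1 = scl (triv_char a)"
proof -
  have "rho a 1 = (\<Sum>k\<in>keys a. if word k = [] then scl (lookup a k) else 0)"
    unfolding rho_def lin_ext_def
  proof (rule sum.cong)
    fix k assume "k \<in> keys a"
    then have "set (word k) \<subseteq> Yl ` {1..n}" using assms by (auto simp: y_smash_def smash_algebra_simps smash_keys_def)
    then show "scl (lookup a k) * smash_act k 1 = (if word k = [] then scl (lookup a k) else 0)"
      by (simp add: smash_act_def word_act_y_one)
  qed simp
  also have "\<dots> = scl (triv_char a)"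
    unfolding triv_char_def scl_sum by (rule sum.mono_neutral_cong_right) auto
  finally show ?thesis .
qed

lemma carrier_y_poly_smash: "carrier (y_poly_smash n) = (\<lambda>a. Iy +>\<^bsub>y_smash n\<^esub> a) ` carrier (y_smash n)"
  unfolding y_poly_smash_def Iy_def[symmetric] by (auto simp: FactRing_def A_RCOSETS_def')

text \<open>The character is constant on a coset because it can be read off from the action on
  \<open>1\<close>, where the ideal acts by zero; hence \<open>the_elem\<close> meets a
  singleton.\<close>

lemma triv_module_smult:
  assumes "a \<in> carrier (y_smash n)"
  shows "(Iy +>\<^bsub>y_smash n\<^esub> a) \<odot>\<^bsub>triv_module\<^esub> z = triv_char a * z"
proof -
  note cl = smash_ideal_closed[OF ring_y_smash[unfolded y_smash_def] ideal_Iy[unfolded y_smash_def], folded y_smash_def]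
  have eq: "Iy +>\<^bsub>y_smash n\<^esub> a = {i + a |i. i \<in> Iy}" by (simp add: y_smash_def smash_coset)
  have "triv_char (i + a) = triv_char a" if i: "i \<in> Iy" for i
  proof -
    have "i + a \<in> carrier (y_smash n)"
      using ring.ring_simprules(1)[OF ring_y_smash cl(1)[OF i] assms]
      by (simp add: y_smash_def smash_algebra_simps(4))
    then have "scl (triv_char (i + a)) = (scl (triv_char a) :: mpol)"
      using rho_I[of i 1] Iy_subset_I i by (simp add: rho_linear rho_one_y[OF assms] flip: rho_one_y) (auto simp: rho_linear rho_one_y assms)
    then have "scl (triv_char (i + a) - triv_char a) = (0 :: mpol)" by (simp add: scl_diff)
    then show ?thesis by simp
  qed
  then have "triv_char ` (Iy +>\<^bsub>y_smash n\<^esub> a) = {triv_char a}"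
    unfolding eq using cl(2) by auto
  then show ?thesis by (simp add: triv_module_def)
qed

lemma y_poly_smash_to_H_coset:
  assumes "a \<in> carrier (y_smash n)"
  shows "y_poly_smash_to_H n c (Iy +>\<^bsub>y_smash n\<^esub> a) = cl a"
proof -
  note cly = smash_ideal_closed[OF ring_y_smash[unfolded y_smash_def] ideal_Iy[unfolded y_smash_def], folded y_smash_def]
  have "y_poly_smash_to_H n c (Iy +>\<^bsub>y_smash n\<^esub> a) = {i + (j + a) |i j. i \<in> I \<and> j \<in> Iy}"
  proof -
    have "Iy +>\<^bsub>y_smash n\<^esub> a = {j + a |j. j \<in> Iy}" by (simp add: y_smash_def smash_coset)
    then show ?thesis
      unfolding y_poly_smash_to_H_def xy_smash_def smash_set_add by auto
  qed
  also have "\<dots> = cl a"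
  proof (intro equalityI subsetI)
    fix x assume "x \<in> {i + (j + a) |i j. i \<in> I \<and> j \<in> Iy}"
    then obtain i j where ij: "i \<in> I" "j \<in> Iy" "x = (i + j) + a" by (auto simp: add.assoc)
    then show "x \<in> cl a" unfolding H_class_eq using I_closed(3) Iy_subset_I by blast
  next
    fix x assume "x \<in> cl a"
    then obtain i where "i \<in> I" "x = i + (0 + a)" by (auto simp: H_class_eq)
    then show "x \<in> {i + (j + a) |i j. i \<in> I \<and> j \<in> Iy}" using cly(2) by blast
  qed
  finally show ?thesis .
qed

end

section \<open>Quotient modules\<close>

locale module_quotient =
  fixes R :: "'r ring" and M :: "('r, 'v) module" (structure) and N :: "'v set"
  assumes ab: "abelian_group M" and sub: "submodule N R M"
    and smult_add: "\<And>r x y. r \<in> carrier R \<Longrightarrow> x \<in> carrier M \<Longrightarrow> y \<in> carrier M \<Longrightarrow>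
      r \<odot> (x \<oplus> y) = r \<odot> x \<oplus> r \<odot> y"
    and smult_carrier: "\<And>r x. r \<in> carrier R \<Longrightarrow> x \<in> carrier M \<Longrightarrow> r \<odot> x \<in> carrier M"
begin

abbreviation "Q \<equiv> quotient_module M N"

sublocale abelian_group M by (rule ab)

sublocale abelian_subgroup N M
proof (rule abelian_subgroupI3)
  show "additive_subgroup N M"
    using sub by (simp add: additive_subgroup_def submodule_def)
qed (rule ab)

lemma N_smult: "r \<in> carrier R \<Longrightarrow> x \<in> N \<Longrightarrow> r \<odot> x \<in> N"
  using sub by (rule submodule.smult_closed)

lemma carrier_Q: "carrier Q = (\<lambda>x. N +> x) ` carrier M"
  by (auto simp: quotient_module_def A_RCOSETS_def')

lemma zero_Q: "\<zero>\<^bsub>Q\<^esub> = N"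
  by (simp add: quotient_module_def)

lemma coset_eq_iff:
  assumes "x \<in> carrier M" "y \<in> carrier M"
  shows "N +> x = N +> y \<longleftrightarrow> x \<ominus> y \<in> N"
  using assms a_rcos_module[of y x] unfolding a_minus_def
  by (metis a_repr_independence' a_rcos_self)

lemma coset_eq_N_iff: "x \<in> carrier M \<Longrightarrow> N +> x = N \<longleftrightarrow> x \<in> N"
  by (metis a_coset_join1 a_coset_join2 a_subgroup)

lemma add_Q: "x \<in> carrier M \<Longrightarrow> y \<in> carrier M \<Longrightarrow> (N +> x) \<oplus>\<^bsub>Q\<^esub> (N +> y) = N +> (x \<oplus> y)"
  by (simp add: quotient_module_def a_rcos_sum)

text \<open>Changing the representative by an element of \<open>N\<close> changes the product by an
  element of \<open>N\<close>, so the union in the definition runs over a single coset.\<close>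

lemma smult_Q:
  assumes r: "r \<in> carrier R" and x: "x \<in> carrier M"
  shows "r \<odot>\<^bsub>Q\<^esub> (N +> x) = N +> (r \<odot> x)"
proof -
  have "N +> (r \<odot> y) = N +> (r \<odot> x)" if y: "y \<in> N +> x" for y
  proof -
    obtain z where z: "z \<in> N" "y = z \<oplus> x" using y by (auto simp: a_r_coset_def r_coset_def)
    have zc: "z \<in> carrier M" using z a_Hcarr by blast
    have "r \<odot> y = r \<odot> z \<oplus> r \<odot> x" using z smult_add[OF r zc x] by simp
    moreover have "r \<odot> z \<in> N" using N_smult r z by blast
    ultimately have "r \<odot> y \<in> N +> (r \<odot> x)" by (auto simp: a_r_coset_def r_coset_def)
    then show ?thesis using a_repr_independence'[of "r \<odot> y" "r \<odot> x"] smult_carrier[OF r x] by simp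
  qed
  then have "(\<Union>y\<in>N +> x. N +> (r \<odot> y)) = (\<Union>y\<in>N +> x. N +> (r \<odot> x))"
    by (rule SUP_cong[OF refl])
  also have "\<dots> = N +> (r \<odot> x)" using a_rcos_self[OF x] by blast
  finally show ?thesis by (simp add: quotient_module_def)
qed

lemma Q_closed: "x \<in> carrier M \<Longrightarrow> N +> x \<in> carrier Q"
  by (auto simp: carrier_Q)

lemma zero_Q_coset: "\<zero>\<^bsub>Q\<^esub> = N +> \<zero>"
  using coset_eq_N_iff[of \<zero>] by (simp add: zero_Q)

lemma abelian_group_Q: "abelian_group Q"
proof (rule abelian_groupI)
  fix x y z assume "x \<in> carrier Q" "y \<in> carrier Q" "z \<in> carrier Q"
  then obtain x' y' z' where *: "x' \<in> carrier M" "x = N +> x'" "y' \<in> carrier M" "y = N +> y'" "z' \<in> carrier M" "z = N +> z'"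
    by (auto simp: carrier_Q)
  then show "x \<oplus>\<^bsub>Q\<^esub> y \<in> carrier Q" by (simp add: add_Q Q_closed)
  show "x \<oplus>\<^bsub>Q\<^esub> y \<oplus>\<^bsub>Q\<^esub> z = x \<oplus>\<^bsub>Q\<^esub> (y \<oplus>\<^bsub>Q\<^esub> z)" using * by (simp add: add_Q a_assoc)
  show "x \<oplus>\<^bsub>Q\<^esub> y = y \<oplus>\<^bsub>Q\<^esub> x" using * by (simp add: add_Q a_comm)
next
  show "\<zero>\<^bsub>Q\<^esub> \<in> carrier Q" by (simp add: zero_Q_coset Q_closed)
  fix x assume "x \<in> carrier Q"
  then obtain x' where *: "x' \<in> carrier M" "x = N +> x'" by (auto simp: carrier_Q)
  then show "\<zero>\<^bsub>Q\<^esub> \<oplus>\<^bsub>Q\<^esub> x = x" unfolding zero_Q_coset by (simp add: add_Q)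
  have "(N +> (\<ominus> x')) \<oplus>\<^bsub>Q\<^esub> x = \<zero>\<^bsub>Q\<^esub>" using * unfolding zero_Q_coset by (simp add: add_Q l_neg)
  then show "\<exists>y\<in>carrier Q. y \<oplus>\<^bsub>Q\<^esub> x = \<zero>\<^bsub>Q\<^esub>" using * Q_closed abelian_group.a_inv_closed[OF ab] by metis
qed

end

section \<open>The standard module is the polynomial representation\<close>

context dunkl
begin

abbreviation "FP \<equiv> free_pairs_module H triv_module"

abbreviation "pairs \<equiv> carrier H \<times> (UNIV :: complex set)"

abbreviation "R0 \<equiv> generate (free_Abelian_group pairs)
  (tensor_relators (y_poly_smash n) H (y_poly_smash_to_H n c) triv_module)"

abbreviation "relators \<equiv> tensor_relators (y_poly_smash n) H (y_poly_smash_to_H n c) triv_module"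

lemma triv_module_simps: "carrier triv_module = UNIV" "x \<oplus>\<^bsub>triv_module\<^esub> y = x + y"
  by (simp_all add: triv_module_def)

lemma relator_cases [consumes 1, case_names left right balance]:
  assumes "x \<in> relators"
  obtains a b v where "a \<in> C" "b \<in> C" "x = frag_of (cl (a + b), v) - (frag_of (cl a, v) + frag_of (cl b, v))"
  | a v w where "a \<in> C" "x = frag_of (cl a, v + w) - (frag_of (cl a, v) + frag_of (cl a, w))"
  | a b v where "a \<in> C" "b \<in> carrier (y_smash n)" "x = frag_of (cl (a * b), v) - frag_of (cl a, triv_char b * v)"
proof -
  from assms consider
    h h' v where "h \<in> carrier H" "h' \<in> carrier H" "x = frag_of (h \<oplus>\<^bsub>H\<^esub> h', v) - (frag_of (h, v) + frag_of (h', v))"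
  | h v w where "h \<in> carrier H" "x = frag_of (h, v + w) - (frag_of (h, v) + frag_of (h, w))"
  | h b v where "h \<in> carrier H" "b \<in> carrier (y_poly_smash n)"
      "x = frag_of (h \<otimes>\<^bsub>H\<^esub> y_poly_smash_to_H n c b, v) - frag_of (h, b \<odot>\<^bsub>triv_module\<^esub> v)"
    unfolding tensor_relators_def triv_module_simps by blast
  then show thesis
  proof cases
    case 1
    then show thesis using that(1) by (auto simp: carrier_H H_class_add)
  next
    case 2
    then show thesis using that(2) by (auto simp: carrier_H)
  next
    case 3
    then obtain a b' where ab: "a \<in> C" "h = cl a" "b' \<in> carrier (y_smash n)" "b = Iy +>\<^bsub>y_smash n\<^esub> b'"
      by (auto simp: carrier_H carrier_y_poly_smash)
    then have "b' \<in> C" using Cy_subset by blast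
    then show thesis
      using that(3)[OF ab(1,3)] 3(3) ab by (simp add: y_poly_smash_to_H_coset triv_module_smult H_class_mult)
  qed
qed

lemma relatorI:
  "a \<in> C \<Longrightarrow> b \<in> C \<Longrightarrow> frag_of (cl (a + b), v) - (frag_of (cl a, v) + frag_of (cl b, v)) \<in> relators"
  "a \<in> C \<Longrightarrow> frag_of (cl a, v + w) - (frag_of (cl a, v) + frag_of (cl a, w)) \<in> relators"
  "a \<in> C \<Longrightarrow> b \<in> carrier (y_smash n) \<Longrightarrow> frag_of (cl (a * b), v) - frag_of (cl a, triv_char b * v) \<in> relators"
proof -
  show "frag_of (cl (a + b), v) - (frag_of (cl a, v) + frag_of (cl b, v)) \<in> relators" if "a \<in> C" "b \<in> C" for a b v
    using H_class_in[OF that(1)] H_class_in[OF that(2)]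
    unfolding tensor_relators_def triv_module_simps H_class_add[OF that, symmetric] by blast
  show "frag_of (cl a, v + w) - (frag_of (cl a, v) + frag_of (cl a, w)) \<in> relators" if "a \<in> C" for a v w
    using H_class_in[OF that] unfolding tensor_relators_def triv_module_simps by blast
  show "frag_of (cl (a * b), v) - frag_of (cl a, triv_char b * v) \<in> relators"
    if ab: "a \<in> C" "b \<in> carrier (y_smash n)" for a b v
  proof -
    have "b \<in> C" using ab Cy_subset by blast
    then have "frag_of (cl (a * b), v) - frag_of (cl a, triv_char b * v)
      = frag_of (cl a \<otimes>\<^bsub>H\<^esub> y_poly_smash_to_H n c (Iy +>\<^bsub>y_smash n\<^esub> b), v) - frag_of (cl a, (Iy +>\<^bsub>y_smash n\<^esub> b) \<odot>\<^bsub>triv_module\<^esub> v)"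
      using ab by (simp add: y_poly_smash_to_H_coset triv_module_smult H_class_mult)
    moreover have "cl a \<in> carrier H" "Iy +>\<^bsub>y_smash n\<^esub> b \<in> carrier (y_poly_smash n)"
      using ab by (auto simp: carrier_H carrier_y_poly_smash)
    ultimately show ?thesis unfolding tensor_relators_def triv_module_simps by blast
  qed
qed

lemma keys_diff_subset: "keys x \<subseteq> S \<Longrightarrow> keys y \<subseteq> S \<Longrightarrow> keys (x - y) \<subseteq> S" for x y :: "'x \<Rightarrow>\<^sub>0 int"
  using keys_diff[of x y] by blast

lemma keys_add_subset: "keys x \<subseteq> S \<Longrightarrow> keys y \<subseteq> S \<Longrightarrow> keys (x + y) \<subseteq> S" for x y :: "'x \<Rightarrow>\<^sub>0 int"
  using keys_add[of x y] by blast

lemma relators_carrier: "x \<in> relators \<Longrightarrow> keys x \<subseteq> pairs"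
proof (induction rule: relator_cases)
  case (balance a b v)
  then have "b \<in> C" using Cy_subset by blast
  then show ?case unfolding balance(3) by (intro keys_diff_subset) (use balance in \<open>auto simp: carrier_H C_closed\<close>)
next
  case (left a b v)
  then show ?case unfolding left(3)
    by (intro keys_diff_subset keys_add_subset) (auto simp: carrier_H C_closed)
next
  case (right a v w)
  then show ?case unfolding right(2)
    by (intro keys_diff_subset keys_add_subset) (auto simp: carrier_H C_closed)
qed

lemma R0_carrier: "x \<in> R0 \<Longrightarrow> keys x \<subseteq> pairs"
proof -
  assume x: "x \<in> R0"
  have "relators \<subseteq> carrier (free_Abelian_group pairs)" using relators_carrier by auto
  from group.generate_in_carrier[OF group_free_Abelian_group this x]
  show ?thesis by (simp only: carrier_free_Abelian_group_iff)
qed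

lemma R0_closed: "0 \<in> R0" "x \<in> R0 \<Longrightarrow> y \<in> R0 \<Longrightarrow> x + y \<in> R0" "x \<in> R0 \<Longrightarrow> - x \<in> R0"
  "x \<in> R0 \<Longrightarrow> y \<in> R0 \<Longrightarrow> x - y \<in> R0" "x \<in> relators \<Longrightarrow> x \<in> R0"
proof -
  show "0 \<in> R0" using generate.one[of "free_Abelian_group pairs" relators] by simp
  show add: "x + y \<in> R0" if "x \<in> R0" "y \<in> R0" for x y using generate.eng[OF that] by simp
  have rc: "relators \<subseteq> carrier (free_Abelian_group pairs)" using relators_carrier by auto
  show neg: "- x \<in> R0" if "x \<in> R0" for x
    using group.generate_m_inv_closed[OF group_free_Abelian_group rc that] inv_free_Abelian_group[OF R0_carrier[OF that]]
    by simp
  show "x - y \<in> R0" if "x \<in> R0" "y \<in> R0" for x y using add[OF that(1) neg[OF that(2)]] by simp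
  show "x \<in> R0" if "x \<in> relators" using generate.incl[OF that] .
qed

lemma R0_induct [consumes 1, case_names zero relator add neg]:
  assumes "x \<in> R0" "P 0" "\<And>x. x \<in> relators \<Longrightarrow> P x"
    "\<And>x y. x \<in> R0 \<Longrightarrow> y \<in> R0 \<Longrightarrow> P x \<Longrightarrow> P y \<Longrightarrow> P (x + y)" "\<And>x. x \<in> relators \<Longrightarrow> P x \<Longrightarrow> P (- x)"
  shows "P x"
  using assms(1)
proof (induction rule: generate.induct)
  case (inv h)
  then show ?case using assms(3,5) relators_carrier[OF inv] by simp
qed (use assms in auto)

definition pair_act :: "smash set \<Rightarrow> (smash set \<times> complex \<Rightarrow>\<^sub>0 int) \<Rightarrow> (smash set \<times> complex \<Rightarrow>\<^sub>0 int)" where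
  "pair_act r = frag_extend (\<lambda>(h, v). frag_of (r \<otimes>\<^bsub>H\<^esub> h, v))"

lemma pair_act_linear: "pair_act r (x + y) = pair_act r x + pair_act r y" "pair_act r (x - y) = pair_act r x - pair_act r y"
  "pair_act r (- x) = - pair_act r x" "pair_act r 0 = 0"
  "pair_act r (frag_of (h, v)) = frag_of (r \<otimes>\<^bsub>H\<^esub> h, v)"
  by (simp_all add: pair_act_def frag_extend_add frag_extend_diff frag_extend_minus)

lemma pair_act_carrier:
  assumes "r \<in> carrier H" "keys x \<subseteq> pairs"
  shows "keys (pair_act r x) \<subseteq> pairs"
proof -
  have "r \<otimes>\<^bsub>H\<^esub> h \<in> carrier H" if "h \<in> carrier H" for h
    using ring.ring_simprules(5)[OF ring_H assms(1) that] .
  then have "(\<Union>y\<in>keys x. keys (case y of (h, v) \<Rightarrow> frag_of (r \<otimes>\<^bsub>H\<^esub> h, v))) \<subseteq> pairs"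
    using assms(2) by auto
  with keys_frag_extend[of "\<lambda>(h, v). frag_of (r \<otimes>\<^bsub>H\<^esub> h, v)" x]
  show ?thesis unfolding pair_act_def by (rule order_trans)
qed

text \<open>Left multiplication sends each relator to a relator of the same kind.\<close>

lemma pair_act_R0:
  assumes r: "r \<in> carrier H" and "x \<in> R0"
  shows "pair_act r x \<in> R0"
  using assms(2)
proof (induction rule: R0_induct)
  case (relator x)
  obtain d where d: "d \<in> C" "r = cl d" using r by (auto simp: carrier_H)
  from relator show ?case
  proof (cases rule: relator_cases)
    case (left a b v)
    then show ?thesis
      using relatorI(1)[of "d * a" "d * b" v] d R0_closed(5)
      by (simp add: pair_act_linear H_class_mult C_closed distrib_left)
  next
    case (right a v w)
    then show ?thesis
      using relatorI(2)[of "d * a" v w] d R0_closed(5)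
      by (simp add: pair_act_linear H_class_mult C_closed)
  next
    case (balance a b v)
    then have "b \<in> C" using Cy_subset by blast
    then show ?thesis
      using relatorI(3)[of "d * a" b v] d R0_closed(5) balance
      by (simp add: pair_act_linear H_class_mult C_closed mult.assoc)
  qed
qed (auto simp: pair_act_linear intro: R0_closed)

text \<open>The map sending \<open>h \<otimes> v\<close> to \<open>v\<close> times the polynomial
  \<open>h(1)\<close>, written on the free group. It will separate the images of distinct
  polynomials.\<close>

definition ev :: "(smash set \<times> complex \<Rightarrow>\<^sub>0 int) \<Rightarrow> mpol" where
  "ev F = (\<Sum>k\<in>keys F. of_int (lookup F k) * (scl (snd k) * hact (fst k) 1))"

lemma ev_add: "ev (F + G) = ev F + ev G"
  unfolding ev_def by (rule setsum_keys_plus_distrib) (simp_all add: distrib_right)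

lemma ev_frag_of: "ev (frag_of (h, v)) = scl v * hact h 1"
  by (simp add: ev_def)

lemma ev_0: "ev 0 = 0"
  by (simp add: ev_def)

lemma ev_neg: "ev (- F) = - ev F"
  using ev_add[of F "- F"] by (simp add: ev_0 eq_neg_iff_add_eq_0 add.commute)

lemma ev_diff: "ev (F - G) = ev F - ev G"
  using ev_add[of F "- G"] by (simp add: ev_neg)

text \<open>The only relators that are not pure additivity are the balancing ones, and for them
  \<open>rho_one_y\<close> is the required identity.\<close>

lemma ev_R0: "x \<in> R0 \<Longrightarrow> ev x = 0"
proof (induction rule: R0_induct)
  case (relator x)
  then show ?case
  proof (cases rule: relator_cases)
    case (left a b v)
    then show ?thesis by (simp add: ev_diff ev_add ev_frag_of hact_class rho_linear distrib_left)
  next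
    case (right a v w)
    then show ?thesis by (simp add: ev_diff ev_add ev_frag_of hact_class scl_add distrib_right)
  next
    case (balance a b v)
    then have "b \<in> C" using Cy_subset by blast
    then have "rho (a * b) 1 = rho a (scl (triv_char b) * 1)"
      using balance by (simp add: rho_mult rho_one_y)
    also have "\<dots> = scl (triv_char b) * rho a 1" by (rule clinear_scl[OF clinear_rho2])
    finally show ?thesis using balance
      by (simp add: ev_diff ev_frag_of hact_class scl_mult mult_ac)
  qed
qed (simp_all add: ev_0 ev_add ev_neg)

definition T :: "smash \<Rightarrow> (smash set \<times> complex \<Rightarrow>\<^sub>0 int)" where
  "T a = frag_of (cl a, 1)"

lemma T_add: "a \<in> C \<Longrightarrow> b \<in> C \<Longrightarrow> T (a + b) - (T a + T b) \<in> R0"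
  unfolding T_def using relatorI(1) R0_closed(5) by blast

lemma T_0: "T 0 \<in> R0"
  using R0_closed(3)[OF T_add[of 0 0]] by (simp add: C_closed)

lemma T_diff:
  assumes "a \<in> C" "b \<in> C"
  shows "T (a - b) - (T a - T b) \<in> R0"
proof -
  have "T (a - b + b) - (T (a - b) + T b) \<in> R0" by (rule T_add) (use assms in \<open>auto intro: C_diff\<close>)
  from R0_closed(3)[OF this] show ?thesis by (simp add: algebra_simps)
qed

text \<open>The left ideal of \<open>a\<close> with \<open>a \<otimes> 1 = 0\<close> in the induced module.\<close>

definition K :: "smash set" where
  "K = {a \<in> C. T a \<in> R0}"

lemma K_diff: "a \<in> K \<Longrightarrow> b \<in> K \<Longrightarrow> a - b \<in> K"
proof -
  assume "a \<in> K" "b \<in> K"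
  then have ab: "a \<in> C" "b \<in> C" "T a \<in> R0" "T b \<in> R0" by (auto simp: K_def)
  from R0_closed(2)[OF T_diff[OF ab(1,2)] R0_closed(4)[OF ab(3,4)]]
  show ?thesis using ab by (simp add: K_def C_diff)
qed

lemma K_0: "0 \<in> K"
  using T_0 by (simp add: K_def C_closed)

lemma K_neg: "a \<in> K \<Longrightarrow> - a \<in> K"
  using K_diff[OF K_0] by simp

lemma K_add: "a \<in> K \<Longrightarrow> b \<in> K \<Longrightarrow> a + b \<in> K"
  using K_diff[OF _ K_neg, of a b] by simp

lemma I_subset_K: "a \<in> I \<Longrightarrow> a \<in> K"
  using H_class_eqI[of a 0] T_0 I_closed(1) by (simp add: K_def T_def)

lemma K_mult: "a \<in> K \<Longrightarrow> b \<in> C \<Longrightarrow> b * a \<in> K"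
  using pair_act_R0[OF H_class_in, of b "T a"]
  by (simp add: K_def T_def pair_act_linear H_class_mult C_closed)

text \<open>In the tensor product \<open>b \<otimes> 1 = 1 \<otimes> \<chi>(b) = \<chi>(b) \<otimes>
  1\<close> for the trivial character \<open>\<chi>\<close>.\<close>

lemma K_y:
  assumes "b \<in> carrier (y_smash n)"
  shows "b - scl (triv_char b) \<in> K"
proof -
  have b: "b \<in> C" using assms Cy_subset by blast
  have t: "triv_char (scl z) = z" for z
  proof -
    have "scl (triv_char (scl z) - z) = (0 :: mpol)"
      using rho_one_y[OF Cy_gens(3), of z] by (simp add: scl_diff)
    then show ?thesis by (simp only: scl_eq_0_iff) simp
  qed
  \<comment> \<open>Balancing is used twice, for \<open>b\<close> and for the scalar
    \<open>\<chi>(b)\<close>; both give \<open>1 \<otimes> \<chi>(b)\<close>.\<close>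
  have "frag_of (cl (1 * b), 1) - frag_of (cl 1, triv_char b * 1) \<in> R0"
    using relatorI(3)[OF C_closed(2) assms] R0_closed(5) by blast
  moreover have "frag_of (cl (1 * scl (triv_char b)), 1) - frag_of (cl 1, triv_char (scl (triv_char b)) * 1) \<in> R0"
    using relatorI(3)[OF C_closed(2) Cy_gens(3)] R0_closed(5) by blast
  ultimately have "T b - T (scl (triv_char b)) \<in> R0"
    using R0_closed(4) unfolding T_def t by fastforce
  from R0_closed(2)[OF T_diff[OF b C_gens(4)[of "triv_char b"]] this] have "T (b - scl (triv_char b)) \<in> R0" by simp
  then show ?thesis using b by (simp add: K_def C_diff C_gens)
qed

lemma triv_char_gens: "triv_char (pg p) = 1" "triv_char (yg i) = 0"
  by (simp_all add: triv_char_def pg_def yg_def cong: conj_cong)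

lemma K_yg: "i \<in> {1..n} \<Longrightarrow> yg i \<in> K"
  using K_y[OF Cy_gens(1)] by (simp add: triv_char_gens)

lemma K_pg: "affected p \<subseteq> {1..n} \<Longrightarrow> pg p - 1 \<in> K"
  using K_y[OF Cy_gens(2)] by (simp add: triv_char_gens)

end

section \<open>Rewriting every \<open>h \<otimes> 1\<close> to a polynomial\<close>

lemma perm_letter_1 [simp]: "perm_letter 1 = id"
proof
  fix l show "perm_letter 1 l = id l" by (cases l) simp_all
qed

lemma pg_xg: "pg p * xg i = xg (papply p i) * pg p"
  by (simp add: pg_def xg_def mult_single plus_smash_word_def)

definition word_mono :: "letter list \<Rightarrow> smash" where
  "word_mono w = single (Smash w 1) 1"

lemma word_mono_simps: "word_mono [] = 1" "word_mono [Xl i] = xg i" "word_mono [Yl i] = yg i" "word_mono (u @ w) = word_mono u * word_mono w"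
  by (simp_all add: word_mono_def xg_def yg_def mult_single plus_smash_word_def flip: zero_smash_word_def)

lemma word_mono_Cons: "word_mono (l # w) = word_mono [l] * word_mono w"
  using word_mono_simps(4)[of "[l]" w] by simp

context dunkl
begin

lemma C_word_mono: "set w \<subseteq> xy_letters \<Longrightarrow> word_mono w \<in> C"
  by (auto simp: C_eq smash_keys_def word_mono_def)

text \<open>Congruence modulo a left ideal: it expresses equality of \<open>a \<otimes> 1\<close>
  and \<open>b \<otimes> 1\<close> and is compatible with multiplication from the left.\<close>

definition kcong :: "smash \<Rightarrow> smash \<Rightarrow> bool" where
  "kcong a b \<longleftrightarrow> a \<in> C \<and> b \<in> C \<and> a - b \<in> K"

lemma kcong_refl: "a \<in> C \<Longrightarrow> kcong a a"
  by (simp add: kcong_def K_0)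

lemma kcong_trans [trans]: "kcong a b \<Longrightarrow> kcong b d \<Longrightarrow> kcong a d"
  using K_add[of "a - b" "b - d"] by (simp add: kcong_def)

lemma kcong_sym: "kcong a b \<Longrightarrow> kcong b a"
  using K_neg[of "a - b"] by (simp add: kcong_def)

lemma kcong_add: "kcong a b \<Longrightarrow> kcong a' b' \<Longrightarrow> kcong (a + a') (b + b')"
  using K_add[of "a - b" "a' - b'"] by (simp add: kcong_def C_closed algebra_simps)

lemma kcong_mult: "kcong a b \<Longrightarrow> d \<in> C \<Longrightarrow> kcong (d * a) (d * b)"
  using K_mult[of "a - b" d] by (simp add: kcong_def C_closed right_diff_distrib)

lemma kcong_diff: "kcong a b \<Longrightarrow> kcong a' b' \<Longrightarrow> kcong (a - a') (b - b')"
  using K_diff[of "a - b" "a' - b'"] by (simp add: kcong_def C_diff algebra_simps)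

lemma kcong_sum: "(\<And>x. x \<in> A \<Longrightarrow> kcong (f x) (g x)) \<Longrightarrow> kcong (\<Sum>x\<in>A. f x) (\<Sum>x\<in>A. g x)"
  by (induction A rule: infinite_finite_induct) (auto intro: kcong_add kcong_refl C_closed)

lemma kcong_ideal: "a \<in> C \<Longrightarrow> b \<in> C \<Longrightarrow> a - b \<in> I \<Longrightarrow> kcong a b"
  using I_subset_K by (simp add: kcong_def)

text \<open>A fixed order of the letters is chosen because they commute only modulo the Cherednik
  ideal.\<close>

definition xword :: "(nat \<Rightarrow>\<^sub>0 nat) \<Rightarrow> letter list" where
  "xword b = concat (map (\<lambda>i. replicate (lookup b i) (Xl i)) [1..<n + 1])"

definition emb :: "mpol \<Rightarrow> smash" where
  "emb = lin_ext (\<lambda>b. word_mono (xword b))"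

lemma clinear_emb: "clinear emb"
  unfolding emb_def by (rule clinear_lin_ext)

lemmas emb_linear = clinear_add[OF clinear_emb] clinear_diff[OF clinear_emb]
  clinear_scl[OF clinear_emb] clinear_sum[OF clinear_emb] clinear_0[OF clinear_emb]

lemma emb_single: "emb (single b v) = scl v * word_mono (xword b)"
  by (simp add: emb_def lin_ext_single)

lemma set_xword: "set (xword b) \<subseteq> Xl ` {1..n}"
  by (auto simp: xword_def)

lemma C_emb: "emb p \<in> C"
  unfolding emb_def lin_ext_def using set_xword by (intro C_sum C_closed(4) C_gens C_word_mono) blast

lemma emb_scl: "emb (scl z) = scl z"
proof -
  have "xword 0 = []" by (simp add: xword_def)
  then show ?thesis by (simp add: scl_def emb_single word_mono_simps)
qed

lemma xg_mono_commute:
  assumes i: "i \<in> {1..n}" and "set u \<subseteq> Xl ` {1..n}"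
  shows "xg i * word_mono u - word_mono u * xg i \<in> I"
  using assms(2)
proof (induction u)
  case Nil
  then show ?case using I_closed(2) by (simp add: word_mono_simps)
next
  case (Cons l u)
  then obtain j where j: "l = Xl j" "j \<in> {1..n}" by auto
  have u: "word_mono u \<in> C" using Cons by (intro C_word_mono) auto
  have "xg i * xg j - xg j * xg i \<in> I"
    by (rule relators_in_I) (use i j in \<open>auto simp: cherednik_relators_def\<close>)
  then have "(xg i * xg j - xg j * xg i) * word_mono u \<in> I" by (rule I_closed(7)[OF _ u])
  moreover have "xg j * (xg i * word_mono u - word_mono u * xg i) \<in> I"
    using Cons by (intro I_closed(6) C_gens j) auto
  ultimately have "(xg i * xg j - xg j * xg i) * word_mono u + xg j * (xg i * word_mono u - word_mono u * xg i) \<in> I"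
    by (rule I_closed(3))
  then show ?case unfolding j(1) word_mono_Cons[of "Xl j" u] word_mono_simps(2) by (simp add: algebra_simps)
qed

text \<open>The new letter \<open>x_i\<close> has to pass the block of smaller variables, and each
  exchange costs a commutator in the ideal.\<close>

lemma emb_var:
  assumes i: "i \<in> {1..n}" and p: "p \<in> Pn"
  shows "xg i * emb p - emb (var i * p) \<in> I"
proof -
  have "keys p \<subseteq> {b. keys b \<subseteq> {1..n}}" using p by (auto simp: Pn_def)
  then show ?thesis
  proof (induction p rule: poly_mapping_induct_on)
    case (single b v)
    let ?g = "\<lambda>b i. replicate (lookup b i) (Xl i)"
    let ?u = "concat (map (?g b) [1..<i])" and ?w = "concat (map (?g b) [i..<n + 1])"
    have "i + (n + 1 - i) = n + 1" using i by simp
    then have split: "[1..<n + 1] = [1..<i] @ [i..<n + 1]"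
      using i upt_add_eq_append[of 1 i "n + 1 - i"] by auto
    have split': "[i..<n + 1] = i # [i + 1..<n + 1]" using i by (subst upt_conv_Cons) (auto simp: Suc_eq_plus1)
    have xb: "xword b = ?u @ ?w" unfolding xword_def split by simp
    have e1: "map (?g (single i 1 + b)) [1..<i] = map (?g b) [1..<i]"
      by (rule map_cong) (auto simp: lookup_add lookup_single when_def)
    have e2: "map (?g (single i 1 + b)) [i + 1..<n + 1] = map (?g b) [i + 1..<n + 1]"
      by (rule map_cong) (auto simp: lookup_add lookup_single when_def)
    have xb': "xword (single i 1 + b) = ?u @ [Xl i] @ ?w"
      unfolding xword_def split map_append concat_append e1 unfolding split' list.map concat.simps e2
      by (simp add: lookup_add plus_1_eq_Suc)
    have wC: "word_mono ?w \<in> C" and uX: "set ?u \<subseteq> Xl ` {1..n}"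
      using i by (auto intro!: C_word_mono)
    have "scl v * ((xg i * word_mono ?u - word_mono ?u * xg i) * word_mono ?w) \<in> I"
      by (intro I_closed(6,7) xg_mono_commute i uX wC C_gens)
    moreover have "xg i * emb (single b v) - emb (var i * single b v)
       = scl v * ((xg i * word_mono ?u - word_mono ?u * xg i) * word_mono ?w)"
    proof -
      have "xg i * (scl v * (word_mono ?u * word_mono ?w)) = scl v * (xg i * (word_mono ?u * word_mono ?w))"
        by (simp only: mult.assoc[symmetric] scl_commute)
      then show ?thesis
        unfolding var_mult_single emb_single xb xb' word_mono_simps
        by (simp add: right_diff_distrib left_diff_distrib mult.assoc)
    qed
    ultimately show ?case by simp
  next
    case (add f g)
    from I_closed(3)[OF add(3,4)] show ?case by (simp add: emb_linear distrib_left algebra_simps)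
  qed (simp add: emb_linear I_closed)
qed

lemma kcong_emb_var:
  "i \<in> {1..n} \<Longrightarrow> p \<in> Pn \<Longrightarrow> kcong (xg i * emb p) (emb (var i * p))"
  by (intro kcong_ideal emb_var C_emb C_closed C_gens)

text \<open>The letters \<open>x_i\<close> act by multiplication, and the reordering errors of
  \<open>emb_var\<close> act by zero.\<close>

lemma rho_emb:
  assumes "p \<in> Pn"
  shows "rho (emb p) 1 = p"
proof -
  have "\<forall>a\<in>keys p. keys a \<subseteq> {1..n}" using assms by (simp add: Pn_def)
  then show ?thesis
  proof (induction p rule: poly_induct_vars)
    case (var i p)
    then have "rho (xg i * emb p - emb (var i * p)) 1 = 0"
      by (intro rho_I emb_var) (simp_all add: Pn_def)
    then show ?case using var by (simp add: rho_linear rho_mult C_gens C_emb)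
  qed (simp_all add: emb_scl emb_linear rho_linear)
qed

text \<open>A permutation passes the letters \<open>x_j\<close> exactly, permuting their indices,
  and is finally absorbed since \<open>p - 1\<close> lies in \<open>K\<close>.\<close>

lemma kcong_emb_pact:
  assumes q: "affected q \<subseteq> {1..n}" and p: "p \<in> Pn"
  shows "kcong (pg q * emb p) (emb (pact q p))"
proof -
  have "\<forall>a\<in>keys p. keys a \<subseteq> {1..n}" using p by (simp add: Pn_def)
  then show ?thesis
  proof (induction p rule: poly_induct_vars)
    case (scl z)
    have "scl z * (pg q - 1) \<in> K" by (intro K_mult K_pg q C_gens)
    then show ?case
      by (simp add: kcong_def emb_scl C_closed C_gens q scl_commute right_diff_distrib)
  next
    case (add f g)
    then show ?case by (simp add: emb_linear pact_linear distrib_left kcong_add)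
  next
    case (var j p)
    have pP: "p \<in> Pn" using var by (simp add: Pn_def)
    have qj: "papply q j \<in> {1..n}" using papply_in_iff[OF q] var by blast
    have "kcong (pg q * emb (var j * p)) (pg q * (xg j * emb p))"
      by (intro kcong_mult kcong_sym[OF kcong_emb_var] var pP C_gens q)
    also have "pg q * (xg j * emb p) = xg (papply q j) * (pg q * emb p)"
      by (simp add: pg_xg flip: mult.assoc)
    also have "kcong \<dots> (xg (papply q j) * emb (pact q p))"
      by (intro kcong_mult var C_gens qj)
    also have "kcong \<dots> (emb (var (papply q j) * pact q p))"
      by (intro kcong_emb_var qj Pn_pact q pP)
    finally show ?case by (simp add: pact_mult pact_var)
  qed
qed

text \<open>The relations move \<open>y_i\<close> to the right past \<open>x_j\<close>, with the
  same corrections as in the recursion of the Dunkl operator; at the right end \<open>y_i\<close>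
  lies in \<open>K\<close>.\<close>

lemma kcong_emb_dk:
  assumes i: "i \<in> {1..n}" and p: "p \<in> Pn"
  shows "kcong (yg i * emb p) (emb (dk i p))"
proof -
  have "\<forall>a\<in>keys p. keys a \<subseteq> {1..n}" using p by (simp add: Pn_def)
  then show ?thesis
  proof (induction p rule: poly_induct_vars)
    case (scl z)
    have "scl z * yg i \<in> K" by (intro K_mult K_yg i C_gens)
    moreover from this have "scl z * yg i \<in> C" by (simp add: K_def)
    ultimately show ?case
      by (simp add: kcong_def emb_scl emb_linear C_closed scl_commute)
  next
    case (add f g)
    then show ?case by (simp add: emb_linear dk_linear distrib_left kcong_add)
  next
    case (var j p)
    have pP: "p \<in> Pn" using var by (simp add: Pn_def)
    have xD: "kcong (xg j * (yg i * emb p)) (emb (var j * dk i p))"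
    proof -
      have "kcong (xg j * (yg i * emb p)) (xg j * emb (dk i p))"
        by (intro kcong_mult var C_gens)
      also have "kcong \<dots> (emb (var j * dk i p))"
        by (intro kcong_emb_var var Pn_dk i pP)
      finally show ?thesis .
    qed
    have yx: "kcong (yg i * emb (var j * p)) (yg i * (xg j * emb p))"
      by (intro kcong_mult kcong_sym[OF kcong_emb_var] var pP C_gens i)
    have sw: "kcong (pg (swp i l) * emb p) (emb (pact (swp i l) p))" if "l \<in> {1..n}" for l
      by (intro kcong_emb_pact affected_swap_subset i that pP)
    show ?case
    proof (cases "i = j")
      case False
      let ?r = "(yg i * xg j - xg j * yg i) - scl c * pg (swp i j)"
      have "?r \<in> I"
        by (rule relators_in_I) (use i var False in \<open>auto simp: cherednik_relators_def const_eq_scl\<close>)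
      then have "?r * emb p \<in> I" by (intro I_closed(7) C_emb)
      then have "kcong (yg i * (xg j * emb p)) (xg j * (yg i * emb p) + scl c * (pg (swp i j) * emb p))"
        by (intro kcong_ideal C_closed C_gens C_emb C_pg_swap i var) (simp add: algebra_simps)
      also have "kcong \<dots> (emb (var j * dk i p) + scl c * emb (pact (swp i j) p))"
        by (intro kcong_add xD kcong_mult sw var C_gens)
      also have "\<dots> = emb (dk i (var j * p))"
        using dk_var_mult[OF i var(1) False] by (simp add: emb_linear)
      finally show ?thesis using yx kcong_trans by blast
    next
      case True
      let ?S = "\<lambda>f. \<Sum>l\<in>{1..n} - {i}. f l"
      let ?r = "(yg i * xg i - xg i * yg i) - (1 - scl c * ?S (\<lambda>l. pg (swp i l)))"
      have "?r \<in> I"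
        unfolding const_eq_scl[symmetric]
        by (rule relators_in_I, unfold cherednik_relators_def, rule UnI2, rule CollectI, rule exI[of _ i])
           (use i in simp)
      then have rI: "?r * emb p \<in> I" by (intro I_closed(7) C_emb)
      have "kcong (yg i * (xg i * emb p)) (xg i * (yg i * emb p) + (emb p - scl c * ?S (\<lambda>l. pg (swp i l) * emb p)))"
      proof (rule kcong_ideal[rotated 2])
        have "?r * emb p = yg i * (xg i * emb p) - (xg i * (yg i * emb p) + (emb p - scl c * ?S (\<lambda>l. pg (swp i l) * emb p)))"
          by (simp add: left_diff_distrib mult.assoc sum_distrib_right)
        then show "yg i * (xg i * emb p) - (xg i * (yg i * emb p) + (emb p - scl c * ?S (\<lambda>l. pg (swp i l) * emb p))) \<in> I"
          using rI by (simp only:)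
        show "yg i * (xg i * emb p) \<in> C"
          by (intro C_closed C_gens C_emb i)
        show "xg i * (yg i * emb p) + (emb p - scl c * ?S (\<lambda>l. pg (swp i l) * emb p)) \<in> C"
          by (intro C_closed C_gens C_emb i C_diff C_sum C_pg_swap) simp_all
      qed
      also have "kcong \<dots> (emb (var i * dk i p) + (emb p - scl c * ?S (\<lambda>l. emb (pact (swp i l) p))))"
        using xD True by (intro kcong_add kcong_diff kcong_refl C_emb kcong_mult kcong_sum sw C_gens) auto
      also have "\<dots> = emb (dk i (var i * p))"
        using dk_var_mult_same[OF i] by (simp add: emb_linear add_diff_eq)
      finally show ?thesis using yx kcong_trans True by blast
    qed
  qed
qed

lemma kcong_emb_word: "set w \<subseteq> xy_letters \<Longrightarrow> kcong (word_mono w) (emb (word_act w 1))"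
proof (induction w)
  case Nil
  then show ?case using emb_scl[of 1] by (simp add: word_mono_simps kcong_refl C_closed)
next
  case (Cons l w)
  have P: "word_act w 1 \<in> Pn" using Cons by (intro Pn_word_act) auto
  have l: "word_mono [l] \<in> C" using Cons by (intro C_word_mono) auto
  have "kcong (word_mono (l # w)) (word_mono [l] * emb (word_act w 1))"
    unfolding word_mono_Cons[of l w] using Cons l by (intro kcong_mult) auto
  also have "kcong \<dots> (emb (letter_act l (word_act w 1)))"
    using Cons P by (cases l) (auto simp: word_mono_simps intro!: kcong_emb_var kcong_emb_dk)
  finally show ?case by simp
qed

text \<open>A key is a word times a permutation. The permutation is \<open>1\<close> modulo
  \<open>K\<close>, and the letters of the word are then absorbed one by one from the right.\<close>

lemma kcong_emb_rho:
  assumes "a \<in> C"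
  shows "kcong a (emb (rho a 1))"
proof -
  have "keys a \<subseteq> smash_keys xy_letters n" using assms by (simp add: C_eq)
  then show ?thesis
  proof (induction a rule: poly_mapping_induct_on)
    case (single k v)
    obtain w q where k: "k = Smash w q" by (cases k)
    have wq: "set w \<subseteq> xy_letters" "affected q \<subseteq> {1..n}" using single by (auto simp: k smash_keys_def)
    have "word_mono w * pg q - word_mono w = word_mono w * (pg q - 1)" by (simp add: right_diff_distrib)
    then have "kcong (word_mono w * pg q) (word_mono w)"
      using K_mult[OF K_pg[OF wq(2)] C_word_mono[OF wq(1)]] wq by (simp add: kcong_def C_closed C_gens C_word_mono)
    also have "kcong \<dots> (emb (word_act w 1))" by (rule kcong_emb_word[OF wq(1)])
    finally have "kcong (scl v * (word_mono w * pg q)) (scl v * emb (word_act w 1))"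
      by (intro kcong_mult C_gens)
    moreover have "single k v = scl v * (word_mono w * pg q)"
      by (simp add: k word_mono_def pg_def mult_single plus_smash_word_def scl_single)
    moreover have "rho (single k v) 1 = scl v * word_act w 1"
      by (simp add: rho_single smash_act_def k)
    ultimately show ?case by (simp only: emb_linear)
  qed (auto simp: rho_linear emb_linear intro: kcong_add kcong_refl C_closed)
qed

lemma FP_simps: "carrier FP = {x. keys x \<subseteq> pairs}" "x \<oplus>\<^bsub>FP\<^esub> y = x + y" "\<zero>\<^bsub>FP\<^esub> = 0" "r \<odot>\<^bsub>FP\<^esub> x = pair_act r x"
  by (auto simp: free_pairs_module_def triv_module_simps pair_act_def free_Abelian_group_def)

lemma abelian_group_FP: "abelian_group FP"
proof (rule abelian_groupI)
  show "\<exists>y\<in>carrier FP. y \<oplus>\<^bsub>FP\<^esub> x = \<zero>\<^bsub>FP\<^esub>" if "x \<in> carrier FP" for x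
    using that by (intro bexI[of _ "- x"]) (simp_all add: FP_simps)
  show "x \<oplus>\<^bsub>FP\<^esub> y \<in> carrier FP" if "x \<in> carrier FP" "y \<in> carrier FP" for x y
    using that unfolding FP_simps by (simp only: mem_Collect_eq keys_add_subset)
qed (auto simp: FP_simps add_ac)

lemma FP_uminus: "x \<in> carrier FP \<Longrightarrow> \<ominus>\<^bsub>FP\<^esub> x = - x"
  by (rule abelian_group.minus_equality[OF abelian_group_FP]) (simp_all add: FP_simps)

lemma FP_minus: "x \<in> carrier FP \<Longrightarrow> y \<in> carrier FP \<Longrightarrow> x \<ominus>\<^bsub>FP\<^esub> y = x - y"
  unfolding a_minus_def by (simp add: FP_uminus) (simp add: FP_simps)

lemma submodule_R0: "submodule R0 H FP"
proof (rule submodule.intro)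
  interpret abelian_group FP by (rule abelian_group_FP)
  have sub: "R0 \<subseteq> carrier FP" using R0_carrier by (auto simp: FP_simps)
  show "subgroup R0 (add_monoid FP)"
  proof (rule add.subgroupI)
    show "R0 \<noteq> {}" using R0_closed(1) by blast
    show "\<ominus>\<^bsub>FP\<^esub> x \<in> R0" if "x \<in> R0" for x
      using FP_uminus[of x] sub that R0_closed(3) by auto
  qed (use sub R0_closed in \<open>auto simp: FP_simps\<close>)
qed (simp add: submodule_axioms_def FP_simps pair_act_R0)

lemma module_quotient_FP: "module_quotient H FP R0"
proof (rule module_quotient.intro)
  show "abelian_group FP" by (rule abelian_group_FP)
  show "submodule R0 H FP" by (rule submodule_R0)
  show "r \<odot>\<^bsub>FP\<^esub> (x \<oplus>\<^bsub>FP\<^esub> y) = r \<odot>\<^bsub>FP\<^esub> x \<oplus>\<^bsub>FP\<^esub> r \<odot>\<^bsub>FP\<^esub> y" for r x y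
    by (simp add: FP_simps pair_act_linear)
  show "r \<odot>\<^bsub>FP\<^esub> x \<in> carrier FP" if "r \<in> carrier H" "x \<in> carrier FP" for r x
    using that pair_act_carrier[of r x] by (simp add: FP_simps)
qed

lemmas FPQ_simps = module_quotient.carrier_Q[OF module_quotient_FP] module_quotient.zero_Q[OF module_quotient_FP]
lemmas FPQ_coset_eq_iff = module_quotient.coset_eq_iff[OF module_quotient_FP]
lemmas FPQ_coset_eq_N_iff = module_quotient.coset_eq_N_iff[OF module_quotient_FP]
lemmas FPQ_add = module_quotient.add_Q[OF module_quotient_FP]
lemmas FPQ_smult = module_quotient.smult_Q[OF module_quotient_FP]
lemmas FPQ_closed = module_quotient.Q_closed[OF module_quotient_FP]

abbreviation "D \<equiv> Delta_triv n c"

lemma D_eq: "D = quotient_module FP R0"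
  by (simp add: Delta_triv_def induced_module_def triv_module_simps)

text \<open>The isomorphism from polynomials in \<open>x_1, ..., x_n\<close> to the standard module,
  sending \<open>p\<close> to \<open>p \<otimes> 1\<close>.\<close>

definition E :: "mpol \<Rightarrow> delta" where
  "E p = R0 +>\<^bsub>FP\<^esub> T (emb p)"

lemma T_in_FP: "a \<in> C \<Longrightarrow> T a \<in> carrier FP"
  by (simp add: FP_simps T_def carrier_H)

lemma coset_T_eq:
  assumes "kcong a b"
  shows "R0 +>\<^bsub>FP\<^esub> T a = R0 +>\<^bsub>FP\<^esub> T b"
proof -
  have ab: "a \<in> C" "b \<in> C" "T (a - b) \<in> R0" using assms by (auto simp: kcong_def K_def)
  have "T (a - b) - (T (a - b) - (T a - T b)) \<in> R0" by (rule R0_closed(4)[OF ab(3) T_diff[OF ab(1,2)]])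
  then have "T a - T b \<in> R0" by simp
  then show ?thesis using FPQ_coset_eq_iff[OF T_in_FP T_in_FP] FP_minus[OF T_in_FP T_in_FP] ab by simp
qed

lemma E_rho: "a \<in> C \<Longrightarrow> R0 +>\<^bsub>FP\<^esub> T a = E (rho a 1)"
  unfolding E_def by (rule coset_T_eq[OF kcong_emb_rho])

lemma abelian_group_D: "abelian_group D"
  unfolding D_eq by (rule module_quotient.abelian_group_Q[OF module_quotient_FP])

lemma E_in: "E p \<in> carrier D"
  unfolding D_eq E_def by (rule FPQ_closed[OF T_in_FP[OF C_emb]])

lemma E_add:
  assumes "p \<in> Pn" "q \<in> Pn"
  shows "E p \<oplus>\<^bsub>D\<^esub> E q = E (p + q)"
proof -
  have car: "T (emb p) + T (emb q) \<in> carrier FP"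
    using T_in_FP[OF C_emb, of p] T_in_FP[OF C_emb, of q]
    unfolding FP_simps(1) by (simp only: mem_Collect_eq keys_add_subset)
  have "E p \<oplus>\<^bsub>D\<^esub> E q = R0 +>\<^bsub>FP\<^esub> (T (emb p) + T (emb q))"
    unfolding D_eq E_def using FPQ_add[OF T_in_FP[OF C_emb] T_in_FP[OF C_emb], of p q] by (simp only: FP_simps)
  also have "\<dots> = R0 +>\<^bsub>FP\<^esub> T (emb p + emb q)"
    using R0_closed(3)[OF T_add[OF C_emb C_emb, of p q]] FPQ_coset_eq_iff[OF car T_in_FP] FP_minus[OF car T_in_FP]
      C_closed(3)[OF C_emb C_emb, of p q] by simp
  finally show ?thesis by (simp add: E_def emb_linear)
qed

lemma E_0: "E 0 = \<zero>\<^bsub>D\<^esub>"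
  unfolding D_eq E_def FPQ_simps using FPQ_coset_eq_N_iff[OF T_in_FP] T_0 by (simp add: emb_linear C_closed)

lemma E_smult:
  assumes "a \<in> C" "p \<in> Pn"
  shows "cl a \<odot>\<^bsub>D\<^esub> E p = E (rho a p)"
proof -
  have "cl a \<odot>\<^bsub>D\<^esub> E p = R0 +>\<^bsub>FP\<^esub> T (a * emb p)"
    unfolding D_eq E_def FPQ_smult[OF H_class_in[OF assms(1)] T_in_FP[OF C_emb]] FP_simps
    using assms by (simp add: T_def pair_act_linear H_class_mult C_emb)
  also have "\<dots> = E (rho a p)"
    using E_rho[of "a * emb p"] assms by (simp add: C_closed C_emb rho_mult rho_emb)
  finally show ?thesis .
qed

text \<open>\<open>ev\<close> descends to the quotient and recovers \<open>p\<close> from its image,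
  as \<open>emb p\<close> applied to \<open>1\<close> is \<open>p\<close>.\<close>

lemma E_inject:
  assumes "p \<in> Pn" "q \<in> Pn"
  shows "E p = E q \<longleftrightarrow> p = q"
proof
  assume "E p = E q"
  then have "T (emb p) - T (emb q) \<in> R0"
    unfolding E_def using FPQ_coset_eq_iff[OF T_in_FP T_in_FP] FP_minus[OF T_in_FP T_in_FP] C_emb by simp
  then have "ev (T (emb p)) = ev (T (emb q))" using ev_R0 ev_diff by fastforce
  then show "p = q" by (simp add: T_def ev_frag_of hact_class rho_emb assms)
qed simp

lemma carrier_D: "carrier D = E ` Pn"
proof
  show "carrier D \<subseteq> E ` Pn"
  proof
    fix X assume "X \<in> carrier D"
    then obtain x where x: "keys x \<subseteq> pairs" "X = R0 +>\<^bsub>FP\<^esub> x"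
      unfolding D_eq FPQ_simps by (auto simp: FP_simps)
    have "\<exists>a\<in>C. x - T a \<in> R0"
    proof (rule free_Abelian_group_induct[OF x(1)])
      show "\<exists>a\<in>C. 0 - T a \<in> R0" using R0_closed(3)[OF T_0] C_closed(1) by auto
    next
      fix x y assume "\<exists>a\<in>C. x - T a \<in> R0" "\<exists>a\<in>C. y - T a \<in> R0"
      then obtain a b where ab: "a \<in> C" "b \<in> C" "x - T a \<in> R0" "y - T b \<in> R0" by blast
      have "(x - T a) - (y - T b) - (T (a - b) - (T a - T b)) \<in> R0"
        by (intro R0_closed(4) T_diff ab)
      then show "\<exists>a\<in>C. x - y - T a \<in> R0"
        by (intro bexI[of _ "a - b"] C_diff ab) (simp add: algebra_simps)
    next
      fix k assume "k \<in> pairs"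
      then obtain a z where k: "k = (cl a, z)" "a \<in> C" by (auto simp: carrier_H)
      \<comment> \<open>Scalars belong to the \<open>y\<close>-part, so balancing moves
        \<open>z\<close> to the left factor.\<close>
      have "frag_of (cl (a * scl z), 1) - frag_of (cl a, triv_char (scl z) * 1) \<in> R0"
        using relatorI(3)[OF k(2) Cy_gens(3)] R0_closed(5) by blast
      moreover have "triv_char (scl z) = z"
        by (simp add: triv_char_def scl_def zero_smash_word_def cong: conj_cong)
      ultimately have "T (a * scl z) - frag_of k \<in> R0" by (simp add: T_def k)
      from R0_closed(3)[OF this] have "frag_of k - T (a * scl z) \<in> R0" by simp
      then show "\<exists>a\<in>C. frag_of k - T a \<in> R0" by (intro bexI[of _ "a * scl z"] C_closed C_gens k) simp
    qed
    then obtain a where a: "a \<in> C" "x - T a \<in> R0" by blast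
    then have "X = R0 +>\<^bsub>FP\<^esub> T a"
      unfolding x(2) using FPQ_coset_eq_iff[OF _ T_in_FP, of x a] FP_minus[OF _ T_in_FP, of x a] x(1)
      by (simp add: FP_simps(1))
    then show "X \<in> E ` Pn" using E_rho[OF a(1)] Pn_rho[OF a(1) Pn_1] by blast
  qed
qed (use E_in in blast)

lemma finsum_E:
  assumes "finite F" "\<And>a. a \<in> F \<Longrightarrow> f a \<in> Pn"
  shows "finsum D (\<lambda>a. E (f a)) F = E (\<Sum>a\<in>F. f a)"
proof -
  interpret abelian_group D by (rule abelian_group_D)
  show ?thesis using assms
  proof (induction F rule: finite_induct)
    case empty
    then show ?case by (simp add: E_0)
  next
    case (insert a F)
    then have "finsum D (\<lambda>a. E (f a)) (insert a F) = E (f a) \<oplus>\<^bsub>D\<^esub> finsum D (\<lambda>a. E (f a)) F"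
      by (intro finsum_insert) (auto intro: E_in)
    then show ?case using insert by (simp add: E_add Pn_sum)
  qed
qed

end

section \<open>Submodules of the standard module as stable subspaces\<close>

context dunkl
begin

lemma smult_D_add:
  assumes "h \<in> carrier H" "x \<in> carrier D" "y \<in> carrier D"
  shows "h \<odot>\<^bsub>D\<^esub> (x \<oplus>\<^bsub>D\<^esub> y) = h \<odot>\<^bsub>D\<^esub> x \<oplus>\<^bsub>D\<^esub> h \<odot>\<^bsub>D\<^esub> y"
proof -
  obtain a p q where "h = cl a" "a \<in> C" "x = E p" "p \<in> Pn" "y = E q" "q \<in> Pn"
    using assms by (auto simp: carrier_H carrier_D)
  then show ?thesis
    by (simp add: E_add E_smult Pn_add Pn_rho clinear_add[OF clinear_rho2])
qed

lemma smult_D_closed: "h \<in> carrier H \<Longrightarrow> x \<in> carrier D \<Longrightarrow> h \<odot>\<^bsub>D\<^esub> x \<in> carrier D"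
  by (auto simp: carrier_H carrier_D E_smult Pn_rho)

lemma module_quotient_D: "submodule N H D \<Longrightarrow> module_quotient H D N"
  by (rule module_quotient.intro[OF abelian_group_D]) (simp_all add: smult_D_add smult_D_closed)

lemma E_minus:
  assumes "p \<in> Pn" "q \<in> Pn"
  shows "E p \<ominus>\<^bsub>D\<^esub> E q = E (p - q)"
proof -
  interpret abelian_group D by (rule abelian_group_D)
  have "E (- q) \<oplus>\<^bsub>D\<^esub> E q = \<zero>\<^bsub>D\<^esub>" using assms by (simp add: E_add E_0 Pn_uminus)
  then have "\<ominus>\<^bsub>D\<^esub> E q = E (- q)" by (rule minus_equality[OF _ E_in E_in])
  then show ?thesis using assms by (simp add: a_minus_def E_add Pn_uminus)
qed

lemma submodule_E_image:
  assumes N: "stable N"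
  shows "submodule (E ` N) H D"
proof (rule submodule.intro)
  interpret abelian_group D by (rule abelian_group_D)
  have P: "p \<in> Pn" if "p \<in> N" for p using stableD(1)[OF N that] .
  show "subgroup (E ` N) (add_monoid D)"
  proof (rule add.subgroupI)
    show "E ` N \<subseteq> carrier D" using E_in by blast
    show "E ` N \<noteq> {}" using stableD(2)[OF N] by blast
    show "\<ominus>\<^bsub>D\<^esub> x \<in> E ` N" if x: "x \<in> E ` N" for x
    proof -
      obtain p where p: "x = E p" "p \<in> N" using x by blast
      have "\<ominus>\<^bsub>D\<^esub> x = \<zero>\<^bsub>D\<^esub> \<ominus>\<^bsub>D\<^esub> x" using E_in p by (simp add: a_minus_def)
      also have "\<dots> = E (0 - p)" unfolding E_0[symmetric] p(1) by (rule E_minus) (use P p in auto)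
      finally show ?thesis using stable_diff[OF N stableD(2)[OF N] p(2)] by blast
    qed
    show "x \<oplus>\<^bsub>D\<^esub> y \<in> E ` N" if "x \<in> E ` N" "y \<in> E ` N" for x y
      using that P stableD(3)[OF N] by (auto simp: E_add)
  qed
  show "submodule_axioms (E ` N) H D"
    unfolding submodule_axioms_def using P stable_rho[OF N] by (auto simp: carrier_H E_smult)
qed

lemma submodule_D_stable:
  assumes "submodule N H D"
  shows "stable {p \<in> Pn. E p \<in> N}"
proof -
  interpret submodule N H D by fact
  have smult: "E (rho a p) \<in> N" if "a \<in> C" "p \<in> Pn" "E p \<in> N" for a p
    using smult_closed[OF H_class_in[OF that(1)] that(3)] E_smult[OF that(1,2)] by simp
  have zero: "E 0 \<in> N" using one_closed by (simp add: E_0)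
  have add: "E (p + q) \<in> N" if "p \<in> Pn" "q \<in> Pn" "E p \<in> N" "E q \<in> N" for p q
    using m_closed[OF that(3,4)] E_add[OF that(1,2)] by simp
  show ?thesis
    unfolding stable_def
  proof (intro conjI allI ballI impI)
    show "scl z * f \<in> {p \<in> Pn. E p \<in> N}" if "f \<in> {p \<in> Pn. E p \<in> N}" for z f
      using that smult[OF C_gens(4), of f z] by (simp add: Pn_scl_mult)
    show "pact p f \<in> {p \<in> Pn. E p \<in> N}" if "affected p \<subseteq> {1..n}" "f \<in> {p \<in> Pn. E p \<in> N}" for p f
      using that smult[OF C_gens(3), of p f] by (simp add: Pn_pact)
    show "var i * f \<in> {p \<in> Pn. E p \<in> N}" if "i \<in> {1..n}" "f \<in> {p \<in> Pn. E p \<in> N}" for i f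
      using that smult[OF C_gens(1), of i f] Pn_var_mult[of i f] by simp
    show "dk i f \<in> {p \<in> Pn. E p \<in> N}" if "i \<in> {1..n}" "f \<in> {p \<in> Pn. E p \<in> N}" for i f
      using that smult[OF C_gens(2), of i f] Pn_dk[of i f] by simp
  qed (use zero add in \<open>auto intro: Pn_add\<close>)
qed

lemma submodule_D_eq: "submodule N H D \<Longrightarrow> N = E ` {p \<in> Pn. E p \<in> N}"
  using subgroup.subset[OF submodule.axioms(1), of N H D] carrier_D by auto

end

section \<open>The irreducible quotient and the two bases\<close>

context rational_dunkl
begin

abbreviation "B \<equiv> E ` bad_span"

lemma submodule_B: "submodule B H D"
  by (rule submodule_E_image[OF stable_bad_span])

lemma E_in_B_iff: "p \<in> Pn \<Longrightarrow> E p \<in> B \<longleftrightarrow> p \<in> bad_span"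
  using E_inject stableD(1)[OF stable_bad_span] by blast

lemma submodule_D_cases:
  assumes "submodule N H D"
  shows "N \<subseteq> B \<or> N = carrier D"
proof (cases "{p \<in> Pn. E p \<in> N} \<subseteq> bad_span")
  case True
  then show ?thesis using submodule_D_eq[OF assms] by blast
next
  case False
  then have "{p \<in> Pn. E p \<in> N} = Pn"
    using stable_not_subset_bad_span[OF submodule_D_stable[OF assms]] by blast
  then show ?thesis using submodule_D_eq[OF assms] carrier_D by metis
qed

lemma E_1_notin_B: "E 1 \<notin> B"
  using E_in_B_iff[of 1] one_notin_bad_span by simp

text \<open>The preimage of a submodule of the quotient is a submodule of the standard module, hence
  everything or contained in \<open>B\<close>.\<close>

lemma irreducible_B: "irreducible_module H (quotient_module D B)"
  unfolding irreducible_module_def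
proof (intro conjI allI impI)
  interpret QB: module_quotient H D B by (rule module_quotient_D[OF submodule_B])
  show "carrier QB.Q \<noteq> {\<zero>\<^bsub>QB.Q\<^esub>}"
  proof
    assume "carrier QB.Q = {\<zero>\<^bsub>QB.Q\<^esub>}"
    then have "B +>\<^bsub>D\<^esub> E 1 = B" using QB.Q_closed[OF E_in[of 1]] by (simp add: QB.zero_Q)
    then show False using QB.coset_eq_N_iff[OF E_in] E_1_notin_B by blast
  qed
  fix S assume S: "submodule S H QB.Q"
  let ?N = "{x \<in> carrier D. B +>\<^bsub>D\<^esub> x \<in> S}"
  interpret S: submodule S H QB.Q by fact
  interpret QQ: abelian_group QB.Q by (rule QB.abelian_group_Q)
  have subN: "submodule ?N H D"
  proof (rule submodule.intro)
    show "subgroup ?N (add_monoid D)"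
    proof (rule QB.add.subgroupI)
      show "?N \<noteq> {}" using S.one_closed QB.zero_Q_coset by auto
      show "\<ominus>\<^bsub>D\<^esub> x \<in> ?N" if x: "x \<in> ?N" for x
      proof -
        have xc: "x \<in> carrier D" "\<ominus>\<^bsub>D\<^esub> x \<in> carrier D"
          using x abelian_group.a_inv_closed[OF abelian_group_D] by auto
        have "(B +>\<^bsub>D\<^esub> (\<ominus>\<^bsub>D\<^esub> x)) \<oplus>\<^bsub>QB.Q\<^esub> (B +>\<^bsub>D\<^esub> x) = \<zero>\<^bsub>QB.Q\<^esub>"
          using xc by (simp add: QB.add_Q QB.zero_Q_coset abelian_group.l_neg[OF abelian_group_D])
        then have "\<ominus>\<^bsub>QB.Q\<^esub> (B +>\<^bsub>D\<^esub> x) = B +>\<^bsub>D\<^esub> (\<ominus>\<^bsub>D\<^esub> x)"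
          by (rule QQ.minus_equality) (use xc QB.Q_closed in auto)
        moreover have "\<ominus>\<^bsub>QB.Q\<^esub> (B +>\<^bsub>D\<^esub> x) \<in> S"
          using S.m_inv_closed[of "B +>\<^bsub>D\<^esub> x"] x by (simp add: a_inv_def)
        ultimately show ?thesis using xc by simp
      qed
      show "x \<oplus>\<^bsub>D\<^esub> y \<in> ?N" if "x \<in> ?N" "y \<in> ?N" for x y
        using that S.m_closed[of "B +>\<^bsub>D\<^esub> x" "B +>\<^bsub>D\<^esub> y"] abelian_monoid.a_closed[OF abelian_group.axioms(1)[OF abelian_group_D]]
        by (simp add: QB.add_Q)
    qed blast
    show "submodule_axioms ?N H D"
      unfolding submodule_axioms_def using S.smult_closed smult_D_closed by (auto simp flip: QB.smult_Q)
  qed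
  show "S = {\<zero>\<^bsub>QB.Q\<^esub>} \<or> S = carrier QB.Q"
  proof (cases "?N = carrier D")
    case True
    then have "carrier QB.Q \<subseteq> S" by (auto simp: QB.carrier_Q)
    moreover have "S \<subseteq> carrier QB.Q" using S.subset by simp
    ultimately show ?thesis by blast
  next
    case False
    then have sub: "?N \<subseteq> B" using submodule_D_cases[OF subN] by blast
    have "X = B" if X: "X \<in> S" for X
    proof -
      obtain x where x: "x \<in> carrier D" "X = B +>\<^bsub>D\<^esub> x" using X S.subset by (auto simp: QB.carrier_Q)
      then have "x \<in> B" using sub X by blast
      then show ?thesis using x QB.coset_eq_N_iff by blast
    qed
    moreover have "B \<in> S" using S.one_closed by (simp add: QB.zero_Q)
    ultimately show ?thesis unfolding QB.zero_Q by blast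
  qed
qed

text \<open>A submodule \<open>N\<close> with irreducible quotient is proper, so it lies in
  \<open>B\<close>. The image of \<open>B\<close> in the quotient by \<open>N\<close> is then zero,
  giving \<open>B = N\<close>, or everything; the latter would put \<open>1\<close> into
  \<open>B + N = B\<close>.\<close>

lemma irreducible_unique:
  assumes N: "submodule N H D" and irr: "irreducible_module H (quotient_module D N)"
  shows "N = B"
proof -
  interpret QN: module_quotient H D N by (rule module_quotient_D[OF N])
  interpret QQ: abelian_group QN.Q by (rule QN.abelian_group_Q)
  have "N \<noteq> carrier D"
  proof
    assume "N = carrier D"
    then have "N +>\<^bsub>D\<^esub> x = N" if "x \<in> carrier D" for x using QN.coset_eq_N_iff that by simp
    then have "carrier QN.Q = {N}" unfolding QN.carrier_Q using E_in[of 0] by auto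
    then show False using irr by (simp add: irreducible_module_def QN.zero_Q)
  qed
  then have sub: "N \<subseteq> B" using submodule_D_cases[OF N] by blast
  let ?S = "(\<lambda>x. N +>\<^bsub>D\<^esub> x) ` B"
  interpret B: submodule B H D by (rule submodule_B)
  have Bc: "x \<in> carrier D" if "x \<in> B" for x using that E_in by blast
  have "submodule ?S H QN.Q"
  proof (rule submodule.intro)
    show "subgroup ?S (add_monoid QN.Q)"
    proof (rule QQ.add.subgroupI)
      show "?S \<subseteq> carrier QN.Q" using Bc QN.Q_closed by blast
      show "?S \<noteq> {}" using B.one_closed by blast
      show "\<ominus>\<^bsub>QN.Q\<^esub> X \<in> ?S" if X: "X \<in> ?S" for X
      proof -
        obtain x where x: "x \<in> B" "X = N +>\<^bsub>D\<^esub> x" using X by blast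
        have inv: "\<ominus>\<^bsub>D\<^esub> x \<in> B" using B.m_inv_closed[OF x(1)] by (simp add: a_inv_def)
        have "(N +>\<^bsub>D\<^esub> (\<ominus>\<^bsub>D\<^esub> x)) \<oplus>\<^bsub>QN.Q\<^esub> X = \<zero>\<^bsub>QN.Q\<^esub>"
          using x Bc inv by (simp add: QN.add_Q QN.zero_Q_coset abelian_group.l_neg[OF abelian_group_D])
        then have "\<ominus>\<^bsub>QN.Q\<^esub> X = N +>\<^bsub>D\<^esub> (\<ominus>\<^bsub>D\<^esub> x)"
          by (rule QQ.minus_equality) (use x Bc inv QN.Q_closed in auto)
        then show ?thesis using inv by blast
      qed
      show "X \<oplus>\<^bsub>QN.Q\<^esub> Y \<in> ?S" if XY: "X \<in> ?S" "Y \<in> ?S" for X Y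
      proof -
        obtain x y where xy: "x \<in> B" "X = N +>\<^bsub>D\<^esub> x" "y \<in> B" "Y = N +>\<^bsub>D\<^esub> y" using XY by blast
        have "x \<oplus>\<^bsub>D\<^esub> y \<in> B" using B.m_closed[OF xy(1,3)] by simp
        then show ?thesis using xy QN.add_Q[OF Bc Bc, of x y] by blast
      qed
    qed
    show "submodule_axioms ?S H QN.Q"
      unfolding submodule_axioms_def
    proof (intro allI impI)
      fix h X assume h: "h \<in> carrier H" and "X \<in> ?S"
      then obtain x where x: "x \<in> B" "X = N +>\<^bsub>D\<^esub> x" by blast
      then show "h \<odot>\<^bsub>QN.Q\<^esub> X \<in> ?S" using B.smult_closed[OF h x(1)] QN.smult_Q[OF h Bc[OF x(1)]] by auto
    qed
  qed
  then consider "?S = {N}" | "?S = carrier QN.Q"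
    using irr unfolding irreducible_module_def QN.zero_Q by blast
  then show ?thesis
  proof cases
    case 1
    have "B \<subseteq> N"
    proof
      fix x assume x: "x \<in> B"
      then have "N +>\<^bsub>D\<^esub> x = N" using 1 by (metis imageI singletonD)
      then show "x \<in> N" using QN.coset_eq_N_iff[OF Bc[OF x]] by simp
    qed
    then show ?thesis using sub by (rule subset_antisym[rotated])
  next
    case 2
    then have "N +>\<^bsub>D\<^esub> E 1 \<in> ?S" using QN.Q_closed[OF E_in[of 1]] by simp
    then obtain x where x: "N +>\<^bsub>D\<^esub> E 1 = N +>\<^bsub>D\<^esub> x" "x \<in> B" by (rule imageE)
    then obtain p where p: "p \<in> bad_span" "x = E p" by blast
    have pP: "p \<in> Pn" using stableD(1)[OF stable_bad_span p(1)] .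
    have "E 1 \<ominus>\<^bsub>D\<^esub> x \<in> N" using QN.coset_eq_iff[OF E_in Bc[OF x(2)]] x(1) by simp
    then have "E (1 - p) \<in> B" using sub E_minus[OF Pn_1 pP] p by auto
    then have "1 - p \<in> bad_span" using E_in_B_iff[OF Pn_diff[OF Pn_1 pP]] by blast
    then have "1 - p + p \<in> bad_span" by (rule stableD(3)[OF stable_bad_span _ p(1)])
    then show ?thesis using one_notin_bad_span by simp
  qed
qed

lemma L_kernel_eq: "L_kernel n c = B"
  unfolding L_kernel_def
proof (rule the_equality)
  show "submodule B H D \<and> irreducible_module H (quotient_module D B)"
    by (intro conjI submodule_B irreducible_B)
  show "N = B" if "submodule N H D \<and> irreducible_module H (quotient_module D N)" for N
    using that by (intro irreducible_unique) simp_all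
qed

lemma H_scalar_smult_E: "p \<in> Pn \<Longrightarrow> H_scalar n c z \<odot>\<^bsub>D\<^esub> E p = E (scl z * p)"
  by (simp add: H_scalar_def const_eq_scl E_smult C_gens)

lemma vsum_in_Pn: "(\<Sum>a\<in>F. scl (k a) * V a) \<in> Pn"
  by (intro Pn_sum Pn_scl_mult V_in_Pn)

lemma basis_D: "complex_basis (H_scalar n c) D (seqs n) (\<lambda>a. E (V a))"
  unfolding complex_basis_def
proof (intro conjI allI impI ballI)
  have sum: "(\<Oplus>\<^bsub>D\<^esub>a\<in>F. H_scalar n c (k a) \<odot>\<^bsub>D\<^esub> E (V a)) = E (\<Sum>a\<in>F. scl (k a) * V a)" if "finite F" for F k
    using finsum_E[OF that, of "\<lambda>a. scl (k a) * V a"] by (simp add: H_scalar_smult_E V_in_Pn Pn_scl_mult)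
  show "(\<lambda>a. E (V a)) \<in> seqs n \<rightarrow> carrier D" using E_in by blast
  show "k a = 0" if F: "finite F \<and> F \<subseteq> seqs n \<and> (\<Oplus>\<^bsub>D\<^esub>a\<in>F. H_scalar n c (k a) \<odot>\<^bsub>D\<^esub> E (V a)) = \<zero>\<^bsub>D\<^esub>"
    and "a \<in> F" for F k a
  proof -
    have "E (\<Sum>a\<in>F. scl (k a) * V a) = E 0" using F sum[of F k] by (simp add: E_0)
    then have "(\<Sum>a\<in>F. scl (k a) * V a) = 0"
      using E_inject[OF vsum_in_Pn Pn_0] by blast
    then show ?thesis using V_independent F that(2) by blast
  qed
  show "\<exists>F k. finite F \<and> F \<subseteq> seqs n \<and> x = (\<Oplus>\<^bsub>D\<^esub>a\<in>F. H_scalar n c (k a) \<odot>\<^bsub>D\<^esub> E (V a))" if x: "x \<in> carrier D" for x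
  proof -
    obtain p where p: "x = E p" "p \<in> vspan (seqs n)" using x by (auto simp: carrier_D Pn_eq_vspan)
    then obtain F k where "finite F" "F \<subseteq> seqs n" "p = (\<Sum>a\<in>F. scl (k a) * V a)" by (auto simp: vspan_def)
    then show ?thesis using p(1) sum[of F k] by (intro exI[of _ F] exI[of _ k]) simp
  qed
qed

lemma basis_L: "complex_basis (H_scalar n c) (L_triv n c) {a \<in> seqs n. good a} (\<lambda>a. L_proj n c (E (V a)))"
proof -
  interpret QB: module_quotient H D B by (rule module_quotient_D[OF submodule_B])
  interpret QQ: abelian_group QB.Q by (rule QB.abelian_group_Q)
  have L: "L_triv n c = QB.Q" and proj: "L_proj n c x = B +>\<^bsub>D\<^esub> x" for x
    by (simp_all add: L_triv_def L_proj_def L_kernel_eq)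
  have sc: "H_scalar n c z \<odot>\<^bsub>QB.Q\<^esub> (B +>\<^bsub>D\<^esub> E (V a)) = B +>\<^bsub>D\<^esub> E (scl z * V a)" for z a
  proof -
    have "H_scalar n c z \<in> carrier H" by (simp add: H_scalar_def const_eq_scl H_class_in C_gens)
    then show ?thesis using QB.smult_Q[OF _ E_in] H_scalar_smult_E[OF V_in_Pn] by simp
  qed
  have sum: "(\<Oplus>\<^bsub>QB.Q\<^esub>a\<in>F. H_scalar n c (k a) \<odot>\<^bsub>QB.Q\<^esub> (B +>\<^bsub>D\<^esub> E (V a))) = B +>\<^bsub>D\<^esub> E (\<Sum>a\<in>F. scl (k a) * V a)"
    if "finite F" for F k
    using that unfolding sc
  proof (induction F rule: finite_induct)
    case empty
    then show ?case by (simp add: E_0 QB.zero_Q_coset)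
  next
    case (insert a F)
    have "(\<Oplus>\<^bsub>QB.Q\<^esub>a\<in>insert a F. B +>\<^bsub>D\<^esub> E (scl (k a) * V a))
       = (B +>\<^bsub>D\<^esub> E (scl (k a) * V a)) \<oplus>\<^bsub>QB.Q\<^esub> (B +>\<^bsub>D\<^esub> E (\<Sum>a\<in>F. scl (k a) * V a))"
      unfolding insert.IH[symmetric] by (rule QQ.finsum_insert) (use insert QB.Q_closed[OF E_in] in auto)
    then show ?case using insert by (simp add: QB.add_Q E_in E_add Pn_scl_mult V_in_Pn Pn_sum)
  qed
  show ?thesis
    unfolding complex_basis_def L proj
  proof (intro conjI allI impI ballI)
    show "(\<lambda>a. B +>\<^bsub>D\<^esub> E (V a)) \<in> {a \<in> seqs n. good a} \<rightarrow> carrier QB.Q" using QB.Q_closed[OF E_in] by blast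
    show "k a = 0" if F: "finite F \<and> F \<subseteq> {a \<in> seqs n. good a} \<and>
        (\<Oplus>\<^bsub>QB.Q\<^esub>a\<in>F. H_scalar n c (k a) \<odot>\<^bsub>QB.Q\<^esub> (B +>\<^bsub>D\<^esub> E (V a))) = \<zero>\<^bsub>QB.Q\<^esub>"
      and a: "a \<in> F" for F k a
    proof -
      have "B +>\<^bsub>D\<^esub> E (\<Sum>a\<in>F. scl (k a) * V a) = B" using F sum[of F k] by (simp add: QB.zero_Q)
      then have "E (\<Sum>a\<in>F. scl (k a) * V a) \<in> B" using QB.coset_eq_N_iff[OF E_in] by blast
      then have "(\<Sum>a\<in>F. scl (k a) * V a) \<in> bad_span"
        using E_in_B_iff[OF vsum_in_Pn] by blast
      then show ?thesis using good_independent_mod_bad_span F a by blast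
    qed
    show "\<exists>F k. finite F \<and> F \<subseteq> {a \<in> seqs n. good a} \<and>
        X = (\<Oplus>\<^bsub>QB.Q\<^esub>a\<in>F. H_scalar n c (k a) \<odot>\<^bsub>QB.Q\<^esub> (B +>\<^bsub>D\<^esub> E (V a)))" if X: "X \<in> carrier QB.Q" for X
    proof -
      obtain p where p: "p \<in> Pn" "X = B +>\<^bsub>D\<^esub> E p" using X by (auto simp: QB.carrier_Q carrier_D)
      obtain F k where F: "finite F" "F \<subseteq> {a \<in> seqs n. good a}" "p - (\<Sum>a\<in>F. scl (k a) * V a) \<in> bad_span"
        using Pn_decompose[OF p(1)] by blast
      have "E p \<ominus>\<^bsub>D\<^esub> E (\<Sum>a\<in>F. scl (k a) * V a) \<in> B"
        using E_minus[OF p(1) vsum_in_Pn] F(3) by simp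
      then have "X = B +>\<^bsub>D\<^esub> E (\<Sum>a\<in>F. scl (k a) * V a)"
        unfolding p(2) using QB.coset_eq_iff[OF E_in E_in] by blast
      then show ?thesis using F(1,2) sum[OF F(1), of k] by (intro exI[of _ F] exI[of _ k]) simp
    qed
  qed
qed

lemma H_u_E:
  assumes "i \<in> {1..n}" "p \<in> Pn"
  shows "H_u n c i \<odot>\<^bsub>D\<^esub> E p = E (uop i p)"
proof -
  let ?S = "\<Sum>j\<in>{1..<i}. pg (swp i j)"
  have S: "?S \<in> C" using assms(1) by (intro C_sum C_pg_swap) auto
  have mem: "xg i \<in> C" "yg i \<in> C" using assms(1) C_gens by auto
  have a: "xg i * yg i - scl c * ?S \<in> C"
    by (intro C_diff C_closed(4) mem S C_gens(4))
  have "rho (xg i * yg i - scl c * ?S) p = uop i p"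
    using mem by (simp add: rho_linear rho_mult uop_def)
  then show ?thesis using E_smult[OF a assms(2)] by (simp add: H_u_def const_eq_scl)
qed

lemma H_tau_E:
  assumes "p \<in> Pn"
  shows "H_tau n c \<odot>\<^bsub>D\<^esub> E p = E (tau p)"
proof -
  have mem: "xg 1 \<in> C" "pg (long_cycle n) \<in> C" using C_gens affected_long_cycle n_pos by auto
  then show ?thesis
    using E_smult[OF C_closed(4)[OF mem] assms] by (simp add: H_tau_def rho_mult tau_def)
qed

lemma H_lambda_E:
  assumes "p \<in> Pn"
  shows "H_lambda n c \<odot>\<^bsub>D\<^esub> E p = E (lam p)"
proof -
  have mem: "pg (inverse (long_cycle n)) \<in> C" "yg 1 \<in> C" using C_gens affected_long_cycle n_pos by auto
  then show ?thesis
    using E_smult[OF C_closed(4)[OF mem] assms] by (simp add: H_lambda_def rho_mult lam_def)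
qed

lemma H_s_E:
  assumes "i \<in> {1..<n}" "p \<in> Pn"
  shows "H_s n c i \<odot>\<^bsub>D\<^esub> E p = E (pact (swp i (i + 1)) p)"
proof -
  have "pg (swp i (i + 1)) \<in> C" using assms(1) by (intro C_pg_swap) auto
  then show ?thesis using E_smult[OF _ assms(2)] by (simp add: H_s_def)
qed

end

theorem theorem1p11:
  fixes m n :: nat and c :: complex
  assumes "m > 0" and "n > 0" and "coprime m n"
    and "c = of_nat m / of_nat n"
  shows "\<exists>v :: (nat \<Rightarrow> nat) \<Rightarrow> delta.
    complex_basis (H_scalar n c) (Delta_triv n c) (seqs n) v \<and>
    (\<forall>a \<in> seqs n.
      (\<forall>i \<in> {1..n}.
        H_u n c i \<odot>\<^bsub>Delta_triv n c\<^esub> v a = H_scalar n c (wt n c a i) \<odot>\<^bsub>Delta_triv n c\<^esub> v a) \<and>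
      H_tau n c \<odot>\<^bsub>Delta_triv n c\<^esub> v a = v (pi_seq n a) \<and>
      (a 1 > 0 \<longrightarrow>
        H_lambda n c \<odot>\<^bsub>Delta_triv n c\<^esub> v a
          = H_scalar n c (wt n c a 1) \<odot>\<^bsub>Delta_triv n c\<^esub> v (pi_inv_seq n a)) \<and>
      (a 1 = 0 \<longrightarrow>
        wt n c a 1 = 0 \<and> H_lambda n c \<odot>\<^bsub>Delta_triv n c\<^esub> v a = \<zero>\<^bsub>Delta_triv n c\<^esub>) \<and>
      (\<forall>i \<in> {1..<n}.
        (a i > a (i + 1) \<longrightarrow>
          H_s n c i \<odot>\<^bsub>Delta_triv n c\<^esub> v a
            = v (swap_seq i a) \<oplus>\<^bsub>Delta_triv n c\<^esub>
              H_scalar n c (c / (wt n c a i - wt n c a (i + 1))) \<odot>\<^bsub>Delta_triv n c\<^esub> v a) \<and>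
        (a i < a (i + 1) \<longrightarrow>
          H_s n c i \<odot>\<^bsub>Delta_triv n c\<^esub> v a
            = H_scalar n c ((wt n c a (i + 1) - wt n c a i - c) * (wt n c a (i + 1) - wt n c a i + c)
                / (wt n c a i - wt n c a (i + 1))\<^sup>2) \<odot>\<^bsub>Delta_triv n c\<^esub> v (swap_seq i a)
              \<oplus>\<^bsub>Delta_triv n c\<^esub>
              H_scalar n c (c / (wt n c a i - wt n c a (i + 1))) \<odot>\<^bsub>Delta_triv n c\<^esub> v a) \<and>
        (a i = a (i + 1) \<longrightarrow>
          H_s n c i \<odot>\<^bsub>Delta_triv n c\<^esub> v a = v a))) \<and>
    complex_basis (H_scalar n c) (L_triv n c)
      {a \<in> seqs n. \<forall>i \<in> {1..n}. \<forall>j \<in> {1..n}.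
        \<bar>int (a i) - int (a j)\<bar> \<le> int m \<and> (int (a i) - int (a j) = int m \<longrightarrow> i < j)}
      (\<lambda>a. L_proj n c (v a))"
proof -
  interpret rational_dunkl n c m
    by unfold_locales (use assms in auto)
  have basis_good: "complex_basis (H_scalar n c) (L_triv n c)
      {a \<in> seqs n. \<forall>i \<in> {1..n}. \<forall>j \<in> {1..n}.
        \<bar>int (a i) - int (a j)\<bar> \<le> int m \<and> (int (a i) - int (a j) = int m \<longrightarrow> i < j)}
      (\<lambda>a. L_proj n c (E (V a)))"
    using basis_L unfolding good_def .
  show ?thesis
  proof (rule exI[of _ "\<lambda>a. E (V a)"], intro conjI ballI impI)
    fix a i assume i: "i \<in> {1..n}"
    show "H_u n c i \<odot>\<^bsub>D\<^esub> E (V a) = H_scalar n c (wt n c a i) \<odot>\<^bsub>D\<^esub> E (V a)"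
      using H_u_E[OF i V_in_Pn] uop_V[OF i] H_scalar_smult_E[OF V_in_Pn] by simp
  next
    fix a
    show "H_tau n c \<odot>\<^bsub>D\<^esub> E (V a) = E (V (pi_seq n a))"
      by (simp add: H_tau_E V_in_Pn tau_V)
  next
    fix a :: "nat \<Rightarrow> nat" assume "a 1 > 0"
    then show "H_lambda n c \<odot>\<^bsub>D\<^esub> E (V a) = H_scalar n c (wt n c a 1) \<odot>\<^bsub>D\<^esub> E (V (pi_inv_seq n a))"
      using lam_V[of a] by (simp add: H_lambda_E V_in_Pn H_scalar_smult_E)
  next
    fix a :: "nat \<Rightarrow> nat" assume a: "a 1 = 0"
    show "wt n c a 1 = 0" using wt_1_zero[of a] a .
    show "H_lambda n c \<odot>\<^bsub>D\<^esub> E (V a) = \<zero>\<^bsub>D\<^esub>"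
      using lam_V_zero[of a] a by (simp add: H_lambda_E V_in_Pn E_0)
  next
    fix a :: "nat \<Rightarrow> nat" and i assume i: "i \<in> {1..<n}" and "a i > a (i + 1)"
    then show "H_s n c i \<odot>\<^bsub>D\<^esub> E (V a) = E (V (swap_seq i a)) \<oplus>\<^bsub>D\<^esub>
        H_scalar n c (c / (wt n c a i - wt n c a (i + 1))) \<odot>\<^bsub>D\<^esub> E (V a)"
      using swap_V_gt[of i a]
      by (simp only: H_s_E[OF i] V_in_Pn H_scalar_smult_E E_add Pn_scl_mult)
  next
    fix a :: "nat \<Rightarrow> nat" and i assume i: "i \<in> {1..<n}" and "a i < a (i + 1)"
    then show "H_s n c i \<odot>\<^bsub>D\<^esub> E (V a)
        = H_scalar n c ((wt n c a (i + 1) - wt n c a i - c) * (wt n c a (i + 1) - wt n c a i + c)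
            / (wt n c a i - wt n c a (i + 1))\<^sup>2) \<odot>\<^bsub>D\<^esub> E (V (swap_seq i a)) \<oplus>\<^bsub>D\<^esub>
          H_scalar n c (c / (wt n c a i - wt n c a (i + 1))) \<odot>\<^bsub>D\<^esub> E (V a)"
      using swap_V_lt[of i a]
      by (simp only: H_s_E[OF i] V_in_Pn H_scalar_smult_E E_add Pn_scl_mult)
  next
    fix a :: "nat \<Rightarrow> nat" and i assume "i \<in> {1..<n}" "a i = a (i + 1)"
    then show "H_s n c i \<odot>\<^bsub>D\<^esub> E (V a) = E (V a)"
      using swap_V_eq[of i a] H_s_E[of i "V a"] by (simp only: V_in_Pn)
  qed (rule basis_D basis_good)+
qed

end
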